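(* Let $P = D_t + Q(t,D_x)$ be an $m\times m$ system on $\mathbb{T}\times\mathbb{T}^n$ with matrix symbol $Q(t,\xi)=[c_{j,k}(t)Q_{j,k}(\xi)]_{m\times m}$, and suppose that $Q(t,\xi)$ is a strongly triangularizable symbol with diagonal bounded from below, with eigenvalues $\lambda_1(t,\xi),\dots,\lambda_m(t,\xi)$. For $k=1,\dots,m$ let $\lambda_{0,k}(\xi)=(2\pi)^{-1}\int_0^{2\pi}\lambda_k(t,\xi)\,dt$ and $\mathscr{L}_{0,k}=D_t+\lambda_{0,k}(D_x)$. Then $P$ is globally hypoelliptic if and only if the diagonal system $\mathscr{L}_0=\mathrm{diag}(\mathscr{L}_{0,1},\dots,\mathscr{L}_{0,m})$ is globally hypoelliptic.
   Context: Notation. $\mathbb{T}=\mathbb{R}/2\pi\mathbb{Z}$, $D_t=i^{-1}\partial_t$, variables $t\in\mathbb{T}$, $x\in\mathbb{T}^n$, dual variable $\xi\in\mathbb{Z}^n$; $\mathbb{Z}_+$ is the set of non-negative integers. $\mathcal{D}'_m(\mathbb{T}^{n+1})$ and $C^\infty_m(\mathbb{T}^{n+1})$ are the spaces of $m$-dimensional vectors with coordinates in $\mathcal{D}'(\mathbb{T}^{n+1})$ and $C^\infty(\mathbb{T}^{n+1})$. For $u\in\mathcal{D}'(\mathbb{T}^{n+1})$ the partial Fourier coefficients are $\widehat u(t,\xi)=(2\pi)^{-n}\langle u(t,\cdot),e^{-ix\cdot\xi}\rangle$. Operators. The functions $c_{j,k}$ are smooth and complex-valued on $\mathbb{T}$,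 and $Q_{j,k}(D_x)$ are pseudo-differential operators on $\mathbb{T}^n$: $a(D_x)w(x)=\sum_{\xi\in\mathbb{Z}^n}e^{ix\cdot\xi}a(\xi)\widehat w(\xi)$, where the symbol satisfies $|a(\xi)|\le C|\xi|^{\nu}$ for all $\xi\in\mathbb{Z}^n\setminus\{0\}$, for some $C>0$ and order $\nu\in\mathbb{R}$. $Q(t,D_x)$ is the matrix operator with entries $c_{j,k}(t)Q_{j,k}(D_x)$; it acts on distributions by $\widehat{(Q u)}(t,\xi)=Q(t,\xi)\widehat u(t,\xi)$. Likewise $\lambda_{0,k}(D_x)w(x)=\sum_{\xi\in\mathbb{Z}^n}e^{ix\cdot\xi}\lambda_{0,k}(\xi)\widehat w(\xi)$. Global hypoellipticity. An $m\times m$ system $A$ on $\mathbb{T}^{n+1}$ is globally hypoelliptic if $u\in\mathcal{D}'_m(\mathbb{T}^{n+1})$ and $Au\in C^\infty_m(\mathbb{T}^{n+1})$ imply $u\in C^\infty_m(\mathbb{T}^{n+1})$. Smoothness. $C^\infty(\mathbb{T}\times\mathbb{Z}^n)=\{f:\mathbb{T}\times\mathbb{Z}^n\to\mathbb{C};\ f(\cdot,\xi)\in C^\infty(\mathbb{T})\ \forall\xi\in\mathbb{Z}^n\}$; a matrix is smooth on $\mathbb{T}\times\mathbb{Z}^n$ if its entries belong to this space. Condition (A). $Q(t,\xi)$ satisfies condition (A) if, for each $k$, its eigenvalue $\lambda_k(t,\xi)$ (the eigenvalues $\lambda_1,\dots,\lambda_m$ being listed with multiplicity) satisfies: $\lambda_k\in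 C^\infty(\mathbb{T}\times\mathbb{Z}^n)$; and for each $\alpha\in\mathbb{Z}_+$ there are $C=C(\alpha,k)$ and $\mu_k=\mu_k(\alpha)$ such that $\sup_{t\in\mathbb{T}}|\partial_t^\alpha\lambda_k(t,\xi)|\le C|\xi|^{\mu_k}$ for all sufficiently large $|\xi|$. Strongly triangularizable. A symbol $Q(t,\xi)$ satisfying condition (A) is strongly triangularizable if: (B1) for each $\xi\in\mathbb{Z}^n$ there is a triangularization $S^{-1}(t,\xi)Q(t,\xi)S(t,\xi)=\Lambda(t,\xi)+\mathcal{N}(t,\xi)$, where $\Lambda=\mathrm{diag}(\lambda_1,\dots,\lambda_m)$ and $\mathcal{N}=[r_{j,k}(t,\xi)]$ is a smooth strictly upper triangular matrix (zero diagonal); (B2) $S$ and $S^{-1}$ are smooth on $\mathbb{T}\times\mathbb{Z}^n$ and for any $\alpha\in\mathbb{Z}_+$ there are positive constants $C,R,\gamma$ with $\sup_{t}\|\partial_t^\alpha S(t,\xi)\|_{\mathbb{C}^{m\times m}}\le C|\xi|^\gamma$ and $\sup_{t}\|\partial_t^\alpha S^{-1}(t,\xi)\|_{\mathbb{C}^{m\times m}}\le C|\xi|^\gamma$ for all $|\xi|\ge R$; (B3) for all $\alpha\in\mathbb{Z}_+$ and $N>0$ there are positive constants $C,R$ with $\sup_t\|\partial_t^\alpha B(t,\xi)\|_{\mathbb{C}^{m\times m}}\le C|\xi|^{-N}$ for all $|\xi|\ge R$, where $B(t,\xi)=S^{-1}(t,\xi)\cdot D_tS(t,\xi)$. It is strongly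 triangularizable with diagonal bounded from below if moreover (B4) for each $k\in\{1,\dots,m\}$ there is a positive constant $\theta_k$ with $\Im\lambda_k(t,\xi)\ge-\theta_k$ for all $t\in\mathbb{T}$, $\xi\in\mathbb{Z}^n$. *)

theory Defs
  imports "HOL-Analysis.Analysis"
begin

primrec C_diff :: "nat \<Rightarrow> ('a::euclidean_space \<Rightarrow> 'b::real_normed_vector) \<Rightarrow> bool" where
  "C_diff 0 f \<longleftrightarrow> continuous_on UNIV f"
| "C_diff (Suc k) f \<longleftrightarrow>
     (\<forall>x. f differentiable (at x)) \<and> (\<forall>v. C_diff k (\<lambda>x. frechet_derivative f (at x) v))"

text \<open>A function on a torus is a function on the covering Euclidean space that is
  \<open>2\<pi>\<close>-periodic in each coordinate. The torus of \<open>t\<close> is covered by \<open>real\<close>, and the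
  torus of \<open>(t, x)\<close>, which has dimension \<open>n + 1\<close> for \<open>n = CARD('n)\<close>, by
  \<open>real \<times> real ^ 'n\<close>.\<close>

definition torus_smooth :: "('a::euclidean_space \<Rightarrow> complex) \<Rightarrow> bool" where
  "torus_smooth f \<longleftrightarrow>
     (\<forall>k. C_diff k f) \<and> (\<forall>x. \<forall>b\<in>Basis. f (x + (2 * pi) *\<^sub>R b) = f x)"

primrec iter_partial :: "'a::euclidean_space list \<Rightarrow> ('a \<Rightarrow> complex) \<Rightarrow> 'a \<Rightarrow> complex" where
  "iter_partial [] f = f"
| "iter_partial (b # bs) f = (\<lambda>x. frechet_derivative (iter_partial bs f) (at x) b)"

definition t_deriv :: "nat \<Rightarrow> (real \<Rightarrow> 'b::real_normed_vector) \<Rightarrow> real \<Rightarrow> 'b" where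
  "t_deriv k = (\<lambda>f t. vector_derivative f (at t)) ^^ k"

definition D_t :: "(real \<Rightarrow> complex) \<Rightarrow> real \<Rightarrow> complex" where
  "D_t f t = inverse \<i> * vector_derivative f (at t)"

text \<open>Distributions on a torus are the continuous linear functionals on its smooth functions.
  They are represented by total functions, whose values at functions that are not smooth and
  periodic play no role.\<close>

definition test_seminorm :: "nat \<Rightarrow> ('a::euclidean_space \<Rightarrow> complex) \<Rightarrow> real" where
  "test_seminorm N \<phi> =
     (\<Sum>bs | set bs \<subseteq> Basis \<and> length bs \<le> N. SUP x. cmod (iter_partial bs \<phi> x))"

definition torus_distribution :: "(('a::euclidean_space \<Rightarrow> complex) \<Rightarrow> complex) \<Rightarrow> bool" where
  "torus_distribution u \<longleftrightarrow>
     (\<forall>\<phi> \<psi> a b. torus_smooth \<phi> \<longrightarrow> torus_smooth \<psi> \<longrightarrow>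
        u (\<lambda>x. a * \<phi> x + b * \<psi> x) = a * u \<phi> + b * u \<psi>) \<and>
     (\<exists>C N. \<forall>\<phi>. torus_smooth \<phi> \<longrightarrow> cmod (u \<phi>) \<le> C * test_seminorm N \<phi>)"

definition smooth_distribution :: "(('a::euclidean_space \<Rightarrow> complex) \<Rightarrow> complex) \<Rightarrow> bool" where
  "smooth_distribution u \<longleftrightarrow>
     (\<exists>f. torus_smooth f \<and>
        (\<forall>\<phi>. torus_smooth \<phi> \<longrightarrow>
           u \<phi> = integral (cbox 0 ((2 * pi) *\<^sub>R One)) (\<lambda>x. f x * \<phi> x)))"

type_synonym 'n distr = "(real \<times> (real, 'n) vec \<Rightarrow> complex) \<Rightarrow> complex"

definition globally_hypoelliptic ::
    "(('m::finite \<Rightarrow> 'n::finite distr) \<Rightarrow> 'm \<Rightarrow> 'n distr) \<Rightarrow> bool" where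
  "globally_hypoelliptic A \<longleftrightarrow>
     (\<forall>u. (\<forall>k. torus_distribution (u k)) \<longrightarrow> (\<forall>k. smooth_distribution (A u k)) \<longrightarrow>
        (\<forall>k. smooth_distribution (u k)))"

definition zvec :: "int ^ 'n \<Rightarrow> real ^ 'n" where
  "zvec \<xi> = (\<chi> i. real_of_int (\<xi> $ i))"

text \<open>The transpose of \<open>D\<^sub>t\<close> is \<open>- D\<^sub>t\<close>.\<close>

definition distr_Dt :: "'n::finite distr \<Rightarrow> 'n distr" where
  "distr_Dt u \<phi> = - u (\<lambda>(t, x). D_t (\<lambda>s. \<phi> (s, x)) t)"

definition distr_mult :: "(real \<Rightarrow> complex) \<Rightarrow> 'n::finite distr \<Rightarrow> 'n distr" where
  "distr_mult c u \<phi> = u (\<lambda>(t, x). c t * \<phi> (t, x))"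

text \<open>The partial Fourier coefficient \<open>(2\<pi>)\<^sup>-\<^sup>n \<langle>u(t, \<cdot>), exp (- i x \<cdot> \<xi>)\<rangle>\<close>, a
  distribution in \<open>t\<close>, paired with a test function \<open>\<psi>\<close> of \<open>t\<close>.\<close>

definition partial_fourier :: "'n::finite distr \<Rightarrow> int ^ 'n \<Rightarrow> (real \<Rightarrow> complex) \<Rightarrow> complex" where
  "partial_fourier u \<xi> \<psi> =
     u (\<lambda>(t, x). \<psi> t * cis (- (x \<bullet> zvec \<xi>))) / (2 * of_real pi) ^ CARD('n)"

text \<open>\<open>a(D\<^sub>x) u\<close> is the sum over \<open>\<xi>\<close> of \<open>a(\<xi>) exp (i x \<cdot> \<xi>)\<close> times the partial Fourier
  coefficient of \<open>u\<close> at \<open>\<xi>\<close>; each term is paired with \<open>\<phi>\<close> by first integrating in \<open>x\<close>.\<close>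

definition distr_pdo :: "(int ^ 'n \<Rightarrow> complex) \<Rightarrow> 'n::finite distr \<Rightarrow> 'n distr" where
  "distr_pdo a u \<phi> =
     (\<Sum>\<^sub>\<infinity>\<xi>\<in>UNIV. a \<xi> * partial_fourier u \<xi>
        (\<lambda>t. integral (cbox 0 ((2 * pi) *\<^sub>R One)) (\<lambda>x. cis (x \<bullet> zvec \<xi>) * \<phi> (t, x))))"

definition pdo_symbol :: "(int ^ 'n \<Rightarrow> complex) \<Rightarrow> bool" where
  "pdo_symbol a \<longleftrightarrow> (\<exists>C>0. \<exists>\<nu>. \<forall>\<xi>. \<xi> \<noteq> 0 \<longrightarrow> cmod (a \<xi>) \<le> C * norm (zvec \<xi>) powr \<nu>)"

definition system_op ::
    "('m::finite \<Rightarrow> 'm \<Rightarrow> real \<Rightarrow> complex) \<Rightarrow> ('m \<Rightarrow> 'm \<Rightarrow> int ^ 'n \<Rightarrow> complex) \<Rightarrow>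
     ('m \<Rightarrow> 'n::finite distr) \<Rightarrow> 'm \<Rightarrow> 'n distr" where
  "system_op c q u j \<phi> =
     distr_Dt (u j) \<phi> + (\<Sum>k\<in>UNIV. distr_mult (c j k) (distr_pdo (q j k) (u k)) \<phi>)"

definition scalar_op :: "(int ^ 'n \<Rightarrow> complex) \<Rightarrow> 'n::finite distr \<Rightarrow> 'n distr" where
  "scalar_op a u \<phi> = distr_Dt u \<phi> + distr_pdo a u \<phi>"

definition diag_system ::
    "('m::finite \<Rightarrow> 'n::finite distr \<Rightarrow> 'n distr) \<Rightarrow> ('m \<Rightarrow> 'n distr) \<Rightarrow> 'm \<Rightarrow> 'n distr" where
  "diag_system L u k = L k (u k)"

definition matrix_symbol ::
    "('m::finite \<Rightarrow> 'm \<Rightarrow> real \<Rightarrow> complex) \<Rightarrow> ('m \<Rightarrow> 'm \<Rightarrow> int ^ 'n \<Rightarrow> complex) \<Rightarrow>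
     real \<Rightarrow> int ^ 'n \<Rightarrow> complex ^ 'm ^ 'm" where
  "matrix_symbol c q t \<xi> = (\<chi> j k. c j k t * q j k \<xi>)"

definition smooth_symbol :: "(real \<Rightarrow> int ^ 'n \<Rightarrow> complex) \<Rightarrow> bool" where
  "smooth_symbol f \<longleftrightarrow> (\<forall>\<xi>. torus_smooth (\<lambda>t. f t \<xi>))"

definition smooth_matrix_symbol :: "(real \<Rightarrow> int ^ 'n \<Rightarrow> complex ^ 'm ^ 'm) \<Rightarrow> bool" where
  "smooth_matrix_symbol S \<longleftrightarrow> (\<forall>j k. smooth_symbol (\<lambda>t \<xi>. S t \<xi> $ j $ k))"

text \<open>\<open>l\<close> lists the eigenvalues of \<open>M\<close> with algebraic multiplicity: the characteristic
  polynomial of \<open>M\<close> is the product of the \<open>z - l k\<close>.\<close>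

definition eigenvalue_list :: "complex ^ 'm ^ 'm \<Rightarrow> ('m::finite \<Rightarrow> complex) \<Rightarrow> bool" where
  "eigenvalue_list M l \<longleftrightarrow> (\<forall>z. det (mat z - M) = (\<Prod>k\<in>UNIV. z - l k))"

definition condition_A ::
    "(real \<Rightarrow> int ^ 'n \<Rightarrow> complex ^ 'm ^ 'm) \<Rightarrow> ('m::finite \<Rightarrow> real \<Rightarrow> int ^ 'n \<Rightarrow> complex) \<Rightarrow> bool"
  where
  "condition_A Q eig \<longleftrightarrow>
     (\<forall>t \<xi>. eigenvalue_list (Q t \<xi>) (\<lambda>k. eig k t \<xi>)) \<and>
     (\<forall>k. smooth_symbol (eig k)) \<and>
     (\<forall>k \<alpha>. \<exists>C \<mu> R. \<forall>\<xi>. norm (zvec \<xi>) \<ge> R \<longrightarrow>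
        (\<forall>t. cmod (t_deriv \<alpha> (\<lambda>s. eig k s \<xi>) t) \<le> C * norm (zvec \<xi>) powr \<mu>))"

definition diag_mat :: "('m \<Rightarrow> complex) \<Rightarrow> complex ^ 'm ^ 'm" where
  "diag_mat l = (\<chi> j k. if j = k then l k else 0)"

definition strictly_upper_triangular :: "complex ^ ('m::{finite, linorder}) ^ ('m::{finite, linorder}) \<Rightarrow> bool" where
  "strictly_upper_triangular M \<longleftrightarrow> (\<forall>j k. k \<le> j \<longrightarrow> M $ j $ k = 0)"

definition matrix_D_t :: "(real \<Rightarrow> complex ^ 'm ^ 'm) \<Rightarrow> real \<Rightarrow> complex ^ 'm ^ 'm" where
  "matrix_D_t S t = (\<chi> j k. D_t (\<lambda>s. S s $ j $ k) t)"

definition matrix_poly_bounded :: "(real \<Rightarrow> int ^ 'n \<Rightarrow> complex ^ 'm ^ 'm) \<Rightarrow> bool" where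
  "matrix_poly_bounded S \<longleftrightarrow>
     (\<forall>\<alpha>. \<exists>C>0. \<exists>R>0. \<exists>\<gamma>>0. \<forall>\<xi>. norm (zvec \<xi>) \<ge> R \<longrightarrow>
        (\<forall>t. norm (t_deriv \<alpha> (\<lambda>s. S s \<xi>) t) \<le> C * norm (zvec \<xi>) powr \<gamma>))"

definition matrix_rapidly_decreasing :: "(real \<Rightarrow> int ^ 'n \<Rightarrow> complex ^ 'm ^ 'm) \<Rightarrow> bool" where
  "matrix_rapidly_decreasing B \<longleftrightarrow>
     (\<forall>\<alpha>. \<forall>N>0. \<exists>C>0. \<exists>R>0. \<forall>\<xi>. norm (zvec \<xi>) \<ge> R \<longrightarrow>
        (\<forall>t. norm (t_deriv \<alpha> (\<lambda>s. B s \<xi>) t) \<le> C * norm (zvec \<xi>) powr (- N)))"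

definition strongly_triangularizable ::
    "(real \<Rightarrow> int ^ 'n \<Rightarrow> complex ^ ('m::{finite, linorder}) ^ ('m::{finite, linorder})) \<Rightarrow>
     ('m \<Rightarrow> real \<Rightarrow> int ^ 'n \<Rightarrow> complex) \<Rightarrow> bool" where
  "strongly_triangularizable Q eig \<longleftrightarrow>
     condition_A Q eig \<and>
     (\<exists>S \<N>.
        (\<forall>t \<xi>. invertible (S t \<xi>)) \<and>
        (\<forall>t \<xi>. matrix_inv (S t \<xi>) ** Q t \<xi> ** S t \<xi> = diag_mat (\<lambda>k. eig k t \<xi>) + \<N> t \<xi>) \<and>
        smooth_matrix_symbol \<N> \<and>
        (\<forall>t \<xi>. strictly_upper_triangular (\<N> t \<xi>)) \<and>
        smooth_matrix_symbol S \<and>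
        smooth_matrix_symbol (\<lambda>t \<xi>. matrix_inv (S t \<xi>)) \<and>
        matrix_poly_bounded S \<and>
        matrix_poly_bounded (\<lambda>t \<xi>. matrix_inv (S t \<xi>)) \<and>
        matrix_rapidly_decreasing
          (\<lambda>t \<xi>. matrix_inv (S t \<xi>) ** matrix_D_t (\<lambda>s. S s \<xi>) t))"

definition diagonal_bounded_below :: "('m \<Rightarrow> real \<Rightarrow> int ^ 'n \<Rightarrow> complex) \<Rightarrow> bool" where
  "diagonal_bounded_below eig \<longleftrightarrow> (\<forall>k. \<exists>\<theta>>0. \<forall>t \<xi>. Im (eig k t \<xi>) \<ge> - \<theta>)"

definition t_mean :: "(real \<Rightarrow> int ^ 'n \<Rightarrow> complex) \<Rightarrow> int ^ 'n \<Rightarrow> complex" where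
  "t_mean f \<xi> = integral {0..2 * pi} (\<lambda>t. f t \<xi>) / (2 * of_real pi)"

end

theory Submission
  imports Defs
begin

text \<open>Taking Fourier coefficients in \<open>x\<close> turns \<open>P u = f\<close> into a family of linear systems of ordinary
  differential equations on the circle, indexed by \<open>\<xi>\<close>. Smoothness of \<open>f\<close> forces the coefficients of
  \<open>u\<close> to be smooth in \<open>t\<close> with derivatives growing at most polynomially in \<open>\<xi>\<close>, and \<open>u\<close> is smooth
  exactly when they decay rapidly. The substitution \<open>u = S v\<close> makes the systems triangular up to the
  rapidly decaying term \<open>B\<close>, and each scalar equation \<open>D\<^sub>t v + \<lambda>\<^sub>k v = g\<close> is solved by an explicit
  integral divided by \<open>exp (2\<pi>\<i> \<lambda>\<^sub>0\<^sub>,\<^sub>k(\<xi>)) - 1\<close>, where the lower bound on \<open>Im \<lambda>\<^sub>k\<close> keeps the integral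
  under control. Hence both \<open>P\<close> and the diagonal system are globally hypoelliptic if and only if, for
  every \<open>k\<close>, this divisor is bounded below by a negative power of \<open>\<bar>\<xi>\<bar>\<close> for large \<open>\<xi>\<close>: back
  substitution gives one direction, and for the other one starts from an approximate solution of
  the homogeneous equation in the first row \<open>k\<close> for which the bound fails and solves the rows above
  it. The diagonal system is treated as the special case \<open>S = 1\<close>.\<close>

subsection \<open>Smooth functions and seminorms on the torus\<close>

text \<open>Two uniformities carry the argument. A solution is known to grow at most polynomially in
  \<xi> before anything is known about its decay, so the perturbation \<open>B v\<close> is rapidly
  decaying from the outset and can be moved to the right-hand side. And every operation on the
  coefficients, be it applying \<open>S\<close>, its inverse or the nilpotent part, or dividing by
  the divisor, costs only a power of |\<xi>|, so one calculus covers polynomial growth and rapid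
  decay at once. The approximate solution comes from moving the mean to a nearby resonance: if exp(2
  pi i \<mu>) equals exp(2 pi i times the mean), the eigenvalue minus \<mu> has an integer mean and
  an exact periodic solution. The principal logarithm makes \<mu> as small as the divisor, so the
  error \<mu> v decays rapidly along the frequencies where the divisor does. Strict upper
  triangularity feeds component k only into rows before k, and minimality of k gives these good
  divisors; their components may grow polynomially, since component k alone already fails to
  decay.\<close>

lemma C_diff_SucD: "C_diff (Suc k) f \<Longrightarrow> C_diff k f"
proof (induction k arbitrary: f)
  case 0
  then show ?case
    by (auto simp: continuous_on_eq_continuous_at intro: differentiable_imp_continuous_within)
next
  case (Suc k)
  then show ?case by simp
qed

lemma C_diff_continuous: "C_diff k f \<Longrightarrow> continuous_on UNIV f"
proof (induction k)
  case (Suc k)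
  then show ?case using C_diff_SucD by blast
qed simp

text \<open>Derivatives are unique, so it suffices to exhibit some derivative \<open>f'\<close>
  whose directional slices are smooth enough; the choice made by \<open>frechet_derivative\<close>
  then agrees with it.\<close>

lemma C_diff_Suc_has_derivativeI:
  assumes "\<And>x. (f has_derivative f' x) (at x)" "\<And>v. C_diff k (\<lambda>x. f' x v)"
  shows "C_diff (Suc k) f"
proof -
  have "frechet_derivative f (at x) = f' x" for x
    by (rule frechet_derivative_at[OF assms(1), symmetric])
  with assms show ?thesis by (auto simp: differentiable_def)
qed

lemma C_diff_Suc_has_derivative:
  assumes "C_diff (Suc k) f"
  shows "(f has_derivative frechet_derivative f (at x)) (at x)"
  using assms by (simp flip: frechet_derivative_works)

lemma C_diff_const: "C_diff k (\<lambda>x. c)"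
proof (induction k arbitrary: c)
  case (Suc k)
  show ?case
    by (rule C_diff_Suc_has_derivativeI[where f' = "\<lambda>x v. 0"]) (auto intro: Suc derivative_eq_intros)
qed auto

lemma C_diff_add:
  "C_diff k f \<Longrightarrow> C_diff k g \<Longrightarrow> C_diff k (\<lambda>x. f x + g x)"
proof (induction k arbitrary: f g)
  case (Suc k)
  show ?case
    by (rule C_diff_Suc_has_derivativeI
        [where f' = "\<lambda>x v. frechet_derivative f (at x) v + frechet_derivative g (at x) v"])
      (use Suc in \<open>auto intro!: has_derivative_add C_diff_Suc_has_derivative\<close>)
qed (auto intro: continuous_intros)

lemma C_diff_mult:
  fixes f g :: "'a::euclidean_space \<Rightarrow> complex"
  shows "C_diff k f \<Longrightarrow> C_diff k g \<Longrightarrow> C_diff k (\<lambda>x. f x * g x)"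
proof (induction k arbitrary: f g)
  case (Suc k)
  note * = C_diff_SucD[OF Suc.prems(1)] C_diff_SucD[OF Suc.prems(2)]
  show ?case
    by (rule C_diff_Suc_has_derivativeI
        [where f' = "\<lambda>x v. f x * frechet_derivative g (at x) v + frechet_derivative f (at x) v * g x"])
      (use Suc * in \<open>auto intro!: has_derivative_mult C_diff_add simp flip: frechet_derivative_works\<close>)
qed (auto intro: continuous_intros)

lemma C_diff_compose_linear:
  assumes L: "bounded_linear L"
  shows "C_diff k f \<Longrightarrow> C_diff k (\<lambda>x. f (L x))"
proof (induction k arbitrary: f)
  case 0
  then show ?case
    using continuous_on_compose2[of UNIV f UNIV L] L by (auto simp: linear_continuous_on)
next
  case (Suc k)
  show ?case
    by (rule C_diff_Suc_has_derivativeI[where f' = "\<lambda>x v. frechet_derivative f (at (L x)) (L v)"])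
      (use Suc in \<open>auto intro!: has_derivative_compose[OF bounded_linear_imp_has_derivative[OF L]] C_diff_Suc_has_derivative\<close>)
qed

lemma torus_smooth_has_derivative:
  "torus_smooth f \<Longrightarrow> (f has_derivative frechet_derivative f (at x)) (at x)"
  unfolding torus_smooth_def using C_diff_Suc_has_derivative by blast

lemma torus_smooth_differentiable: "torus_smooth f \<Longrightarrow> f differentiable (at x)"
  using torus_smooth_has_derivative differentiable_def by blast

lemma torus_smooth_continuous: "torus_smooth f \<Longrightarrow> continuous_on S f"
  unfolding torus_smooth_def using C_diff_continuous continuous_on_subset by blast

lemma torus_smooth_periodic: "torus_smooth f \<Longrightarrow> b \<in> Basis \<Longrightarrow> f (x + (2 * pi) *\<^sub>R b) = f x"
  unfolding torus_smooth_def by blast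

lemma torus_smooth_const: "torus_smooth (\<lambda>x. c)"
  by (simp add: torus_smooth_def C_diff_const)

lemma torus_smooth_add: "torus_smooth f \<Longrightarrow> torus_smooth g \<Longrightarrow> torus_smooth (\<lambda>x. f x + g x)"
  by (simp add: torus_smooth_def C_diff_add del: C_diff.simps)

lemma torus_smooth_mult: "torus_smooth f \<Longrightarrow> torus_smooth g \<Longrightarrow> torus_smooth (\<lambda>x. f x * g x)"
  by (simp add: torus_smooth_def C_diff_mult del: C_diff.simps)

lemma torus_smooth_cmult: "torus_smooth f \<Longrightarrow> torus_smooth (\<lambda>x. c * f x)"
  by (simp add: torus_smooth_mult torus_smooth_const)

lemma torus_smooth_sum: "(\<And>i. i \<in> A \<Longrightarrow> torus_smooth (f i)) \<Longrightarrow> torus_smooth (\<lambda>x. \<Sum>i\<in>A. f i x)"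
  by (induction A rule: infinite_finite_induct) (auto intro: torus_smooth_add torus_smooth_const)

lemma torus_smooth_minus: "torus_smooth f \<Longrightarrow> torus_smooth (\<lambda>x. - f x)"
  using torus_smooth_cmult[of f "-1"] by simp

lemma torus_smooth_diff: "torus_smooth f \<Longrightarrow> torus_smooth g \<Longrightarrow> torus_smooth (\<lambda>x. f x - g x)"
  using torus_smooth_add[OF _ torus_smooth_minus, of f g] by simp

lemma torus_smooth_frechet:
  assumes f: "torus_smooth f"
  shows "torus_smooth (\<lambda>x. frechet_derivative f (at x) v)"
  unfolding torus_smooth_def
proof (intro conjI allI ballI)
  fix k
  have "C_diff (Suc k) f" using f unfolding torus_smooth_def by blast
  then show "C_diff k (\<lambda>x. frechet_derivative f (at x) v)" by simp
next
  fix x b :: 'a assume b: "b \<in> Basis"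
  have "((\<lambda>y. f (y + (2 * pi) *\<^sub>R b)) has_derivative frechet_derivative f (at (x + (2 * pi) *\<^sub>R b))) (at x)"
    by (rule has_derivative_compose[OF _ torus_smooth_has_derivative[OF f],
          of "\<lambda>y. y + (2 * pi) *\<^sub>R b" "\<lambda>y. y"]) (auto intro!: derivative_eq_intros)
  moreover have "(\<lambda>y. f (y + (2 * pi) *\<^sub>R b)) = f"
    using torus_smooth_periodic[OF f b] by auto
  ultimately have "(f has_derivative frechet_derivative f (at (x + (2 * pi) *\<^sub>R b))) (at x)" by simp
  then show "frechet_derivative f (at (x + (2 * pi) *\<^sub>R b)) v = frechet_derivative f (at x) v"
    using frechet_derivative_at[of f] by simp
qed

lemma torus_smooth_iter_partial: "torus_smooth f \<Longrightarrow> torus_smooth (iter_partial bs f)"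
  by (induction bs) (auto intro: torus_smooth_frechet)

text \<open>The translation is composed one basis direction at a time, and in each direction by
  induction upwards and downwards from 0.\<close>

lemma torus_periodic_lattice:
  assumes per: "\<And>x b. b \<in> Basis \<Longrightarrow> f (x + (2 * pi) *\<^sub>R b) = f x"
    and k: "\<And>b. b \<in> Basis \<Longrightarrow> z \<bullet> b \<in> \<int>"
  shows "f (x + (2 * pi) *\<^sub>R z) = f (x::'a::euclidean_space)"
proof -
  have step: "f (x + (2 * pi * of_int n) *\<^sub>R b) = f x" if b: "b \<in> Basis" for n :: int and b x
  proof (induction n rule: int_induct[of _ 0])
    case (step1 i)
    have "f (x + (2 * pi * of_int (i + 1)) *\<^sub>R b) = f ((x + (2 * pi * of_int i) *\<^sub>R b) + (2 * pi) *\<^sub>R b)"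
      by (simp add: algebra_simps)
    with per[OF b] step1 show ?case by simp
  next
    case (step2 i)
    have "f (x + (2 * pi * of_int i) *\<^sub>R b) = f ((x + (2 * pi * of_int (i - 1)) *\<^sub>R b) + (2 * pi) *\<^sub>R b)"
      by (simp add: algebra_simps)
    with per[OF b] step2 show ?case by simp
  qed simp
  have "f (x + (2 * pi) *\<^sub>R (\<Sum>b\<in>A. (z \<bullet> b) *\<^sub>R b)) = f x" if "A \<subseteq> Basis" "finite A" for A
    using that(2,1)
  proof (induction A arbitrary: x)
    case (insert b A)
    obtain n where n: "z \<bullet> b = of_int n" using k[of b] insert.prems by (auto simp: Ints_def)
    have "f (x + (2 * pi) *\<^sub>R (\<Sum>b\<in>insert b A. (z \<bullet> b) *\<^sub>R b)) =
      f ((x + (2 * pi * of_int n) *\<^sub>R b) + (2 * pi) *\<^sub>R (\<Sum>b\<in>A. (z \<bullet> b) *\<^sub>R b))"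
      using insert.hyps n by (simp add: algebra_simps)
    then show ?case using insert step by simp
  qed simp
  from this[of Basis] show ?thesis by (simp add: euclidean_representation)
qed

lemma torus_reduce:
  obtains z where "\<And>b. b \<in> Basis \<Longrightarrow> z \<bullet> b \<in> \<int>"
    "(x::'a::euclidean_space) + (2 * pi) *\<^sub>R z \<in> cbox 0 ((2 * pi) *\<^sub>R One)"
proof
  define z :: 'a where "z = (\<Sum>b\<in>Basis. of_int (- \<lfloor>(x \<bullet> b) / (2 * pi)\<rfloor>) *\<^sub>R b)"
  have z: "z \<bullet> b = of_int (- \<lfloor>(x \<bullet> b) / (2 * pi)\<rfloor>)" if "b \<in> Basis" for b
    unfolding z_def using that by (subst inner_sum_left_Basis) auto
  show "z \<bullet> b \<in> \<int>" if "b \<in> Basis" for b using z that by simp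
  show "x + (2 * pi) *\<^sub>R z \<in> cbox 0 ((2 * pi) *\<^sub>R One)"
    unfolding mem_box
  proof (intro ballI conjI)
    fix b :: 'a assume b: "b \<in> Basis"
    have 1: "2 * pi * of_int \<lfloor>(x \<bullet> b) / (2 * pi)\<rfloor> \<le> x \<bullet> b"
      using of_int_floor_le[of "(x \<bullet> b) / (2 * pi)"] pos_le_divide_eq[of "2 * pi"]
      by (simp only: pi_gt_zero zero_less_mult_iff zero_less_numeral simp_thms mult.commute)
    have "(x \<bullet> b) / (2 * pi) \<le> of_int \<lfloor>(x \<bullet> b) / (2 * pi)\<rfloor> + 1" by linarith
    then have 2: "x \<bullet> b \<le> 2 * pi * of_int \<lfloor>(x \<bullet> b) / (2 * pi)\<rfloor> + 2 * pi"
      by (simp add: pos_divide_le_eq algebra_simps)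
    show "0 \<bullet> b \<le> (x + (2 * pi) *\<^sub>R z) \<bullet> b" using 1 b by (simp add: inner_add_left z)
    show "(x + (2 * pi) *\<^sub>R z) \<bullet> b \<le> ((2 * pi) *\<^sub>R One) \<bullet> b" using 2 b by (simp add: inner_add_left z)
  qed
qed

text \<open>Suprema and zeros of a periodic function can therefore be sought on the compact
  cell.\<close>

lemma torus_smooth_cell:
  assumes "torus_smooth f"
  obtains y where "y \<in> cbox 0 ((2 * pi) *\<^sub>R One)" "f y = f x"
proof -
  obtain z where z: "\<And>b. b \<in> Basis \<Longrightarrow> z \<bullet> b \<in> \<int>"
    "x + (2 * pi) *\<^sub>R z \<in> cbox 0 ((2 * pi) *\<^sub>R One)" by (rule torus_reduce[of x]) blast
  then show thesis
    using torus_periodic_lattice[of f z x] torus_smooth_periodic[OF assms] that by blast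
qed

text \<open>\<open>test_seminorm\<close> and later majorants are written with \<open>SUP\<close>,
  which is an upper bound only over bounded sets; compactness of the cell supplies the
  bound.\<close>

lemma torus_smooth_bdd_above:
  assumes f: "torus_smooth f"
  shows "bdd_above (range (\<lambda>x. cmod (f x)))"
proof -
  have "bounded (f ` cbox 0 ((2 * pi) *\<^sub>R One))"
    by (intro compact_imp_bounded compact_continuous_image torus_smooth_continuous f compact_cbox)
  then obtain B where B: "\<And>y. y \<in> cbox 0 ((2 * pi) *\<^sub>R One) \<Longrightarrow> cmod (f y) \<le> B"
    by (auto simp: bounded_iff)
  have "cmod (f x) \<le> B" for x
    by (rule torus_smooth_cell[OF f, of x]) (use B in metis)
  then show ?thesis by (auto intro!: bdd_aboveI[of _ B])
qed

section \<open>Seminorms under differentiation and multiplication\<close>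

lemma cmod_iter_partial_le_SUP:
  "torus_smooth f \<Longrightarrow> cmod (iter_partial bs f x) \<le> (SUP x. cmod (iter_partial bs f x))"
  by (intro cSUP_upper torus_smooth_bdd_above torus_smooth_iter_partial) auto

lemma finite_Basis_lists: "finite {bs. set bs \<subseteq> (Basis :: 'a::euclidean_space set) \<and> length bs \<le> N}"
  using finite_lists_length_le[of Basis N] by simp

lemma SUP_iter_partial_nonneg:
  fixes f :: "'a::euclidean_space \<Rightarrow> complex"
  assumes "torus_smooth f"
  shows "0 \<le> (SUP x. cmod (iter_partial bs f x))"
  by (rule order_trans[OF norm_ge_zero cmod_iter_partial_le_SUP[OF assms, of bs 0]])

lemma SUP_iter_partial_le_test_seminorm:
  fixes f :: "'a::euclidean_space \<Rightarrow> complex"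
  assumes "torus_smooth f" "set bs \<subseteq> Basis" "length bs \<le> N"
  shows "(SUP x. cmod (iter_partial bs f x)) \<le> test_seminorm N f"
  unfolding test_seminorm_def
  by (rule member_le_sum[of bs _ "\<lambda>bs. SUP x. cmod (iter_partial bs f x)"])
    (use assms finite_Basis_lists SUP_iter_partial_nonneg in auto)

lemma cmod_iter_partial_le_test_seminorm:
  assumes "torus_smooth f" "set bs \<subseteq> Basis" "length bs \<le> N"
  shows "cmod (iter_partial bs f x) \<le> test_seminorm N f"
  by (rule order_trans[OF cmod_iter_partial_le_SUP SUP_iter_partial_le_test_seminorm]) (fact assms)+

lemma test_seminorm_nonneg: "torus_smooth f \<Longrightarrow> 0 \<le> test_seminorm N f"
  unfolding test_seminorm_def by (intro sum_nonneg SUP_iter_partial_nonneg)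

lemma test_seminorm_mono:
  fixes f :: "'a::euclidean_space \<Rightarrow> complex"
  assumes "torus_smooth f" "N \<le> M"
  shows "test_seminorm N f \<le> test_seminorm M f"
  unfolding test_seminorm_def
  by (rule sum_mono2) (use assms finite_Basis_lists SUP_iter_partial_nonneg in auto)

lemma test_seminorm_leI:
  fixes f :: "'a::euclidean_space \<Rightarrow> complex"
  assumes "\<And>bs x. set bs \<subseteq> Basis \<Longrightarrow> length bs \<le> N \<Longrightarrow> cmod (iter_partial bs f x) \<le> C"
  shows "test_seminorm N f \<le> real (card {bs. set bs \<subseteq> (Basis :: 'a set) \<and> length bs \<le> N}) * C"
  unfolding test_seminorm_def
  by (rule sum_bounded_above) (use assms in \<open>auto intro: cSUP_least\<close>)

lemma iter_partial_snoc:
  "iter_partial (bs @ [b]) f = iter_partial bs (\<lambda>x. frechet_derivative f (at x) b)"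
  by (induction bs) auto

text \<open>\<open>iter_partial\<close> applies the last entry of its list first, so differentiating
  \<open>f\<close> beforehand appends \<open>b\<close> to every list. Appending is injective and
  raises the length by one, and the summands it misses are non-negative.\<close>

lemma test_seminorm_frechet:
  fixes f :: "'a::euclidean_space \<Rightarrow> complex"
  assumes f: "torus_smooth f" and b: "b \<in> Basis"
  shows "test_seminorm N (\<lambda>x. frechet_derivative f (at x) b) \<le> test_seminorm (Suc N) f"
proof -
  let ?A = "{bs. set bs \<subseteq> (Basis :: 'a set) \<and> length bs \<le> N}"
  let ?g = "\<lambda>bs. SUP x. cmod (iter_partial bs f x)"
  have "test_seminorm N (\<lambda>x. frechet_derivative f (at x) b) = (\<Sum>bs\<in>?A. ?g (bs @ [b]))"
    unfolding test_seminorm_def iter_partial_snoc by simp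
  also have "\<dots> = sum ?g ((\<lambda>bs. bs @ [b]) ` ?A)"
    by (subst sum.reindex) (auto simp: inj_on_def)
  also have "\<dots> \<le> test_seminorm (Suc N) f"
    unfolding test_seminorm_def
    by (rule sum_mono2) (use b f finite_Basis_lists SUP_iter_partial_nonneg in auto)
  finally show ?thesis .
qed

lemma frechet_add:
  "torus_smooth f \<Longrightarrow> torus_smooth g \<Longrightarrow>
   frechet_derivative (\<lambda>x. f x + g x) (at x) v = frechet_derivative f (at x) v + frechet_derivative g (at x) v"
  by (rule fun_cong[OF frechet_derivative_at[OF has_derivative_add[OF torus_smooth_has_derivative
      torus_smooth_has_derivative]], symmetric])

lemma frechet_mult:
  "torus_smooth f \<Longrightarrow> torus_smooth g \<Longrightarrow>
   frechet_derivative (\<lambda>x. f x * g x) (at x) v = f x * frechet_derivative g (at x) v + frechet_derivative f (at x) v * g x"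
  by (rule fun_cong[OF frechet_derivative_at[OF has_derivative_mult[OF torus_smooth_has_derivative
      torus_smooth_has_derivative]], symmetric])

lemma iter_partial_add:
  "torus_smooth f \<Longrightarrow> torus_smooth g \<Longrightarrow>
   iter_partial bs (\<lambda>x. f x + g x) = (\<lambda>x. iter_partial bs f x + iter_partial bs g x)"
  by (induction bs) (simp_all add: frechet_add torus_smooth_iter_partial)

text \<open>The Leibniz rule, peeling off the innermost derivative. It falls either on
  \<open>f\<close>, which raises the order of the seminorm, or on \<open>g\<close>, so the induction
  has to range over all smooth factors \<open>g\<close>. The constant is uniform in
  \<open>f\<close>.\<close>

lemma iter_partial_mult_bound:
  fixes g :: "'a::euclidean_space \<Rightarrow> complex"
  assumes "torus_smooth g"
  shows "set bs \<subseteq> Basis \<Longrightarrow> \<exists>C\<ge>0. \<forall>f x. torus_smooth f \<longrightarrow>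
    cmod (iter_partial bs (\<lambda>x. g x * f x) x) \<le> C * test_seminorm (length bs) f"
  using assms
proof (induction bs arbitrary: g rule: rev_induct)
  case Nil
  obtain C where C: "\<And>x. cmod (g x) \<le> C"
    using torus_smooth_bdd_above[OF Nil(2)] by (auto simp: bdd_above_def)
  have C0: "0 \<le> C" by (rule order_trans[OF norm_ge_zero C[of 0]])
  have "cmod (g x * f x) \<le> C * test_seminorm 0 f" if "torus_smooth f" for f x
    unfolding norm_mult
    by (rule mult_mono) (use C C0 cmod_iter_partial_le_test_seminorm[OF that, of "[]" 0 x] in auto)
  with C0 show ?case by auto
next
  case (snoc b bs)
  let ?D = "\<lambda>f x. frechet_derivative f (at x) b"
  from snoc have "set bs \<subseteq> Basis" "torus_smooth g" by auto
  from snoc.IH[OF this] obtain C1 where C1: "0 \<le> C1"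
    "\<And>f x. torus_smooth f \<Longrightarrow> cmod (iter_partial bs (\<lambda>x. g x * f x) x) \<le> C1 * test_seminorm (length bs) f"
    by blast
  from snoc.IH[OF \<open>set bs \<subseteq> Basis\<close> torus_smooth_frechet[OF snoc.prems(2), of b]] obtain C2 where C2: "0 \<le> C2"
    "\<And>f x. torus_smooth f \<Longrightarrow> cmod (iter_partial bs (\<lambda>x. ?D g x * f x) x) \<le> C2 * test_seminorm (length bs) f"
    by blast
  have "cmod (iter_partial (bs @ [b]) (\<lambda>x. g x * f x) x) \<le> (C1 + C2) * test_seminorm (length (bs @ [b])) f"
    if f: "torus_smooth f" for f x
  proof -
    have "cmod (iter_partial (bs @ [b]) (\<lambda>x. g x * f x) x)
      = cmod (iter_partial bs (\<lambda>x. g x * ?D f x) x + iter_partial bs (\<lambda>x. ?D g x * f x) x)"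
      unfolding iter_partial_snoc frechet_mult[OF snoc.prems(2) f]
      by (subst iter_partial_add) (intro torus_smooth_mult torus_smooth_frechet snoc.prems f refl)+
    also have "\<dots> \<le> C1 * test_seminorm (length bs) (?D f) + C2 * test_seminorm (length bs) f"
      by (rule norm_triangle_le[OF add_mono[OF C1(2)[OF torus_smooth_frechet[OF f]] C2(2)[OF f]]])
    also have "\<dots> \<le> C1 * test_seminorm (Suc (length bs)) f + C2 * test_seminorm (Suc (length bs)) f"
      using snoc.prems f C1(1) C2(1)
      by (intro add_mono mult_left_mono test_seminorm_frechet test_seminorm_mono) auto
    finally show ?thesis by (simp add: algebra_simps)
  qed
  then show ?case by (intro exI[of _ "C1 + C2"] conjI add_nonneg_nonneg C1(1) C2(1)) blast
qed

lemma test_seminorm_mult: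
  fixes g :: "'a::euclidean_space \<Rightarrow> complex"
  assumes g: "torus_smooth g"
  obtains C where "C \<ge> 0" "\<And>f. torus_smooth f \<Longrightarrow> test_seminorm N (\<lambda>x. g x * f x) \<le> C * test_seminorm N f"
proof -
  let ?A = "{bs. set bs \<subseteq> (Basis :: 'a set) \<and> length bs \<le> N}"
  have "\<forall>bs\<in>?A. \<exists>C\<ge>0. \<forall>f x. torus_smooth f \<longrightarrow>
    cmod (iter_partial bs (\<lambda>x. g x * f x) x) \<le> C * test_seminorm N f"
  proof
    fix bs assume bs: "bs \<in> ?A"
    then obtain C where C: "C \<ge> 0" "\<And>f x. torus_smooth f \<Longrightarrow>
      cmod (iter_partial bs (\<lambda>x. g x * f x) x) \<le> C * test_seminorm (length bs) f"
      using iter_partial_mult_bound[OF g, of bs] by auto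
    have "cmod (iter_partial bs (\<lambda>x. g x * f x) x) \<le> C * test_seminorm N f" if "torus_smooth f" for f x
      by (rule order_trans[OF C(2)[OF that]])
        (use that bs C(1) in \<open>auto intro!: mult_left_mono test_seminorm_mono\<close>)
    with C(1) show "\<exists>C\<ge>0. \<forall>f x. torus_smooth f \<longrightarrow>
      cmod (iter_partial bs (\<lambda>x. g x * f x) x) \<le> C * test_seminorm N f" by auto
  qed
  from bchoice[OF this] obtain C where C: "\<And>bs. bs \<in> ?A \<Longrightarrow> C bs \<ge> 0"
    "\<And>bs f x. bs \<in> ?A \<Longrightarrow> torus_smooth f \<Longrightarrow>
      cmod (iter_partial bs (\<lambda>x. g x * f x) x) \<le> C bs * test_seminorm N f"
    by blast
  show thesis
  proof
    show "sum C ?A \<ge> 0" using C(1) by (rule sum_nonneg)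
    show "test_seminorm N (\<lambda>x. g x * f x) \<le> sum C ?A * test_seminorm N f" if "torus_smooth f" for f
      unfolding test_seminorm_def[of N "\<lambda>x. g x * f x"] sum_distrib_right
      by (rule sum_mono) (use C(2) that in \<open>auto intro!: cSUP_least\<close>)
  qed
qed

subsection \<open>Fourier series with rapidly decreasing coefficients\<close>

text \<open>The dual lattice is kept inside the Euclidean space itself, so that one development
  serves \<open>real\<close>, \<open>real ^ 'n\<close> and their product; frequencies of type
  \<open>int ^ 'n\<close> enter later through \<open>zvec\<close>.\<close>

definition torus_lattice :: "'a::euclidean_space set" where
  "torus_lattice = {z. \<forall>b\<in>Basis. z \<bullet> b \<in> \<int>}"

definition torus_char :: "'a::euclidean_space \<Rightarrow> 'a \<Rightarrow> complex" where
  "torus_char z x = cis (x \<bullet> z)"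

definition rapid :: "('a::euclidean_space \<Rightarrow> complex) \<Rightarrow> bool" where
  "rapid a \<longleftrightarrow> (\<forall>N. \<exists>C. \<forall>z\<in>torus_lattice. cmod (a z) * (1 + norm z) ^ N \<le> C)"

definition fseries :: "('a::euclidean_space \<Rightarrow> complex) \<Rightarrow> 'a \<Rightarrow> complex" where
  "fseries a x = (\<Sum>\<^sub>\<infinity>z\<in>torus_lattice. a z * torus_char z x)"

lemma torus_lattice_uminus: "z \<in> torus_lattice \<Longrightarrow> - z \<in> torus_lattice"
  by (auto simp: torus_lattice_def)

lemma torus_lattice_diff: "z \<in> torus_lattice \<Longrightarrow> w \<in> torus_lattice \<Longrightarrow> z - w \<in> torus_lattice"
  by (auto simp: torus_lattice_def inner_diff_left)

lemma torus_lattice_zero: "0 \<in> torus_lattice"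
  by (auto simp: torus_lattice_def)

lemma cmod_torus_char [simp]: "cmod (torus_char z x) = 1"
  by (simp add: torus_char_def)

lemma torus_char_add: "torus_char (z + w) x = torus_char z x * torus_char w x"
  by (simp add: torus_char_def inner_add_right cis_mult)

lemma torus_char_periodic:
  assumes "z \<in> torus_lattice" "b \<in> Basis"
  shows "torus_char z (x + (2 * pi) *\<^sub>R b) = torus_char z x"
proof -
  have "b \<bullet> z \<in> \<int>" using assms by (auto simp: torus_lattice_def inner_commute)
  then have "cis (2 * pi * (b \<bullet> z)) = 1" by (rule cis_multiple_2pi)
  then show ?thesis by (simp add: torus_char_def inner_add_left flip: cis_mult)
qed

text \<open>The integers split into \<open>n\<close> and \<open>- n - 1\<close> for natural
  \<open>n\<close>, and both halves are shifted tails of the series of inverse squares.\<close>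

lemma int_inverse_square_summable: "(\<lambda>k::int. inverse ((1 + \<bar>of_int k\<bar>)^2) :: real) summable_on UNIV"
proof -
  have "summable (\<lambda>n. inverse (real n ^ 2))" using inverse_power_summable[of 2, where 'a=real] by simp
  then have s: "summable (\<lambda>n. inverse ((1 + real n)^2))" "summable (\<lambda>n. inverse ((2 + real n)^2))"
    using summable_Suc_iff[of "\<lambda>n. inverse (real n ^ 2)"]
      summable_Suc_iff[of "\<lambda>n. inverse ((1 + real n) ^ 2)"] by (simp_all add: add.commute add.assoc)
  then have s': "(\<lambda>n. inverse ((1 + real n)^2)) summable_on UNIV" "(\<lambda>n. inverse ((2 + real n)^2)) summable_on UNIV"
    by (auto intro!: norm_summable_imp_summable_on)
  let ?f = "\<lambda>k::int. inverse ((1 + \<bar>of_int k\<bar>)^2) :: real"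
  have 1: "?f summable_on range int"
    using s'(1) by (subst summable_on_reindex) (auto simp: o_def)
  have 2: "?f summable_on range (\<lambda>n. - int n - 1)"
  proof (subst summable_on_reindex)
    have "1 + \<bar>of_int (- int n - 1)\<bar> = 2 + real n" for n by simp
    then show "(?f \<circ> (\<lambda>n. - int n - 1)) summable_on UNIV" using s'(2) by (simp add: o_def)
  qed (auto simp: inj_on_def)
  have "k \<in> range int \<union> range (\<lambda>n. - int n - 1)" for k
  proof (cases "k \<ge> 0")
    case True
    then have "k = int (nat k)" by simp
    then show ?thesis by blast
  next
    case False
    then have "k = - int (nat (- k - 1)) - 1" by simp
    then show ?thesis by blast
  qed
  then have "range int \<union> range (\<lambda>n. - int n - 1) = UNIV" by auto
  moreover have "range int \<inter> range (\<lambda>n. - int n - 1) = {}" by auto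
  ultimately show ?thesis using summable_on_Un_disjoint[OF 1 2] by simp
qed

lemma torus_lattice_floor: "z \<in> torus_lattice \<Longrightarrow> b \<in> Basis \<Longrightarrow> of_int \<lfloor>z \<bullet> b\<rfloor> = z \<bullet> b"
  by (auto simp: torus_lattice_def Ints_def)

text \<open>Integer coordinates recover the lattice point; restricting to \<open>Basis\<close>
  places the images in a product set \<open>PiE\<close>, over which sums of products factor.\<close>

lemma torus_lattice_inj:
  "inj_on (\<lambda>z::'a::euclidean_space. restrict (\<lambda>b. \<lfloor>z \<bullet> b\<rfloor>) Basis) torus_lattice"
proof (rule inj_onI)
  fix z w :: 'a
  assume zw: "z \<in> torus_lattice" "w \<in> torus_lattice"
    and eq: "restrict (\<lambda>b. \<lfloor>z \<bullet> b\<rfloor>) Basis = restrict (\<lambda>b. \<lfloor>w \<bullet> b\<rfloor>) Basis"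
  show "z = w"
  proof (rule euclidean_eqI)
    fix b :: 'a assume b: "b \<in> Basis"
    have "\<lfloor>z \<bullet> b\<rfloor> = \<lfloor>w \<bullet> b\<rfloor>" using fun_cong[OF eq, of b] unfolding restrict_apply'[OF b] .
    then have "of_int \<lfloor>z \<bullet> b\<rfloor> = (of_int \<lfloor>w \<bullet> b\<rfloor> :: real)" by (rule arg_cong)
    then show "z \<bullet> b = w \<bullet> b" unfolding torus_lattice_floor[OF zw(1) b] torus_lattice_floor[OF zw(2) b] .
  qed
qed

text \<open>Every coordinate of \<open>z\<close> is at most \<open>norm z\<close>, so the weight is
  at most a product of one-dimensional weights, with two powers spent per dimension. Finite sums are
  then bounded by a power of the one-dimensional sum.\<close>

lemma torus_lattice_summable:
  "(\<lambda>z::'a::euclidean_space. inverse ((1 + norm z) ^ (2 * DIM('a)))) summable_on torus_lattice"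
proof (rule nonneg_bdd_above_summable_on)
  let ?h = "\<lambda>k::int. inverse ((1 + \<bar>of_int k\<bar>)^2) :: real"
  let ?r = "\<lambda>z::'a. restrict (\<lambda>b. \<lfloor>z \<bullet> b\<rfloor>) Basis"
  show "bdd_above (sum (\<lambda>z::'a. inverse ((1 + norm z) ^ (2 * DIM('a)))) ` {F. F \<subseteq> torus_lattice \<and> finite F})"
  proof (rule bdd_aboveI2)
    fix F :: "'a set" assume "F \<in> {F. F \<subseteq> torus_lattice \<and> finite F}"
    then have F: "F \<subseteq> torus_lattice" "finite F" by auto
    define K where "K = (\<Union>b\<in>Basis. (\<lambda>z::'a. \<lfloor>z \<bullet> b\<rfloor>) ` F)"
    have finK: "finite K" using F by (auto simp: K_def)
    have "inverse ((1 + norm z) ^ (2 * DIM('a))) \<le> (\<Prod>b\<in>Basis. ?h (?r z b))" if z: "z \<in> F" for z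
    proof -
      have "inverse ((1 + norm z) ^ (2 * DIM('a))) = (\<Prod>b\<in>(Basis::'a set). inverse ((1 + norm z)^2))"
        by (simp only: prod_constant power_mult power_inverse)
      also have "\<dots> \<le> (\<Prod>b\<in>Basis. ?h (?r z b))"
      proof (rule prod_mono)
        fix b :: 'a assume b: "b \<in> Basis"
        have "of_int (?r z b) = z \<bullet> b"
          unfolding restrict_apply'[OF b] by (rule torus_lattice_floor[OF subsetD[OF F(1) z] b])
        then have "\<bar>of_int (?r z b)\<bar> \<le> norm z"
          using Basis_le_norm[OF b, of z] by (simp only:)
        then show "0 \<le> inverse ((1 + norm z)^2) \<and> inverse ((1 + norm z)^2) \<le> ?h (?r z b)"
          by (intro conjI le_imp_inverse_le power_mono zero_less_power add_left_mono) (simp_all add: add_pos_nonneg)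
      qed
      finally show ?thesis .
    qed
    then have "(\<Sum>z\<in>F. inverse ((1 + norm z) ^ (2 * DIM('a)))) \<le> (\<Sum>z\<in>F. \<Prod>b\<in>Basis. ?h (?r z b))"
      by (rule sum_mono)
    also have "\<dots> = (\<Sum>g\<in>?r ` F. \<Prod>b\<in>Basis. ?h (g b))"
      using inj_on_subset[OF torus_lattice_inj F(1)] by (subst sum.reindex) (auto simp: o_def)
    also have "\<dots> \<le> (\<Sum>g\<in>PiE (Basis::'a set) (\<lambda>_. K). \<Prod>b\<in>Basis. ?h (g b))"
    proof (rule sum_mono2)
      show "finite (PiE (Basis::'a set) (\<lambda>_. K))" using finK by (intro finite_PiE) auto
      show "?r ` F \<subseteq> PiE (Basis::'a set) (\<lambda>_. K)"
        by (intro image_subsetI) (auto simp: K_def PiE_iff)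
    qed (intro prod_nonneg, simp)
    also have "\<dots> = (\<Prod>b\<in>(Basis::'a set). \<Sum>k\<in>K. ?h k)"
      using finK by (subst prod_sum_PiE) auto
    also have "\<dots> \<le> (infsum ?h UNIV) ^ DIM('a)"
      unfolding prod_constant
      by (intro power_mono finite_sum_le_infsum[OF int_inverse_square_summable finK] sum_nonneg) auto
    finally show "(\<Sum>z\<in>F. inverse ((1 + norm z) ^ (2 * DIM('a)))) \<le> (infsum ?h UNIV) ^ DIM('a)" .
  qed
qed auto

text \<open>Decay of order \<open>N + 2 * DIM('a)\<close> still leaves the summable weight after
  \<open>N\<close> powers are spent.\<close>

lemma rapid_summable:
  fixes a :: "'a::euclidean_space \<Rightarrow> complex"
  assumes "rapid a"
  shows "(\<lambda>z. cmod (a z) * (1 + norm z) ^ N) summable_on torus_lattice"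
proof -
  obtain C where C: "\<And>z. z \<in> torus_lattice \<Longrightarrow> cmod (a z) * (1 + norm z) ^ (N + 2 * DIM('a)) \<le> C"
    using assms unfolding rapid_def by blast
  show ?thesis
  proof (rule summable_on_comparison_test)
    show "(\<lambda>z::'a. C * inverse ((1 + norm z) ^ (2 * DIM('a)))) summable_on torus_lattice"
      by (intro summable_on_cmult_right torus_lattice_summable)
    fix z :: 'a assume z: "z \<in> torus_lattice"
    have "0 < (1 + norm z) ^ (2 * DIM('a))" by (intro zero_less_power add_pos_nonneg) auto
    then show "cmod (a z) * (1 + norm z) ^ N \<le> C * inverse ((1 + norm z) ^ (2 * DIM('a)))"
      using C[OF z] by (simp add: power_add field_simps)
  qed auto
qed

lemma rapid_norm_summable: "rapid a \<Longrightarrow> (\<lambda>z. cmod (a z)) summable_on torus_lattice"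
  using rapid_summable[of a 0] by simp

lemma rapid_mult:
  assumes a: "rapid a" and p: "\<And>z. z \<in> torus_lattice \<Longrightarrow> cmod (p z) \<le> C * (1 + norm z) ^ M"
  shows "rapid (\<lambda>z. p z * a z)"
  unfolding rapid_def
proof
  fix N
  obtain C' where C': "\<And>z. z \<in> torus_lattice \<Longrightarrow> cmod (a z) * (1 + norm z) ^ (N + M) \<le> C'"
    using a unfolding rapid_def by blast
  have "cmod (p z * a z) * (1 + norm z) ^ N \<le> \<bar>C\<bar> * C'" if z: "z \<in> torus_lattice" for z
  proof -
    have "cmod (p z) \<le> \<bar>C\<bar> * (1 + norm z) ^ M"
      by (rule order_trans[OF p[OF z]]) (auto intro!: mult_right_mono)
    then have "cmod (p z * a z) * (1 + norm z) ^ N \<le> (\<bar>C\<bar> * (1 + norm z) ^ M) * cmod (a z) * (1 + norm z) ^ N"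
      by (auto simp: norm_mult intro!: mult_right_mono)
    also have "\<dots> = \<bar>C\<bar> * (cmod (a z) * (1 + norm z) ^ (N + M))" by (simp add: power_add algebra_simps)
    also have "\<dots> \<le> \<bar>C\<bar> * C'" using C'[OF z] by (auto intro!: mult_left_mono)
    finally show ?thesis .
  qed
  then show "\<exists>C. \<forall>z\<in>torus_lattice. cmod (p z * a z) * (1 + norm z) ^ N \<le> C" by blast
qed

lemma rapid_mono:
  assumes "rapid a" "\<And>z. z \<in> torus_lattice \<Longrightarrow> cmod (b z) \<le> cmod (a z)"
  shows "rapid b"
  unfolding rapid_def
proof
  fix N
  obtain C where C: "\<And>z. z \<in> torus_lattice \<Longrightarrow> cmod (a z) * (1 + norm z) ^ N \<le> C"
    using assms(1) unfolding rapid_def by blast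
  have "cmod (b z) * (1 + norm z) ^ N \<le> C" if "z \<in> torus_lattice" for z
    by (rule order_trans[OF mult_right_mono[OF assms(2)[OF that]] C[OF that]]) simp
  then show "\<exists>C. \<forall>z\<in>torus_lattice. cmod (b z) * (1 + norm z) ^ N \<le> C" by blast
qed

lemma cmod_inner_le: "cmod (\<i> * of_real (v \<bullet> z)) \<le> norm v * (1 + norm z) ^ 1"
proof -
  have "\<bar>v \<bullet> z\<bar> \<le> norm v * norm z" by (rule Cauchy_Schwarz_ineq2)
  also have "\<dots> \<le> norm v * (1 + norm z)" by (intro mult_left_mono) auto
  finally show ?thesis by (simp add: norm_mult)
qed

lemma rapid_deriv: "rapid a \<Longrightarrow> rapid (\<lambda>z. \<i> * of_real (v \<bullet> z) * a z)"
  using rapid_mult[of a "\<lambda>z. \<i> * of_real (v \<bullet> z)" "norm v" 1] cmod_inner_le[of v] by simp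

lemma fseries_has_sum:
  assumes "rapid a"
  shows "((\<lambda>z. a z * torus_char z x) has_sum fseries a x) torus_lattice"
  unfolding fseries_def
  by (rule has_sum_infsum, rule abs_summable_summable)
    (use rapid_norm_summable[OF assms] in \<open>simp add: norm_mult\<close>)

lemma has_sum_diff:
  fixes f g :: "_ \<Rightarrow> complex"
  assumes "(f has_sum S) A" "(g has_sum T) A"
  shows "((\<lambda>z. f z - g z) has_sum (S - T)) A"
  using has_sum_add[OF assms(1) has_sum_cmult_right[OF assms(2), of "-1"]] by simp

lemma cis_taylor1: "cmod (cis s - 1 - \<i> * of_real s) \<le> s\<^sup>2"
proof -
  have "(\<Sum>k\<le>1. (\<i> * of_real s) ^ k / fact k :: complex) = 1 + \<i> * of_real s"
    by simp
  then show ?thesis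
    using Taylor_exp[of "\<i> * of_real s" 1]
    by (simp add: cis_conv_exp norm_mult power2_eq_square diff_diff_eq)
qed

text \<open>Termwise differentiation. The second-order remainder of a character is at most the
  square of \<open>norm (y - x) * (1 + norm z)\<close>, and rapid decay makes the weighted sum
  finite, so the total error is quadratic in \<open>norm (y - x)\<close>.\<close>

lemma fseries_has_derivative:
  fixes a :: "'a::euclidean_space \<Rightarrow> complex"
  assumes a: "rapid a"
  shows "(fseries a has_derivative (\<lambda>v. fseries (\<lambda>z. \<i> * of_real (v \<bullet> z) * a z) x)) (at x)"
proof (rule has_derivativeI_sandwich[where e = 1])
  let ?D = "\<lambda>v. fseries (\<lambda>z. \<i> * of_real (v \<bullet> z) * a z) x"
  \<comment> \<open>The second power of the weight is what the quadratic remainder needs; the same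
    constant also bounds the candidate derivative.\<close>
  define K where "K = infsum (\<lambda>z. cmod (a z) * (1 + norm z) ^ 2) torus_lattice"
  have hs: "((\<lambda>z. \<i> * of_real (v \<bullet> z) * a z * torus_char z x) has_sum ?D v) torus_lattice" for v
    by (rule fseries_has_sum[OF rapid_deriv[OF a]])
  have K: "((\<lambda>z. cmod (a z) * (1 + norm z) ^ 2 * c) has_sum (K * c)) torus_lattice" for c
    unfolding K_def by (intro has_sum_cmult_left has_sum_infsum rapid_summable a)
  show "bounded_linear ?D"
  proof (rule bounded_linear_intro[where K = K])
    fix v w :: 'a
    have "((\<lambda>z. \<i> * of_real ((v + w) \<bullet> z) * a z * torus_char z x) has_sum (?D v + ?D w)) torus_lattice"
      using has_sum_add[OF hs[of v] hs[of w]] by (simp add: inner_add_left algebra_simps)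
    from has_sum_unique[OF hs[of "v + w"] this] show "?D (v + w) = ?D v + ?D w" .
  next
    fix r :: real and v :: 'a
    have "((\<lambda>z. \<i> * of_real ((r *\<^sub>R v) \<bullet> z) * a z * torus_char z x) has_sum (r *\<^sub>R ?D v)) torus_lattice"
      using has_sum_cmult_right[OF hs[of v], of "of_real r"] by (simp add: algebra_simps scaleR_conv_of_real)
    from has_sum_unique[OF hs[of "r *\<^sub>R v"] this] show "?D (r *\<^sub>R v) = r *\<^sub>R ?D v" .
  next
    fix v :: 'a
    have "norm (?D v) \<le> K * norm v"
    proof (rule norm_infsum_le[OF hs[of v] K])
      fix z :: 'a
      have "cmod (\<i> * of_real (v \<bullet> z)) \<le> norm v * (1 + norm z) ^ 1" by (rule cmod_inner_le)
      also have "\<dots> \<le> norm v * (1 + norm z) ^ 2"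
        by (intro mult_left_mono power_increasing) auto
      finally have "cmod (\<i> * of_real (v \<bullet> z)) * cmod (a z) \<le> norm v * (1 + norm z) ^ 2 * cmod (a z)"
        by (rule mult_right_mono) simp
      then show "norm (\<i> * of_real (v \<bullet> z) * a z * torus_char z x) \<le> cmod (a z) * (1 + norm z) ^ 2 * norm v"
        by (simp add: norm_mult algebra_simps)
    qed
    then show "norm (?D v) \<le> norm v * K" by (simp add: mult.commute)
  qed
  show "norm (fseries a y - fseries a x - ?D (y - x)) / norm (y - x) \<le> K * norm (y - x)"
    if "y \<noteq> x" for y
  proof -
    have "norm (fseries a y - fseries a x - ?D (y - x)) \<le> K * (norm (y - x))^2"
    proof (rule norm_infsum_le[OF _ K])
      show "((\<lambda>z. a z * torus_char z y - a z * torus_char z x - \<i> * of_real ((y - x) \<bullet> z) * a z * torus_char z x)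
        has_sum fseries a y - fseries a x - ?D (y - x)) torus_lattice"
        by (intro has_sum_diff fseries_has_sum a hs)
      fix z :: 'a
      have "torus_char z y = torus_char z x * cis ((y - x) \<bullet> z)"
        by (simp add: torus_char_def cis_mult inner_diff_left)
      then have "a z * torus_char z y - a z * torus_char z x - \<i> * of_real ((y - x) \<bullet> z) * a z * torus_char z x
        = a z * torus_char z x * (cis ((y - x) \<bullet> z) - 1 - \<i> * of_real ((y - x) \<bullet> z))"
        by (simp add: algebra_simps)
      then have "norm (a z * torus_char z y - a z * torus_char z x - \<i> * of_real ((y - x) \<bullet> z) * a z * torus_char z x)
        \<le> cmod (a z) * ((y - x) \<bullet> z)^2"
        using cis_taylor1[of "(y - x) \<bullet> z"] by (simp add: norm_mult mult_left_mono)
      also have "\<bar>(y - x) \<bullet> z\<bar> \<le> norm (y - x) * (1 + norm z)"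
        using cmod_inner_le[of "y - x" z] by (simp add: norm_mult)
      then have "((y - x) \<bullet> z)^2 \<le> (norm (y - x) * (1 + norm z))^2"
        using abs_le_square_iff[of "(y - x) \<bullet> z" "norm (y - x) * (1 + norm z)"] by simp
      then have "cmod (a z) * ((y - x) \<bullet> z)^2 \<le> cmod (a z) * (norm (y - x) * (1 + norm z))^2"
        by (intro mult_left_mono) auto
      finally show "norm (a z * torus_char z y - a z * torus_char z x - \<i> * of_real ((y - x) \<bullet> z) * a z * torus_char z x)
        \<le> cmod (a z) * (1 + norm z) ^ 2 * (norm (y - x))^2"
        by (simp only: power_mult_distrib ac_simps)
    qed
    then show ?thesis using that by (simp add: field_simps power2_eq_square)
  qed
  have "((\<lambda>y. K * norm (y - x)) \<longlongrightarrow> K * norm (x - x)) (at x)"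
    by (intro tendsto_intros)
  then show "((\<lambda>y. K * norm (y - x)) \<longlongrightarrow> 0) (at x)" by simp
qed simp

text \<open>A derivative of such a series is again one, with coefficients multiplied by a linear
  factor; this closes the induction on the order.\<close>

lemma torus_smooth_fseries:
  assumes "rapid a"
  shows "torus_smooth (fseries a)"
  unfolding torus_smooth_def
proof (intro conjI allI ballI)
  fix k
  show "C_diff k (fseries a)"
    using assms
  proof (induction k arbitrary: a)
    case 0
    then show ?case
      using has_derivative_continuous[OF fseries_has_derivative[OF 0]]
      by (simp add: continuous_on_eq_continuous_at)
  next
    case (Suc k)
    show ?case
      by (rule C_diff_Suc_has_derivativeI[OF fseries_has_derivative[OF Suc.prems]])
        (rule Suc.IH[OF rapid_deriv[OF Suc.prems]])
  qed
next
  fix x b :: 'a assume "b \<in> Basis"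
  then show "fseries a (x + (2 * pi) *\<^sub>R b) = fseries a x"
    unfolding fseries_def by (intro infsum_cong) (simp add: torus_char_periodic)
qed

lemma rapid_iter: "rapid a \<Longrightarrow> rapid (\<lambda>z. (\<Prod>b\<leftarrow>bs. \<i> * of_real (b \<bullet> z)) * a z)"
proof (induction bs)
  case (Cons b bs)
  then show ?case using rapid_deriv[OF Cons.IH[OF Cons.prems], of b] by (simp add: mult.assoc)
qed simp

lemma iter_partial_fseries:
  "rapid a \<Longrightarrow> iter_partial bs (fseries a) = fseries (\<lambda>z. (\<Prod>b\<leftarrow>bs. \<i> * of_real (b \<bullet> z)) * a z)"
proof (induction bs)
  case (Cons b bs)
  show ?case
    by (simp add: Cons mult.assoc
        frechet_derivative_at[OF fseries_has_derivative[OF rapid_iter[OF Cons.prems, of bs]], symmetric])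
qed simp

lemma cmod_fseries_le: 
  assumes "rapid a"
  shows "cmod (fseries a x) \<le> (\<Sum>\<^sub>\<infinity>z\<in>torus_lattice. cmod (a z))"
  by (rule norm_infsum_le[OF fseries_has_sum[OF assms] has_sum_infsum[OF rapid_norm_summable[OF assms]]])
    (simp add: norm_mult)

lemma cmod_prod_list_inner_le:
  assumes "set bs \<subseteq> Basis"
  shows "cmod (\<Prod>b\<leftarrow>bs. \<i> * of_real (b \<bullet> z)) \<le> (1 + norm z) ^ length bs"
  using assms
proof (induction bs)
  case (Cons b bs)
  have "cmod (\<i> * of_real (b \<bullet> z)) \<le> 1 + norm z"
    using cmod_inner_le[of b z] Cons.prems by simp
  then have "cmod (\<i> * of_real (b \<bullet> z)) * cmod (\<Prod>b\<leftarrow>bs. \<i> * of_real (b \<bullet> z)) \<le> (1 + norm z) * (1 + norm z) ^ length bs"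
    using Cons by (intro mult_mono) simp_all
  then show ?case by (simp add: norm_mult)
qed simp

lemma iter_partial_fseries_le:
  assumes a: "rapid a" and bs: "set bs \<subseteq> Basis" "length bs \<le> N"
  shows "cmod (iter_partial bs (fseries a) x) \<le> (\<Sum>\<^sub>\<infinity>z\<in>torus_lattice. cmod (a z) * (1 + norm z) ^ N)"
  unfolding iter_partial_fseries[OF a]
proof (rule order_trans[OF cmod_fseries_le[OF rapid_iter[OF a]]], rule infsum_mono)
  show "(\<lambda>z. cmod ((\<Prod>b\<leftarrow>bs. \<i> * of_real (b \<bullet> z)) * a z)) summable_on torus_lattice"
    by (rule rapid_norm_summable[OF rapid_iter[OF a]])
  show "(\<lambda>z. cmod (a z) * (1 + norm z) ^ N) summable_on torus_lattice"
    by (rule rapid_summable[OF a])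
  fix z
  have "cmod (\<Prod>b\<leftarrow>bs. \<i> * of_real (b \<bullet> z)) \<le> (1 + norm z) ^ N"
    by (rule order_trans[OF cmod_prod_list_inner_le[OF bs(1)] power_increasing[OF bs(2)]]) simp
  then show "cmod ((\<Prod>b\<leftarrow>bs. \<i> * of_real (b \<bullet> z)) * a z) \<le> cmod (a z) * (1 + norm z) ^ N"
    unfolding norm_mult mult.commute[of "cmod (a z)"] by (rule mult_right_mono) simp
qed

section \<open>Linearity and continuity of distributions\<close>

lemma torus_distribution_lincomb:
  "torus_distribution u \<Longrightarrow> torus_smooth \<phi> \<Longrightarrow> torus_smooth \<psi> \<Longrightarrow>
   u (\<lambda>x. a * \<phi> x + b * \<psi> x) = a * u \<phi> + b * u \<psi>"
  by (drule torus_distribution_def[THEN iffD1, THEN conjunct1]) simp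

lemma torus_distribution_add:
  "torus_distribution u \<Longrightarrow> torus_smooth \<phi> \<Longrightarrow> torus_smooth \<psi> \<Longrightarrow> u (\<lambda>x. \<phi> x + \<psi> x) = u \<phi> + u \<psi>"
  using torus_distribution_lincomb[of u \<phi> \<psi> 1 1] by simp

lemma torus_distribution_cmult:
  "torus_distribution u \<Longrightarrow> torus_smooth \<phi> \<Longrightarrow> u (\<lambda>x. c * \<phi> x) = c * u \<phi>"
  using torus_distribution_lincomb[of u \<phi> \<phi> c 0] by simp

lemma torus_distribution_bound:
  assumes "torus_distribution u"
  obtains C N where "0 \<le> C" "\<And>\<phi>. torus_smooth \<phi> \<Longrightarrow> cmod (u \<phi>) \<le> C * test_seminorm N \<phi>"
proof -
  obtain C N where "\<forall>\<phi>. torus_smooth \<phi> \<longrightarrow> cmod (u \<phi>) \<le> C * test_seminorm N \<phi>"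
    using conjunct2[OF assms[unfolded torus_distribution_def]] by (elim exE)
  then have CN: "\<And>\<phi>. torus_smooth \<phi> \<Longrightarrow> cmod (u \<phi>) \<le> C * test_seminorm N \<phi>" by simp
  have "cmod (u \<phi>) \<le> \<bar>C\<bar> * test_seminorm N \<phi>" if "torus_smooth \<phi>" for \<phi>
    by (rule order_trans[OF CN[OF that]]) (intro mult_right_mono test_seminorm_nonneg that abs_ge_self)
  then show thesis by (rule that[of "\<bar>C\<bar>" N, OF abs_ge_zero])
qed

subsection \<open>Fourier coefficients\<close>

abbreviation torus_cell :: "'a::euclidean_space set" where
  "torus_cell \<equiv> cbox 0 ((2 * pi) *\<^sub>R One)"

definition fcoef :: "('a::euclidean_space \<Rightarrow> complex) \<Rightarrow> 'a \<Rightarrow> complex" where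
  "fcoef f z = integral torus_cell (\<lambda>x. f x * torus_char (- z) x) / (2 * of_real pi) ^ DIM('a)"

lemma content_torus_cell: "measure lborel (torus_cell :: 'a::euclidean_space set) = (2 * pi) ^ DIM('a)"
  by (subst content_cbox) auto

text \<open>Cut the cell at height \<open>s\<close> in the direction \<open>b\<close>: periodicity
  moves the lower slab up by one period, where it completes the upper slab to the shifted
  cell.\<close>

lemma integral_torus_shift:
  fixes f :: "'a::euclidean_space \<Rightarrow> complex"
  assumes cont: "continuous_on UNIV f" and b: "b \<in> Basis"
    and per: "\<And>x. f (x + (2 * pi) *\<^sub>R b) = f x" and s: "0 \<le> s" "s \<le> 2 * pi"
  shows "integral torus_cell (\<lambda>x. f (x + s *\<^sub>R b)) = integral torus_cell f"
proof -
  have int: "f integrable_on cbox a c" for a c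
    by (intro integrable_continuous continuous_on_subset[OF cont]) auto
  let ?One = "(2 * pi) *\<^sub>R (One::'a)"
  let ?A = "cbox (s *\<^sub>R b) (?One + s *\<^sub>R b)"
  define c1 where "c1 = (\<Sum>i\<in>Basis. (if i = b then min (?One \<bullet> b) s else ?One \<bullet> i) *\<^sub>R i)"
  define c2 where "c2 = (\<Sum>i\<in>Basis. (if i = b then max ((0::'a) \<bullet> b) s else (0::'a) \<bullet> i) *\<^sub>R i)"
  have C1: "cbox 0 ?One \<inter> {x. x \<bullet> b \<le> s} = cbox 0 c1"
    and C2: "cbox 0 ?One \<inter> {x. x \<bullet> b \<ge> s} = cbox c2 ?One"
    unfolding c1_def c2_def by (rule interval_split[OF b])+
  obtain I1 I2 where I: "(f has_integral I1) (cbox 0 c1)" "(f has_integral I2) (cbox c2 ?One)"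
    using int unfolding integrable_on_def by blast
  have "(f has_integral I1 + I2) (cbox 0 ?One)"
    by (rule has_integral_split[OF _ _ b, where c = s]) (use I C1 C2 in simp_all)
  then have 1: "integral torus_cell f = I1 + I2" by (rule integral_unique)
  have bb: "b \<bullet> i = (if i = b then 1 else 0)" if "i \<in> Basis" for i
    using inner_Basis[OF b that] by auto
  have ball: "(\<forall>i\<in>Basis. R i) \<longleftrightarrow> R b \<and> (\<forall>i\<in>Basis - {b}. R i)" for R :: "'a \<Rightarrow> bool"
    using b by auto
  have c1: "c1 \<bullet> i = (if i = b then s else 2 * pi)" if "i \<in> Basis" for i
    unfolding c1_def using that s b by (subst inner_sum_left_Basis) auto
  have bi: "b \<bullet> i = 0" if "i \<in> Basis - {b}" for i using bb[of i] that by auto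
  have b1: "b \<bullet> b = 1" using bb[OF b] by simp
  have A1: "?A \<inter> {x. x \<bullet> b \<le> 2 * pi} = cbox c2 ?One"
    unfolding C2[symmetric] using s b
    by (intro set_eqI) (auto simp: mem_box ball inner_add_left bi b1)
  \<comment> \<open>The shift rule for integrals translates boxes by subtraction, hence the two
    minus signs for an upward translation by one period.\<close>
  have A2: "?A \<inter> {x. x \<bullet> b \<ge> 2 * pi} = cbox (0 - (- (2 * pi) *\<^sub>R b)) (c1 - (- (2 * pi) *\<^sub>R b))"
    using s b
    by (intro set_eqI) (auto simp: mem_box ball inner_add_left bi b1 c1)
  have per': "f (x + - (2 * pi) *\<^sub>R b) = f x" for x
    using per[of "x + - (2 * pi) *\<^sub>R b"] by simp
  have "(f has_integral I1) (cbox (0 - (- (2 * pi) *\<^sub>R b)) (c1 - (- (2 * pi) *\<^sub>R b)))"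
    using has_integral_shift_cbox[OF I(1), of "- (2 * pi) *\<^sub>R b"] unfolding per' .
  then have "(f has_integral I2 + I1) ?A"
    by (intro has_integral_split[OF _ _ b, where c = "2 * pi"]) (use I A1 A2 in simp_all)
  from has_integral_shift_cbox[OF this, of "s *\<^sub>R b"]
  have "((\<lambda>x. f (x + s *\<^sub>R b)) has_integral I2 + I1) torus_cell" by simp
  then show ?thesis using 1 by (simp add: integral_unique add.commute)
qed

text \<open>The integral of the translate of \<open>f\<close> by \<open>s\<close> along
  \<open>b\<close> is constant in \<open>s\<close>, while differentiating under the integral sign at
  \<open>s = 0\<close> gives the integral of the partial derivative. This is what removes boundary
  terms from integration by parts.\<close>

lemma integral_torus_partial:
  fixes f :: "'a::euclidean_space \<Rightarrow> complex"
  assumes f: "torus_smooth f" and b: "b \<in> Basis"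
  shows "integral torus_cell (\<lambda>x. frechet_derivative f (at x) b) = 0"
proof -
  let ?D = "\<lambda>x. frechet_derivative f (at x) b"
  let ?U = "cbox 0 (2 * pi) :: real set"
  have D: "continuous_on UNIV ?D" by (rule torus_smooth_continuous[OF torus_smooth_frechet[OF f]])
  have "((\<lambda>s. integral torus_cell (\<lambda>x. f (x + s *\<^sub>R b))) has_vector_derivative
      integral torus_cell (\<lambda>x. ?D (x + 0 *\<^sub>R b))) (at 0 within ?U)"
  proof (rule leibniz_rule_vector_derivative[where f = "\<lambda>s x. f (x + s *\<^sub>R b)" and fx = "\<lambda>s x. ?D (x + s *\<^sub>R b)"])
    fix s :: real and x :: 'a
    have "((\<lambda>s. f (x + s *\<^sub>R b)) has_derivative (\<lambda>h. frechet_derivative f (at (x + s *\<^sub>R b)) (h *\<^sub>R b))) (at s within ?U)"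
      by (rule has_derivative_compose[OF _ torus_smooth_has_derivative[OF f], of "\<lambda>s. x + s *\<^sub>R b"])
        (auto intro!: derivative_eq_intros)
    moreover have "frechet_derivative f (at (x + s *\<^sub>R b)) (h *\<^sub>R b) = h *\<^sub>R ?D (x + s *\<^sub>R b)" for h
      by (rule linear_cmul[OF has_derivative_linear[OF torus_smooth_has_derivative[OF f]]])
    ultimately show "((\<lambda>s. f (x + s *\<^sub>R b)) has_vector_derivative ?D (x + s *\<^sub>R b)) (at s within ?U)"
      unfolding has_vector_derivative_def by simp
  next
    fix s :: real
    show "(\<lambda>x. f (x + s *\<^sub>R b)) integrable_on torus_cell"
      by (rule integrable_continuous, rule continuous_on_compose2[OF torus_smooth_continuous[OF f, of UNIV]])
        (auto intro!: continuous_intros)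
  next
    show "continuous_on (?U \<times> torus_cell) (\<lambda>(s, x). ?D (x + s *\<^sub>R b))"
      unfolding split_beta
      by (rule continuous_on_compose2[OF D]) (auto intro!: continuous_intros)
  qed auto
  moreover have "((\<lambda>s. integral torus_cell (\<lambda>x. f (x + s *\<^sub>R b))) has_vector_derivative 0) (at 0 within ?U)"
  proof (rule has_vector_derivative_transform[OF _ _ has_vector_derivative_const])
    show "integral torus_cell (\<lambda>x. f (x + s *\<^sub>R b)) = integral torus_cell f" if "s \<in> ?U" for s
      using that integral_torus_shift[OF torus_smooth_continuous[OF f] b torus_smooth_periodic[OF f b]] by auto
  qed auto
  ultimately have "integral torus_cell (\<lambda>x. ?D (x + 0 *\<^sub>R b)) = 0"
    by (rule vector_derivative_unique_within_closed_interval[of 0 "2 * pi" 0, rotated 2]) auto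
  then show ?thesis by simp
qed

lemma rapid_single: "rapid (\<lambda>w. if w = z then c else 0)"
  unfolding rapid_def
proof
  fix N
  show "\<exists>C. \<forall>w\<in>torus_lattice. cmod (if w = z then c else 0) * (1 + norm w) ^ N \<le> C"
    by (rule exI[of _ "cmod c * (1 + norm z) ^ N"]) auto
qed

lemma fseries_single:
  assumes "z \<in> torus_lattice"
  shows "fseries (\<lambda>w. if w = z then c else 0) = (\<lambda>x. c * torus_char z x)"
proof
  fix x
  have "fseries (\<lambda>w. if w = z then c else 0) x = (\<Sum>\<^sub>\<infinity>w\<in>{z}. c * torus_char z x)"
    unfolding fseries_def by (rule infsum_cong_neutral) (use assms in auto)
  then show "fseries (\<lambda>w. if w = z then c else 0) x = c * torus_char z x" by simp
qed

text \<open>A character is the Fourier series with one non-zero coefficient, so its smoothness and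
  the bounds on its derivatives come from the results on series.\<close>

lemma torus_smooth_char: "z \<in> torus_lattice \<Longrightarrow> torus_smooth (torus_char z)"
  using torus_smooth_fseries[OF rapid_single[of z 1]] fseries_single[of z 1] by simp

lemma frechet_torus_char:
  "frechet_derivative (torus_char z) (at x) v = \<i> * of_real (v \<bullet> z) * torus_char z x"
proof -
  have "(torus_char z has_derivative (\<lambda>v. \<i> * of_real (v \<bullet> z) * torus_char z x)) (at x)"
    unfolding torus_char_def
    by (auto intro!: derivative_eq_intros simp: scaleR_conv_of_real algebra_simps)
  from frechet_derivative_at[OF this, symmetric] show ?thesis by simp
qed

lemma iter_partial_char_le:
  assumes "z \<in> torus_lattice" "set bs \<subseteq> Basis" "length bs \<le> N"
  shows "cmod (iter_partial bs (torus_char z) x) \<le> (1 + norm z) ^ N"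
proof -
  have "cmod (iter_partial bs (fseries (\<lambda>w. if w = z then 1 else 0)) x)
    \<le> (\<Sum>\<^sub>\<infinity>w\<in>torus_lattice. cmod (if w = z then 1 else 0) * (1 + norm w) ^ N)"
    by (rule iter_partial_fseries_le[OF rapid_single assms(2,3)])
  also have "\<dots> = (\<Sum>\<^sub>\<infinity>w\<in>{z}. (1 + norm z) ^ N)"
    by (rule infsum_cong_neutral) (use assms in auto)
  finally show ?thesis by (simp add: fseries_single[OF assms(1)])
qed

text \<open>The seminorms of a character are polynomial in its frequency, so continuity forces
  polynomial growth of the coefficients of a distribution.\<close>

lemma torus_distribution_char_bound:
  fixes u :: "('a::euclidean_space \<Rightarrow> complex) \<Rightarrow> complex"
  assumes u: "torus_distribution u"
  obtains C N where "0 \<le> C" "\<And>z. z \<in> torus_lattice \<Longrightarrow> cmod (u (torus_char z)) \<le> C * (1 + norm z) ^ N"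
proof -
  obtain C N where CN: "0 \<le> C" "\<And>\<phi>. torus_smooth \<phi> \<Longrightarrow> cmod (u \<phi>) \<le> C * test_seminorm N \<phi>"
    by (rule torus_distribution_bound[OF u]) blast
  define K where "K = real (card {bs. set bs \<subseteq> (Basis :: 'a set) \<and> length bs \<le> N})"
  have "cmod (u (torus_char z)) \<le> C * K * (1 + norm z) ^ N" if z: "z \<in> torus_lattice" for z
  proof -
    have "test_seminorm N (torus_char z) \<le> K * (1 + norm z) ^ N"
      unfolding K_def by (rule test_seminorm_leI) (rule iter_partial_char_le[OF z])
    from mult_left_mono[OF this CN(1)] CN(2)[OF torus_smooth_char[OF z]]
    show ?thesis by (simp add: mult.assoc)
  qed
  moreover have "0 \<le> C * K" using CN(1) by (simp add: K_def)
  ultimately show thesis by (rule that[rotated])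
qed

lemma torus_integrable:
  "torus_smooth f \<Longrightarrow> f integrable_on torus_cell"
  by (intro integrable_continuous torus_smooth_continuous)

lemma integral_torus_bound:
  fixes f :: "'a::euclidean_space \<Rightarrow> complex"
  assumes f: "continuous_on torus_cell f" and B: "\<And>x. cmod (f x) \<le> B"
  shows "cmod (integral torus_cell f) \<le> B * (2 * pi) ^ DIM('a)"
proof -
  have "0 \<le> B" by (rule order_trans[OF norm_ge_zero B])
  from has_integral_bound[OF this integrable_integral[OF integrable_continuous[OF f]] B]
  show ?thesis unfolding content_torus_cell .
qed

text \<open>For \<open>w\<close> other than 0 some partial derivative of the character is a non-zero
  multiple of it, and integrals of partial derivatives vanish.\<close>

lemma integral_torus_char:
  fixes w :: "'a::euclidean_space"
  assumes w: "w \<in> torus_lattice"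
  shows "integral torus_cell (torus_char w) = (if w = 0 then (2 * of_real pi) ^ DIM('a) else 0)"
proof (cases "w = 0")
  case True
  then have "torus_char w = (\<lambda>x. 1)" by (auto simp: torus_char_def)
  then show ?thesis
    using True by (simp add: content_torus_cell scaleR_conv_of_real)
next
  case False
  then obtain b where b: "b \<in> Basis" "w \<bullet> b \<noteq> 0" using euclidean_all_zero_iff by blast
  have "0 = integral torus_cell (\<lambda>x. (\<i> * of_real (b \<bullet> w)) * torus_char w x)"
    using integral_torus_partial[OF torus_smooth_char[OF w] b(1)] by (simp add: frechet_torus_char)
  then have "(\<i> * of_real (b \<bullet> w)) * integral torus_cell (torus_char w) = 0" by simp
  then show ?thesis using b False by (simp add: inner_commute)
qed

lemma fcoef_partial:
  fixes f :: "'a::euclidean_space \<Rightarrow> complex"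
  assumes f: "torus_smooth f" and b: "b \<in> Basis" and z: "z \<in> torus_lattice"
  shows "fcoef (\<lambda>x. frechet_derivative f (at x) b) z = \<i> * of_real (b \<bullet> z) * fcoef f z"
proof -
  let ?D = "\<lambda>f x. frechet_derivative f (at x) b"
  note e = torus_smooth_char[OF torus_lattice_uminus[OF z]]
  have "0 = integral torus_cell (?D (\<lambda>x. f x * torus_char (- z) x))"
    using integral_torus_partial[OF torus_smooth_mult[OF f e] b] by simp
  also have "?D (\<lambda>x. f x * torus_char (- z) x) = (\<lambda>x. (- \<i> * of_real (b \<bullet> z)) * (f x * torus_char (- z) x) + ?D f x * torus_char (- z) x)"
    by (rule ext) (simp add: frechet_mult[OF f e] frechet_torus_char)
  also have "integral torus_cell \<dots> = (- \<i> * of_real (b \<bullet> z)) * integral torus_cell (\<lambda>x. f x * torus_char (- z) x)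
      + integral torus_cell (\<lambda>x. ?D f x * torus_char (- z) x)"
    by (subst integral_add[OF torus_integrable[OF torus_smooth_cmult[OF torus_smooth_mult[OF f e]]]
          torus_integrable[OF torus_smooth_mult[OF torus_smooth_frechet[OF f] e]]]) simp
  finally show ?thesis unfolding fcoef_def by simp
qed

lemma cmod_fcoef_le:
  fixes f :: "'a::euclidean_space \<Rightarrow> complex"
  assumes f: "continuous_on torus_cell f" and B: "\<And>x. cmod (f x) \<le> B"
  shows "cmod (fcoef f z) \<le> B"
proof -
  have "cmod (integral torus_cell (\<lambda>x. f x * torus_char (- z) x)) \<le> B * (2 * pi) ^ DIM('a)"
    by (rule integral_torus_bound) (use f B in \<open>auto simp: norm_mult torus_char_def intro!: continuous_intros\<close>)
  then show ?thesis
    unfolding fcoef_def by (simp add: norm_divide norm_mult norm_power pos_divide_le_eq)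
qed

text \<open>The factor \<open>1 + norm z\<close> is at most 1 plus the sum of the moduli of the
  coordinates, and a coordinate times a coefficient is, up to a unit factor, the coefficient of a
  partial derivative. Every step thus yields \<open>1 + DIM('a)\<close> terms, the base of the
  constant.\<close>

lemma fcoef_decay:
  fixes z :: "'a::euclidean_space"
  assumes z: "z \<in> torus_lattice" and f: "torus_smooth f"
  shows "cmod (fcoef f z) * (1 + norm z) ^ N \<le> (1 + real DIM('a)) ^ N * test_seminorm N f"
  using f
proof (induction N arbitrary: f)
  case 0
  have "cmod (fcoef f z) \<le> test_seminorm 0 f"
    using cmod_iter_partial_le_test_seminorm[OF 0, of "[]" 0]
    by (intro cmod_fcoef_le torus_smooth_continuous 0) simp
  then show ?case by simp
next
  case (Suc N)
  let ?D = "\<lambda>b x. frechet_derivative f (at x) b"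
  let ?K = "(1 + real DIM('a)) ^ N" and ?W = "(1 + norm z) ^ N"
  have "cmod (fcoef f z) * (1 + norm z) ^ Suc N \<le> (cmod (fcoef f z) + (\<Sum>b\<in>Basis. cmod (fcoef (?D b) z))) * ?W"
  proof -
    have "cmod (fcoef f z) * (1 + norm z) \<le> cmod (fcoef f z) * (1 + (\<Sum>b\<in>Basis. \<bar>z \<bullet> b\<bar>))"
      by (intro mult_left_mono add_left_mono norm_le_l1) simp
    also have "\<dots> = cmod (fcoef f z) + (\<Sum>b\<in>Basis. cmod (fcoef (?D b) z))"
      using fcoef_partial[OF Suc.prems _ z]
      by (simp add: norm_mult distrib_left sum_distrib_left inner_commute mult.commute)
    finally show ?thesis by (simp add: mult_right_mono mult.assoc[symmetric])
  qed
  also have "\<dots> \<le> ?K * test_seminorm (Suc N) f + (\<Sum>b\<in>(Basis::'a set). ?K * test_seminorm (Suc N) f)"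
    unfolding distrib_right sum_distrib_right
  proof (intro add_mono sum_mono)
    have K: "0 \<le> ?K" by simp
    show "cmod (fcoef f z) * ?W \<le> ?K * test_seminorm (Suc N) f"
      by (rule order_trans[OF Suc.IH[OF Suc.prems] mult_left_mono[OF test_seminorm_mono[OF Suc.prems] K]]) simp
    show "cmod (fcoef (?D b) z) * ?W \<le> ?K * test_seminorm (Suc N) f" if "b \<in> Basis" for b
      by (rule order_trans[OF Suc.IH[OF torus_smooth_frechet[OF Suc.prems]] mult_left_mono[OF test_seminorm_frechet[OF Suc.prems that] K]])
  qed
  also have "\<dots> = (1 + real DIM('a)) ^ Suc N * test_seminorm (Suc N) f"
    by (simp add: algebra_simps)
  finally show ?case .
qed

lemma rapid_fcoef:
  assumes "torus_smooth f"
  shows "rapid (fcoef f)"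
  unfolding rapid_def using fcoef_decay[OF _ assms] by meson

text \<open>Uniform convergence by the Weierstrass test. The map \<open>h\<close> lets the series be
  integrated over the whole cell as well as over slices on which one variable is fixed.\<close>

lemma fseries_integral_has_sum:
  fixes a :: "'a::euclidean_space \<Rightarrow> complex" and h :: "'b::euclidean_space \<Rightarrow> 'a"
  assumes a: "rapid a" and h: "continuous_on (cbox p q) h" and g: "continuous_on (cbox p q) g"
  shows "((\<lambda>z. a z * integral (cbox p q) (\<lambda>x. torus_char z (h x) * g x)) has_sum
     integral (cbox p q) (\<lambda>x. fseries a (h x) * g x)) torus_lattice"
proof -
  have "bounded (g ` cbox p q)" by (intro compact_imp_bounded compact_continuous_image g compact_cbox)
  then obtain B where B: "\<And>x. x \<in> cbox p q \<Longrightarrow> cmod (g x) \<le> B" by (auto simp: bounded_iff)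
  have cont: "continuous_on (cbox p q) (\<lambda>x. a z * torus_char z (h x) * g x)" for z
    unfolding torus_char_def by (intro continuous_intros g h)
  have ul: "uniform_limit (cbox p q) (\<lambda>Z x. \<Sum>z\<in>Z. a z * torus_char z (h x) * g x) (\<lambda>x. fseries a (h x) * g x)
    (finite_subsets_at_top torus_lattice)"
  proof (rule Weierstrass_m_test_general'[where M = "\<lambda>z. cmod (a z) * B"])
    show "norm (a z * torus_char z (h x) * g x) \<le> cmod (a z) * B" if "x \<in> cbox p q" for z x
      using B[OF that] by (simp add: norm_mult mult_left_mono)
    show "((\<lambda>z. a z * torus_char z (h x) * g x) has_sum fseries a (h x) * g x) torus_lattice" for x
      by (intro has_sum_cmult_left fseries_has_sum a)
    show "(\<lambda>z. cmod (a z) * B) summable_on torus_lattice"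
      by (intro summable_on_cmult_left rapid_norm_summable a)
  qed
  obtain I J where IJ: "\<And>Z. ((\<lambda>x. \<Sum>z\<in>Z. a z * torus_char z (h x) * g x) has_integral I Z) (cbox p q)"
    "((\<lambda>x. fseries a (h x) * g x) has_integral J) (cbox p q)" "(I \<longlongrightarrow> J) (finite_subsets_at_top torus_lattice)"
    by (rule uniform_limit_integral_cbox[OF ul]) (auto intro: continuous_on_sum cont)
  have "I Z = (\<Sum>z\<in>Z. a z * integral (cbox p q) (\<lambda>x. torus_char z (h x) * g x))" for Z
  proof (cases "finite Z")
    case True
    have "((\<lambda>x. \<Sum>z\<in>Z. a z * torus_char z (h x) * g x) has_integral
        (\<Sum>z\<in>Z. integral (cbox p q) (\<lambda>x. a z * torus_char z (h x) * g x))) (cbox p q)"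
      by (intro has_integral_sum True integrable_integral integrable_continuous cont)
    from has_integral_unique[OF IJ(1) this] show ?thesis by (simp add: mult.assoc)
  next
    case False
    then show ?thesis using IJ(1)[of Z] by (simp add: has_integral_0_eq)
  qed
  then have "I = sum (\<lambda>z. a z * integral (cbox p q) (\<lambda>x. torus_char z (h x) * g x))" by auto
  then show ?thesis using IJ(3) unfolding has_sum_def integral_unique[OF IJ(2)] by simp
qed

lemma fcoef_char:
  fixes z w :: "'a::euclidean_space"
  assumes "z \<in> torus_lattice" "w \<in> torus_lattice"
  shows "fcoef (torus_char z) w = (if z = w then 1 else 0)"
proof -
  have "integral torus_cell (\<lambda>x. torus_char z x * torus_char (- w) x) = integral torus_cell (torus_char (z - w))"
    unfolding torus_char_add[symmetric] by simp
  then show ?thesis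
    unfolding fcoef_def by (simp add: integral_torus_char torus_lattice_diff assms)
qed

lemma fcoef_fseries:
  fixes a :: "'a::euclidean_space \<Rightarrow> complex"
  assumes a: "rapid a" and w: "w \<in> torus_lattice"
  shows "fcoef (fseries a) w = a w"
proof -
  let ?c = "(2 * of_real pi) ^ DIM('a) :: complex"
  have "((\<lambda>z. a z * integral torus_cell (\<lambda>x. torus_char z x * torus_char (- w) x)) has_sum
     integral torus_cell (\<lambda>x. fseries a x * torus_char (- w) x)) torus_lattice"
    by (rule fseries_integral_has_sum[OF a, of _ _ "\<lambda>x. x"]) (auto simp: torus_char_def intro!: continuous_intros)
  moreover have "a z * integral torus_cell (\<lambda>x. torus_char z x * torus_char (- w) x) = (if z = w then a w * ?c else 0)"
    if "z \<in> torus_lattice" for z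
    using fcoef_char[OF that w] unfolding fcoef_def by (auto split: if_splits)
  ultimately have "((\<lambda>z. if z = w then a w * ?c else 0) has_sum
     integral torus_cell (\<lambda>x. fseries a x * torus_char (- w) x)) torus_lattice"
    by (simp cong: has_sum_cong)
  moreover have "((\<lambda>z. if z = w then a w * ?c else 0) has_sum (a w * ?c)) torus_lattice"
  proof (subst has_sum_cong_neutral[where T = "{w}" and g = "\<lambda>_. a w * ?c"])
    show "((\<lambda>_. a w * ?c) has_sum a w * ?c) {w}" using has_sum_finite[of "{w}" "\<lambda>_. a w * ?c"] by simp
  qed (use w in auto)
  ultimately have "integral torus_cell (\<lambda>x. fseries a x * torus_char (- w) x) = a w * ?c"
    by (rule has_sum_unique)
  then show ?thesis unfolding fcoef_def by simp
qed

subsection \<open>Fourier inversion\<close>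

inductive trig_poly :: "('a::euclidean_space \<Rightarrow> complex) \<Rightarrow> bool" where
  char: "z \<in> torus_lattice \<Longrightarrow> trig_poly (torus_char z)"
| cmult: "trig_poly f \<Longrightarrow> trig_poly (\<lambda>x. c * f x)"
| add: "trig_poly f \<Longrightarrow> trig_poly g \<Longrightarrow> trig_poly (\<lambda>x. f x + g x)"

lemma trig_poly_smooth: "trig_poly f \<Longrightarrow> torus_smooth f"
  by (induction rule: trig_poly.induct) (rule torus_smooth_char torus_smooth_cmult torus_smooth_add; assumption)+

lemma trig_poly_mult:
  assumes "trig_poly f" "trig_poly g"
  shows "trig_poly (\<lambda>x. f x * g x)"
  using assms(1)
proof induction
  case (char z)
  show ?case using assms(2)
  proof induction
    case (char w)
    have "trig_poly (torus_char (z + w))"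
      using \<open>z \<in> torus_lattice\<close> char by (intro trig_poly.char) (auto simp: torus_lattice_def inner_add_left)
    moreover have "torus_char (z + w) = (\<lambda>x. torus_char z x * torus_char w x)"
      by (rule ext) (rule torus_char_add)
    ultimately show ?case by simp
  next
    case (cmult f c)
    from trig_poly.cmult[OF cmult.IH, of c] show ?case by (simp add: mult.left_commute)
  next
    case (add f g)
    from trig_poly.add[OF add.IH] show ?case by (simp add: distrib_left)
  qed
next
  case (cmult f c)
  from trig_poly.cmult[OF cmult.IH, of c] show ?case by (simp add: mult.assoc)
next
  case (add f g)
  from trig_poly.add[OF add.IH] show ?case by (simp add: distrib_right)
qed

lemma trig_poly_const: "trig_poly (\<lambda>x. c)"
proof -
  have "trig_poly (\<lambda>x. c * torus_char 0 x)" by (intro trig_poly.intros torus_lattice_zero)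
  then show ?thesis by (simp add: torus_char_def)
qed

lemma trig_poly_sum: "(\<And>i. i \<in> A \<Longrightarrow> trig_poly (f i)) \<Longrightarrow> trig_poly (\<lambda>x. \<Sum>i\<in>A. f i x)"
  by (induction A rule: infinite_finite_induct) (auto intro: trig_poly.add trig_poly_const)

text \<open>The torus as a compact set in Euclidean space: each coordinate becomes the pair of its
  cosine and sine, and polynomials on this set pull back to trigonometric polynomials.\<close>

definition circle_embedding :: "'a::euclidean_space \<Rightarrow> 'a \<times> 'a" where
  "circle_embedding x = (\<Sum>b\<in>Basis. cos (x \<bullet> b) *\<^sub>R b, \<Sum>b\<in>Basis. sin (x \<bullet> b) *\<^sub>R b)"

lemma continuous_circle_embedding: "continuous_on S circle_embedding"
  unfolding circle_embedding_def by (intro continuous_intros)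

lemma circle_embedding_eq:
  fixes x y :: "'a::euclidean_space"
  assumes f: "torus_smooth f" and eq: "circle_embedding x = circle_embedding y"
  shows "f x = f y"
proof -
  define z where "z = (1 / (2 * pi)) *\<^sub>R (x - y)"
  have "z \<bullet> b \<in> \<int>" if b: "b \<in> Basis" for b
  proof -
    have "fst (circle_embedding x) \<bullet> b = fst (circle_embedding y) \<bullet> b"
      "snd (circle_embedding x) \<bullet> b = snd (circle_embedding y) \<bullet> b" using eq by simp_all
    then have "cos (x \<bullet> b) = cos (y \<bullet> b)" "sin (x \<bullet> b) = sin (y \<bullet> b)"
      unfolding circle_embedding_def fst_conv snd_conv inner_sum_left_Basis[OF b] by simp_all
    then obtain n :: int where "x \<bullet> b = y \<bullet> b + 2 * pi * n" using sin_cos_eq_iff by blast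
    then have "z \<bullet> b = n" by (simp add: z_def inner_diff_left)
    then show ?thesis by simp
  qed
  from torus_periodic_lattice[of f z y, OF torus_smooth_periodic[OF f] this]
  show ?thesis by (simp add: z_def)
qed

text \<open>Euler's formulas express the cosine and sine of the coordinate along \<open>b\<close> by
  the characters of \<open>b\<close> and \<open>- b\<close>.\<close>

lemma trig_poly_linear_circle:
  fixes l :: "'a::euclidean_space \<times> 'a \<Rightarrow> real"
  assumes "bounded_linear l"
  shows "trig_poly (\<lambda>x. of_real (l (circle_embedding x)))"
proof -
  interpret l: bounded_linear l by fact
  have l: "l (p, q) = l (p, 0) + l (0, q)" for p q using l.add[of "(p, 0)" "(0, q)"] by simp
  have l1: "l (\<Sum>b\<in>Basis. g b *\<^sub>R b, 0) = (\<Sum>b\<in>Basis. g b * l (b, 0))" for g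
  proof -
    have "(\<Sum>b\<in>Basis. g b *\<^sub>R b, 0) = (\<Sum>b\<in>Basis. g b *\<^sub>R (b, 0::'a))" by (simp add: prod_eq_iff fst_sum snd_sum)
    then show ?thesis by (simp add: l.sum l.scaleR del: scaleR_Pair)
  qed
  have l2: "l (0, \<Sum>b\<in>Basis. g b *\<^sub>R b) = (\<Sum>b\<in>Basis. g b * l (0, b))" for g
  proof -
    have "(0, \<Sum>b\<in>Basis. g b *\<^sub>R b) = (\<Sum>b\<in>Basis. g b *\<^sub>R (0::'a, b))" by (simp add: prod_eq_iff fst_sum snd_sum)
    then show ?thesis by (simp add: l.sum l.scaleR del: scaleR_Pair)
  qed
  have L: "b \<in> torus_lattice" "- b \<in> torus_lattice" if "b \<in> Basis" for b :: 'a
    using that by (auto simp: torus_lattice_def inner_Basis)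
  have "(\<lambda>x. complex_of_real (l (circle_embedding x))) = (\<lambda>x. \<Sum>b\<in>Basis.
      (of_real (l (b, 0)) / 2 + of_real (l (0, b)) / (2 * \<i>)) * torus_char b x +
      (of_real (l (b, 0)) / 2 - of_real (l (0, b)) / (2 * \<i>)) * torus_char (- b) x)"
  proof
    fix x
    have "complex_of_real (l (circle_embedding x)) =
      (\<Sum>b\<in>Basis. of_real (cos (x \<bullet> b)) * of_real (l (b, 0)) + of_real (sin (x \<bullet> b)) * of_real (l (0, b)))"
      unfolding circle_embedding_def by (subst l) (simp add: l1 l2 sum.distrib)
    also have "\<dots> = (\<Sum>b\<in>Basis.
      (of_real (l (b, 0)) / 2 + of_real (l (0, b)) / (2 * \<i>)) * torus_char b x +
      (of_real (l (b, 0)) / 2 - of_real (l (0, b)) / (2 * \<i>)) * torus_char (- b) x)"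
      by (intro sum.cong refl) (simp add: torus_char_def complex_eq_iff)
    finally show "complex_of_real (l (circle_embedding x)) = \<dots>" .
  qed
  then show ?thesis
    by (simp only:) (intro trig_poly_sum trig_poly.add trig_poly.cmult trig_poly.char L)
qed

lemma trig_poly_polynomial_circle:
  fixes g :: "'a::euclidean_space \<times> 'a \<Rightarrow> complex"
  assumes "polynomial_function g"
  shows "trig_poly (\<lambda>x. g (circle_embedding x))"
proof -
  have r: "trig_poly (\<lambda>x. of_real (r (circle_embedding x)))" if "real_polynomial_function r"
    for r :: "'a \<times> 'a \<Rightarrow> real"
    using that
  proof induction
    case (linear f) then show ?case by (rule trig_poly_linear_circle)
  next
    case (const c) show ?case by (rule trig_poly_const)
  next
    case (add f g) from trig_poly.add[OF add.IH] show ?case by simp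
  next
    case (mult f g) from trig_poly_mult[OF mult.IH] show ?case by simp
  qed
  have "real_polynomial_function (Re \<circ> g)" "real_polynomial_function (Im \<circ> g)"
    using assms unfolding polynomial_function_def using bounded_linear_Re bounded_linear_Im by blast+
  from this[THEN r] have "trig_poly (\<lambda>x. of_real (Re (g (circle_embedding x))) + \<i> * of_real (Im (g (circle_embedding x))))"
    by (intro trig_poly.add trig_poly.cmult) simp_all
  then show ?thesis unfolding complex_eq[symmetric] .
qed

text \<open>A periodic function descends to the image of \<open>circle_embedding\<close>, where
  Stone-Weierstrass applies. It is the conjugate that gets approximated, because the orthogonality
  argument that follows pairs it with \<open>f\<close>.\<close>

lemma trig_poly_dense:
  fixes f :: "'a::euclidean_space \<Rightarrow> complex"
  assumes f: "torus_smooth f" and e: "0 < e"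
  obtains h where "trig_poly h" "\<And>x. x \<in> torus_cell \<Longrightarrow> cmod (cnj (f x) - h x) < e"
proof -
  let ?p = "circle_embedding :: 'a \<Rightarrow> 'a \<times> 'a"
  let ?K = "?p ` torus_cell"
  define F where "F y = f (inv_into torus_cell ?p y)" for y
  have F: "F (?p x) = f x" if "x \<in> torus_cell" for x
    unfolding F_def by (rule circle_embedding_eq[OF f], rule f_inv_into_f) (use that in blast)
  have K: "compact ?K" by (intro compact_continuous_image continuous_circle_embedding compact_cbox)
  \<comment> \<open>The embedding of the compact cell is a closed map: preimages of closed sets
    under \<open>F\<close> are images of compact sets, hence closed.\<close>
  have "continuous_on ?K F"
    unfolding continuous_on_closed_vimage[OF compact_imp_closed[OF K]]
  proof (intro allI impI)
    fix B :: "complex set" assume B: "closed B"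
    have "F -` B \<inter> ?K = ?p ` (f -` B \<inter> torus_cell)" using F by auto
    moreover have "closed (f -` B)"
      by (rule closed_vimage[OF B torus_smooth_continuous[OF f]])
    then have "compact (f -` B \<inter> torus_cell)" by (simp add: closed_Int_compact)
    then have "compact (?p ` (f -` B \<inter> torus_cell))"
      by (intro compact_continuous_image continuous_circle_embedding)
    ultimately show "closed (F -` B \<inter> ?K)" by (simp add: compact_imp_closed)
  qed
  then have "continuous_on ?K (\<lambda>y. cnj (F y))" by (intro continuous_intros)
  from Stone_Weierstrass_polynomial_function[OF K this e] obtain g where
    g: "polynomial_function g" "\<And>y. y \<in> ?K \<Longrightarrow> cmod (cnj (F y) - g y) < e" by blast
  show thesis
  proof
    show "trig_poly (\<lambda>x. g (?p x))" by (rule trig_poly_polynomial_circle[OF g(1)])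
    show "cmod (cnj (f x) - g (?p x)) < e" if "x \<in> torus_cell" for x
      using g(2)[of "?p x"] F[OF that] that by simp
  qed
qed

text \<open>Vanishing coefficients make \<open>f\<close> annihilate all trigonometric polynomials.
  Approximating the conjugate of \<open>f\<close> by them makes the integral of its squared modulus
  arbitrarily small, hence 0, and a continuous non-negative function with zero integral
  vanishes.\<close>

lemma fcoef_zero_imp_zero:
  fixes f :: "'a::euclidean_space \<Rightarrow> complex"
  assumes f: "torus_smooth f" and z: "\<And>z. z \<in> torus_lattice \<Longrightarrow> fcoef f z = 0"
  shows "f x = 0"
proof -
  have orth: "integral torus_cell (\<lambda>x. f x * h x) = 0" if "trig_poly h" for h
    using that
  proof induction
    case (char w)
    then have "fcoef f (- w) = 0" by (intro z torus_lattice_uminus)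
    then show ?case unfolding fcoef_def by simp
  next
    case (cmult h c)
    then show ?case by (simp add: mult.left_commute)
  next
    case (add h g)
    have "integral torus_cell (\<lambda>x. f x * (h x + g x)) = integral torus_cell (\<lambda>x. f x * h x) + integral torus_cell (\<lambda>x. f x * g x)"
      unfolding distrib_left
      by (intro integral_add torus_integrable torus_smooth_mult f trig_poly_smooth add.hyps)
    then show ?case using add.IH by simp
  qed
  obtain B where B: "\<And>x. cmod (f x) \<le> B" using torus_smooth_bdd_above[OF f] by (auto simp: bdd_above_def)
  have B0: "0 \<le> B" by (rule order_trans[OF norm_ge_zero B])
  let ?J = "integral torus_cell (\<lambda>x. f x * cnj (f x))"
  have cf: "continuous_on torus_cell (\<lambda>x. f x * cnj (f x))"
    by (intro continuous_intros torus_smooth_continuous f)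
  have "cmod ?J \<le> e" if e: "0 < e" for e
  proof -
    \<comment> \<open>\<open>B * d\<close> times the measure of the cell has to stay below
      \<open>e\<close>; the summand 1 guards against \<open>B = 0\<close>.\<close>
    define d where "d = e / ((B + 1) * (2 * pi) ^ DIM('a))"
    have pos: "0 < (B + 1) * (2 * pi) ^ DIM('a)" using B0 by simp
    then have d: "0 < d" unfolding d_def using e by simp
    obtain h where h: "trig_poly h" "\<And>x. x \<in> torus_cell \<Longrightarrow> cmod (cnj (f x) - h x) < d"
      by (rule trig_poly_dense[OF f d]) blast
    have hf: "(\<lambda>x. f x * h x) integrable_on torus_cell"
      by (intro torus_integrable torus_smooth_mult f trig_poly_smooth h)
    have "?J = integral torus_cell (\<lambda>x. f x * cnj (f x)) - integral torus_cell (\<lambda>x. f x * h x)"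
      using orth[OF h(1)] by simp
    also have "\<dots> = integral torus_cell (\<lambda>x. f x * cnj (f x) - f x * h x)"
      by (rule integral_diff[symmetric, OF integrable_continuous[OF cf] hf])
    finally have J: "?J = integral torus_cell (\<lambda>x. f x * (cnj (f x) - h x))" by (simp add: right_diff_distrib)
    have "cmod ?J \<le> (B * d) * measure lborel (torus_cell :: 'a set)"
      unfolding J
    proof (rule has_integral_bound[OF _ integrable_integral])
      show "0 \<le> B * d" using B0 d by simp
      show "(\<lambda>x. f x * (cnj (f x) - h x)) integrable_on torus_cell"
        unfolding right_diff_distrib by (rule integrable_diff[OF integrable_continuous[OF cf] hf])
      show "cmod (f x * (cnj (f x) - h x)) \<le> B * d" if "x \<in> torus_cell" for x
        unfolding norm_mult by (rule mult_mono) (use B B0 h(2)[OF that] in auto)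
    qed
    also have "\<dots> = B * e / (B + 1)"
    proof -
      have "(2 * pi) ^ DIM('a) \<noteq> 0" "B + 1 \<noteq> 0" using B0 by auto
      then show ?thesis unfolding content_torus_cell d_def by (simp del: power_mult_distrib)
    qed
    also have "\<dots> \<le> e" using B0 e by (simp add: field_simps)
    finally show ?thesis .
  qed
  then have "cmod ?J \<le> 0" by (rule field_le_epsilon[of _ 0, simplified])
  then have "?J = 0" by simp
  then have "((\<lambda>x. f x * cnj (f x)) has_integral 0) torus_cell"
    using integrable_integral[OF integrable_continuous[OF cf]] by simp
  from has_integral_linear[OF this bounded_linear_Re]
  have int: "((\<lambda>x. (cmod (f x))\<^sup>2) has_integral 0) torus_cell"
    by (simp add: o_def complex_mult_cnj cmod_power2)
  have zero: "f y = 0" if y: "y \<in> torus_cell" for y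
  proof -
    have "(cmod (f y))\<^sup>2 = 0"
      by (rule has_integral_0_cbox_imp_0[OF _ _ int _ y])
        (auto intro!: continuous_intros torus_smooth_continuous f simp: box_ne_empty)
    then show ?thesis by simp
  qed
  show ?thesis by (rule torus_smooth_cell[OF f, of x]) (use zero in metis)
qed

lemma fcoef_add:
  "torus_smooth f \<Longrightarrow> torus_smooth g \<Longrightarrow> z \<in> torus_lattice \<Longrightarrow>
   fcoef (\<lambda>x. f x + g x) z = fcoef f z + fcoef g z"
  unfolding fcoef_def distrib_right
  by (subst integral_add) (auto intro!: torus_integrable torus_smooth_mult torus_smooth_char torus_lattice_uminus simp: add_divide_distrib)

lemma fcoef_cmult: "fcoef (\<lambda>x. c * f x) z = c * fcoef f z"
  unfolding fcoef_def by (simp add: mult.assoc)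

text \<open>The series formed from the coefficients of \<open>f\<close> has these same coefficients,
  so all coefficients of its difference from \<open>f\<close> are 0.\<close>

theorem fourier_inversion:
  assumes f: "torus_smooth f"
  shows "fseries (fcoef f) = f"
proof
  fix x
  note s = torus_smooth_fseries[OF rapid_fcoef[OF f]]
  have "fseries (fcoef f) x + (- 1) * f x = 0"
  proof (rule fcoef_zero_imp_zero[where f = "\<lambda>x. fseries (fcoef f) x + (- 1) * f x"])
    show "torus_smooth (\<lambda>x. fseries (fcoef f) x + (- 1) * f x)"
      by (rule torus_smooth_add[OF s torus_smooth_cmult[OF f]])
    show "fcoef (\<lambda>x. fseries (fcoef f) x + (- 1) * f x) z = 0" if "z \<in> torus_lattice" for z
      by (subst fcoef_add[OF s torus_smooth_cmult[OF f] that]) 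
        (simp only: fcoef_fseries[OF rapid_fcoef[OF f] that] fcoef_cmult, simp)
  qed
  then show "fseries (fcoef f) x = f x" by simp
qed

text \<open>Finite partial sums pass through \<open>u\<close> by linearity. The remainder is again a
  series with rapidly decreasing coefficients, and continuity bounds \<open>u\<close> on it by the
  tail of a convergent weighted sum.\<close>

theorem torus_distribution_fseries:
  fixes u :: "('a::euclidean_space \<Rightarrow> complex) \<Rightarrow> complex"
  assumes u: "torus_distribution u" and a: "rapid a"
  shows "((\<lambda>z. a z * u (torus_char z)) has_sum u (fseries a)) torus_lattice"
proof -
  obtain C N where CN: "0 \<le> C" "\<And>\<phi>. torus_smooth \<phi> \<Longrightarrow> cmod (u \<phi>) \<le> C * test_seminorm N \<phi>"
    by (rule torus_distribution_bound[OF u]) blast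
  let ?w = "\<lambda>z. cmod (a z) * (1 + norm z) ^ N"
  define K where "K = real (card {bs. set bs \<subseteq> (Basis :: 'a set) \<and> length bs \<le> N})"
  have fin: "torus_smooth (\<lambda>x. \<Sum>z\<in>F. a z * torus_char z x) \<and>
      u (\<lambda>x. \<Sum>z\<in>F. a z * torus_char z x) = (\<Sum>z\<in>F. a z * u (torus_char z))"
    if "finite F" "F \<subseteq> torus_lattice" for F
    using that
  proof (induction F)
    case empty
    have "u (\<lambda>x. 0 * (0::complex)) = 0 * u (\<lambda>x. 0)"
      by (rule torus_distribution_cmult[OF u torus_smooth_const])
    then show ?case by (simp add: torus_smooth_const)
  next
    case (insert z F)
    from insert show ?case
      by (simp add: torus_distribution_add[OF u torus_smooth_cmult] torus_smooth_char torus_smooth_add torus_smooth_cmult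
          torus_distribution_cmult[OF u])
  qed
  have tail: "cmod (u (fseries a) - (\<Sum>z\<in>F. a z * u (torus_char z)))
      \<le> C * K * (infsum ?w torus_lattice - sum ?w F)"
    if F: "finite F" "F \<subseteq> torus_lattice" for F
  proof -
    define a' where "a' z = (if z \<in> F then 0 else a z)" for z
    have a': "rapid a'" by (rule rapid_mono[OF a]) (simp add: a'_def)
    have split: "fseries a x = (\<Sum>z\<in>F. a z * torus_char z x) + fseries a' x" for x
    proof -
      have "((\<lambda>z. a z * torus_char z x - a' z * torus_char z x) has_sum (fseries a x - fseries a' x)) torus_lattice"
        by (intro has_sum_diff fseries_has_sum a a')
      moreover have "((\<lambda>z. a z * torus_char z x - a' z * torus_char z x) has_sum (\<Sum>z\<in>F. a z * torus_char z x)) torus_lattice"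
        by (subst has_sum_cong_neutral[where T = F and g = "\<lambda>z. a z * torus_char z x"])
          (use F in \<open>auto simp: a'_def\<close>)
      ultimately show ?thesis using has_sum_unique by fastforce
    qed
    have s': "torus_smooth (fseries a')" by (rule torus_smooth_fseries[OF a'])
    have "u (fseries a) = u (\<lambda>x. (\<Sum>z\<in>F. a z * torus_char z x) + fseries a' x)"
      using split by (metis (no_types))
    also have "\<dots> = (\<Sum>z\<in>F. a z * u (torus_char z)) + u (fseries a')"
      using fin[OF F] torus_distribution_add[OF u _ s'] by simp
    finally have "cmod (u (fseries a) - (\<Sum>z\<in>F. a z * u (torus_char z))) = cmod (u (fseries a'))" by simp
    also have "\<dots> \<le> C * test_seminorm N (fseries a')" by (rule CN(2)[OF s'])
    also have "test_seminorm N (fseries a') \<le> K * (\<Sum>\<^sub>\<infinity>z\<in>torus_lattice. cmod (a' z) * (1 + norm z) ^ N)"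
      unfolding K_def by (rule test_seminorm_leI) (rule iter_partial_fseries_le[OF a'])
    also have "(\<Sum>\<^sub>\<infinity>z\<in>torus_lattice. cmod (a' z) * (1 + norm z) ^ N) = infsum ?w (torus_lattice - F)"
      by (rule infsum_cong_neutral) (auto simp: a'_def)
    also have "\<dots> = infsum ?w torus_lattice - sum ?w F"
      by (subst infsum_Diff) (use F rapid_summable[OF a] in \<open>auto intro: summable_on_finite\<close>)
    finally show ?thesis using CN(1) by (simp add: mult_left_mono mult.assoc)
  qed
  have "((\<lambda>F. C * K * (infsum ?w torus_lattice - sum ?w F)) \<longlongrightarrow> C * K * (infsum ?w torus_lattice - infsum ?w torus_lattice))
      (finite_subsets_at_top torus_lattice)"
    using has_sum_infsum[OF rapid_summable[OF a, of N]] unfolding has_sum_def by (intro tendsto_intros)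
  then have lim: "((\<lambda>F. C * K * (infsum ?w torus_lattice - sum ?w F)) \<longlongrightarrow> 0) (finite_subsets_at_top torus_lattice)"
    by simp
  have ev: "\<forall>\<^sub>F F in finite_subsets_at_top torus_lattice.
      norm ((\<Sum>z\<in>F. a z * u (torus_char z)) - u (fseries a)) \<le> C * K * (infsum ?w torus_lattice - sum ?w F)"
    by (rule eventually_finite_subsets_at_top_weakI) (use tail in \<open>simp add: norm_minus_commute\<close>)
  have "((\<lambda>F. (\<Sum>z\<in>F. a z * u (torus_char z)) - u (fseries a)) \<longlongrightarrow> 0) (finite_subsets_at_top torus_lattice)"
    by (rule Lim_null_comparison[OF ev lim])
  then show ?thesis unfolding has_sum_def by (simp add: LIM_zero_iff)
qed

subsection \<open>Distributions and their coefficients\<close>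

theorem torus_distribution_fourier:
  assumes "torus_distribution u" "torus_smooth f"
  shows "((\<lambda>z. fcoef f z * u (torus_char z)) has_sum u f) torus_lattice"
  using torus_distribution_fseries[OF assms(1) rapid_fcoef[OF assms(2)]] fourier_inversion[OF assms(2)] by simp

lemma torus_distribution_eqI:
  assumes "torus_distribution u" "torus_distribution v"
    and "\<And>z. z \<in> torus_lattice \<Longrightarrow> u (torus_char z) = v (torus_char z)" and f: "torus_smooth f"
  shows "u f = v f"
proof (rule has_sum_unique[OF torus_distribution_fourier[OF assms(1) f]])
  show "((\<lambda>z. fcoef f z * u (torus_char z)) has_sum v f) torus_lattice"
    using torus_distribution_fourier[OF assms(2) f] assms(3) by (simp cong: has_sum_cong)
qed

text \<open>Representation formulas for distributions hold on test functions only, so properties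
  have to be transferred along agreement there rather than along equality of functions.\<close>

lemma torus_distribution_cong:
  fixes u v :: "('a::euclidean_space \<Rightarrow> complex) \<Rightarrow> complex"
  assumes u: "torus_distribution u" and eq: "\<And>f. torus_smooth f \<Longrightarrow> v f = u f"
  shows "torus_distribution v"
proof -
  obtain C N where CN: "0 \<le> C" "\<And>\<phi>. torus_smooth \<phi> \<Longrightarrow> cmod (u \<phi>) \<le> C * test_seminorm N \<phi>"
    by (rule torus_distribution_bound[OF u]) blast
  show ?thesis
    unfolding torus_distribution_def
  proof (intro conjI allI impI exI)
    fix f g :: "'a \<Rightarrow> complex" and a b :: complex assume fg: "torus_smooth f" "torus_smooth g"
    then show "v (\<lambda>x. a * f x + b * g x) = a * v f + b * v g"
      using eq[OF torus_smooth_add[OF torus_smooth_cmult[OF fg(1)] torus_smooth_cmult[OF fg(2)]]]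
      by (simp add: eq torus_distribution_lincomb[OF u])
  next
    fix f :: "'a \<Rightarrow> complex" assume "torus_smooth f"
    then show "cmod (v f) \<le> C * test_seminorm N f" using CN(2)[of f] by (simp add: eq)
  qed
qed

lemma torus_distribution_integral:
  fixes f :: "'a::euclidean_space \<Rightarrow> complex"
  assumes f: "torus_smooth f"
  shows "torus_distribution (\<lambda>g. integral torus_cell (\<lambda>x. f x * g x))"
proof -
  obtain B where B: "\<And>x. cmod (f x) \<le> B" using torus_smooth_bdd_above[OF f] by (auto simp: bdd_above_def)
  have B0: "0 \<le> B" by (rule order_trans[OF norm_ge_zero B])
  show ?thesis
    unfolding torus_distribution_def
  proof (intro conjI allI impI exI)
    fix g h :: "'a \<Rightarrow> complex" and a b :: complex assume gh: "torus_smooth g" "torus_smooth h"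
    have "(\<lambda>x. f x * (a * g x + b * h x)) = (\<lambda>x. a * (f x * g x) + b * (f x * h x))"
      by (auto simp: algebra_simps)
    then show "integral torus_cell (\<lambda>x. f x * (a * g x + b * h x)) =
        a * integral torus_cell (\<lambda>x. f x * g x) + b * integral torus_cell (\<lambda>x. f x * h x)"
      by (simp add: integral_add torus_integrable torus_smooth_cmult torus_smooth_mult f gh)
  next
    fix g :: "'a \<Rightarrow> complex" assume g: "torus_smooth g"
    have "cmod (integral torus_cell (\<lambda>x. f x * g x)) \<le> (B * test_seminorm 0 g) * (2 * pi) ^ DIM('a)"
    proof (rule integral_torus_bound)
      show "cmod (f x * g x) \<le> B * test_seminorm 0 g" for x
        unfolding norm_mult
        by (rule mult_mono) (use B B0 cmod_iter_partial_le_test_seminorm[OF g, of "[]" 0 x] in auto)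
    qed (intro continuous_intros torus_smooth_continuous f g)
    then show "cmod (integral torus_cell (\<lambda>x. f x * g x)) \<le> (B * (2 * pi) ^ DIM('a)) * test_seminorm 0 g"
      by (simp add: ac_simps)
  qed
qed

lemma smooth_imp_torus_distribution:
  assumes "smooth_distribution u"
  shows "torus_distribution u"
proof -
  obtain f where f: "torus_smooth f" "\<And>g. torus_smooth g \<Longrightarrow> u g = integral torus_cell (\<lambda>x. f x * g x)"
    using assms unfolding smooth_distribution_def by blast
  show ?thesis by (rule torus_distribution_cong[OF torus_distribution_integral[OF f(1)] f(2)])
qed

lemma integral_mult_char:
  fixes f :: "'a::euclidean_space \<Rightarrow> complex"
  shows "integral torus_cell (\<lambda>x. f x * torus_char z x) = (2 * of_real pi) ^ DIM('a) * fcoef f (- z)"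
  unfolding fcoef_def by simp

text \<open>Both directions compare the value of \<open>u\<close> at a character with a coefficient
  of the density. The pairing is without conjugation, so the frequency changes sign.\<close>

theorem smooth_distribution_iff_rapid:
  fixes u :: "('a::euclidean_space \<Rightarrow> complex) \<Rightarrow> complex"
  assumes u: "torus_distribution u"
  shows "smooth_distribution u \<longleftrightarrow> rapid (\<lambda>z. u (torus_char z))"
proof
  let ?c = "(2 * of_real pi) ^ DIM('a) :: complex"
  have rapid_neg: "rapid (\<lambda>z. a (- z))" if ra: "rapid a" for a :: "'a \<Rightarrow> complex"
    unfolding rapid_def
  proof
    fix N
    obtain C where "\<And>z. z \<in> torus_lattice \<Longrightarrow> cmod (a z) * (1 + norm z) ^ N \<le> C"
      using ra unfolding rapid_def by blast
    then have "\<forall>z\<in>torus_lattice. cmod (a (- z)) * (1 + norm z) ^ N \<le> C"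
      using torus_lattice_uminus norm_minus_cancel by metis
    then show "\<exists>C. \<forall>z\<in>torus_lattice. cmod (a (- z)) * (1 + norm z) ^ N \<le> C" by blast
  qed
  {
    assume "smooth_distribution u"
    then obtain f where f: "torus_smooth f" "\<And>g. torus_smooth g \<Longrightarrow> u g = integral torus_cell (\<lambda>x. f x * g x)"
      unfolding smooth_distribution_def by blast
    have r: "rapid (\<lambda>z. ?c * fcoef f (- z))"
      by (rule rapid_mult[where C = "cmod ?c" and M = 0, OF rapid_neg[OF rapid_fcoef[OF f(1)]]]) simp
    show "rapid (\<lambda>z. u (torus_char z))"
      by (rule rapid_mono[OF r]) (simp add: f(2) torus_smooth_char integral_mult_char)
  next
    assume r: "rapid (\<lambda>z. u (torus_char z))"
    \<comment> \<open>Dictated by \<open>integral_mult_char\<close>: the value of \<open>u\<close>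
      at the character of \<open>- z\<close> has to be \<open>?c\<close> times the coefficient of
      the density at \<open>z\<close>.\<close>
    define a where "a z = 1 / ?c * u (torus_char (- z))" for z
    have a: "rapid a"
      unfolding a_def
      by (rule rapid_mult[where C = "cmod (1 / ?c)" and M = 0, OF rapid_neg[OF r]]) simp
    have fa: "torus_smooth (fseries a)" by (rule torus_smooth_fseries[OF a])
    have "u g = integral torus_cell (\<lambda>x. fseries a x * g x)" if "torus_smooth g" for g
    proof (rule torus_distribution_eqI[OF u torus_distribution_integral[OF fa] _ that])
      fix z :: 'a assume z: "z \<in> torus_lattice"
      show "u (torus_char z) = integral torus_cell (\<lambda>x. fseries a x * torus_char z x)"
        unfolding integral_mult_char fcoef_fseries[OF a torus_lattice_uminus[OF z]] by (simp add: a_def)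
    qed
    with fa show "smooth_distribution u" unfolding smooth_distribution_def by blast
  }
qed

text \<open>The distribution with prescribed values \<open>b\<close> on the characters; Fourier
  inversion forces this formula on all other test functions.\<close>

definition coef_distribution :: "('a::euclidean_space \<Rightarrow> complex) \<Rightarrow> ('a \<Rightarrow> complex) \<Rightarrow> complex" where
  "coef_distribution b f = (\<Sum>\<^sub>\<infinity>z\<in>torus_lattice. fcoef f z * b z)"

text \<open>Coefficients of test functions decay faster than \<open>b\<close> grows. Spending
  \<open>N\<close> powers on \<open>b\<close> and \<open>2 * DIM('a)\<close> on summability bounds
  the order of the resulting distribution.\<close>

lemma coef_distribution:
  fixes b :: "'a::euclidean_space \<Rightarrow> complex"
  assumes b: "\<And>z. z \<in> torus_lattice \<Longrightarrow> cmod (b z) \<le> C * (1 + norm z) ^ N"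
  shows coef_distribution_has_sum:
      "torus_smooth f \<Longrightarrow> ((\<lambda>z. fcoef f z * b z) has_sum coef_distribution b f) torus_lattice"
    and torus_distribution_coef: "torus_distribution (coef_distribution b)"
    and coef_distribution_char: "w \<in> torus_lattice \<Longrightarrow> coef_distribution b (torus_char w) = b w"
proof -
  have rb: "rapid (\<lambda>z. b z * fcoef f z)" if "torus_smooth f" for f
    by (rule rapid_mult[OF rapid_fcoef[OF that] b])
  have hs: "((\<lambda>z. fcoef f z * b z) has_sum coef_distribution b f) torus_lattice" if f: "torus_smooth f" for f
    unfolding coef_distribution_def
    by (rule has_sum_infsum, rule abs_summable_summable)
      (use rapid_norm_summable[OF rb[OF f]] in \<open>simp add: mult.commute\<close>)
  then show "torus_smooth f \<Longrightarrow> ((\<lambda>z. fcoef f z * b z) has_sum coef_distribution b f) torus_lattice" .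
  let ?M = "N + 2 * DIM('a)"
  define S where "S = (\<Sum>\<^sub>\<infinity>z\<in>(torus_lattice :: 'a set). inverse ((1 + norm z) ^ (2 * DIM('a))))"
  define K where "K = (1 + real DIM('a)) ^ ?M"
  show "torus_distribution (coef_distribution b)"
    unfolding torus_distribution_def
  proof (intro conjI allI impI exI)
    fix f g :: "'a \<Rightarrow> complex" and c d :: complex assume fg: "torus_smooth f" "torus_smooth g"
    have s: "torus_smooth (\<lambda>x. c * f x + d * g x)" by (intro torus_smooth_add torus_smooth_cmult fg)
    have "((\<lambda>z. c * (fcoef f z * b z) + d * (fcoef g z * b z)) has_sum
        c * coef_distribution b f + d * coef_distribution b g) torus_lattice"
      by (intro has_sum_add has_sum_cmult_right hs fg)
    then have "((\<lambda>z. fcoef (\<lambda>x. c * f x + d * g x) z * b z) has_sum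
        c * coef_distribution b f + d * coef_distribution b g) torus_lattice"
      by (rule has_sum_cong[THEN iffD1, rotated])
        (simp add: fcoef_add torus_smooth_cmult fg fcoef_cmult algebra_simps)
    from has_sum_unique[OF hs[OF s] this]
    show "coef_distribution b (\<lambda>x. c * f x + d * g x) = c * coef_distribution b f + d * coef_distribution b g" .
  next
    fix f :: "'a \<Rightarrow> complex" assume f: "torus_smooth f"
    have "cmod (coef_distribution b f) \<le> (\<bar>C\<bar> * K * test_seminorm ?M f) * S"
    proof (rule norm_infsum_le[OF hs[OF f]])
      show "((\<lambda>z::'a. (\<bar>C\<bar> * K * test_seminorm ?M f) * inverse ((1 + norm z) ^ (2 * DIM('a)))) has_sum
          (\<bar>C\<bar> * K * test_seminorm ?M f) * S) torus_lattice"
        unfolding S_def by (intro has_sum_cmult_right has_sum_infsum torus_lattice_summable)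
      fix z :: 'a assume z: "z \<in> torus_lattice"
      have W: "0 < (1 + norm z) ^ n" for n by (intro zero_less_power add_pos_nonneg) auto
      have "cmod (b z) \<le> \<bar>C\<bar> * (1 + norm z) ^ N"
        by (rule order_trans[OF b[OF z] mult_right_mono]) simp_all
      then have "norm (fcoef f z * b z) * (1 + norm z) ^ (2 * DIM('a))
          \<le> cmod (fcoef f z) * (\<bar>C\<bar> * (1 + norm z) ^ N) * (1 + norm z) ^ (2 * DIM('a))"
        unfolding norm_mult by (intro mult_right_mono mult_left_mono) simp_all
      also have "\<dots> = \<bar>C\<bar> * (cmod (fcoef f z) * (1 + norm z) ^ ?M)" by (simp add: power_add ac_simps)
      also have "\<dots> \<le> \<bar>C\<bar> * (K * test_seminorm ?M f)"
        unfolding K_def by (intro mult_left_mono fcoef_decay z f) simp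
      finally show "norm (fcoef f z * b z) \<le> (\<bar>C\<bar> * K * test_seminorm ?M f) * inverse ((1 + norm z) ^ (2 * DIM('a)))"
        using W[of "2 * DIM('a)"] by (simp add: field_simps)
    qed
    then show "cmod (coef_distribution b f) \<le> (\<bar>C\<bar> * K * S) * test_seminorm ?M f" by (simp add: ac_simps)
  qed
  assume w: "w \<in> torus_lattice"
  have "coef_distribution b (torus_char w) = (\<Sum>\<^sub>\<infinity>z\<in>{w}. b w)"
    unfolding coef_distribution_def
    by (rule infsum_cong_neutral) (use w in \<open>auto simp: fcoef_char\<close>)
  then show "coef_distribution b (torus_char w) = b w" by simp
qed

subsection \<open>Partial Fourier coefficients\<close>

lemma torus_lattice_real: "(torus_lattice :: real set) = \<int>"
  by (auto simp: torus_lattice_def)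

lemma torus_lattice_prod:
  fixes t :: "'a::euclidean_space" and y :: "'b::euclidean_space"
  shows "(t, y) \<in> torus_lattice \<longleftrightarrow> t \<in> torus_lattice \<and> y \<in> torus_lattice"
  by (auto simp: torus_lattice_def Basis_prod_def ball_Un)

lemma torus_lattice_vec: "(torus_lattice :: (real ^ 'n::finite) set) = range zvec"
proof (intro equalityI subsetI)
  fix y :: "real ^ 'n" assume y: "y \<in> torus_lattice"
  have "y $ i \<in> \<int>" for i
    using y by (auto simp: torus_lattice_def Basis_vec_def inner_axis)
  then have "y = zvec (\<chi> i. \<lfloor>y $ i\<rfloor>)"
    by (simp add: zvec_def vec_eq_iff)
  then show "y \<in> range zvec" by blast
next
  fix y :: "real ^ 'n" assume "y \<in> range zvec"
  then show "y \<in> torus_lattice" by (auto simp: torus_lattice_def Basis_vec_def inner_axis zvec_def)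
qed

lemma inj_zvec: "inj zvec"
  by (auto simp: inj_def zvec_def vec_eq_iff)

lemma zvec_in_lattice: "zvec \<xi> \<in> torus_lattice"
  by (simp add: torus_lattice_vec)

lemma torus_char_prod: "torus_char (\<tau>, y) (t, x) = torus_char \<tau> t * torus_char y x"
  by (simp add: torus_char_def inner_prod_def cis_mult)

text \<open>Shifted by 1 so that it is at least 1 at every frequency, including 0: powers are then
  monotone in the exponent and division is safe.\<close>

definition wt :: "int ^ 'n::finite \<Rightarrow> real" where
  "wt \<xi> = 1 + norm (zvec \<xi>)"

lemma wt_ge_1: "1 \<le> wt \<xi>"
  by (simp add: wt_def)

lemma wt_pos: "0 < wt \<xi>"
  using wt_ge_1[of \<xi>] by linarith

lemma norm_prod_le_wt: "1 + norm (\<tau> :: real, - zvec \<xi>) \<le> (1 + \<bar>\<tau>\<bar>) * wt \<xi>"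
  using norm_Pair_le[of \<tau> "- zvec \<xi>"] mult_nonneg_nonneg[OF abs_ge_zero[of \<tau>] norm_ge_zero[of "zvec \<xi>"]]
  unfolding wt_def real_norm_def norm_minus_cancel distrib_left distrib_right by linarith

lemma abs_le_norm_prod: "1 + \<bar>\<tau>\<bar> \<le> 1 + norm (\<tau> :: real, y)" "1 + norm y \<le> 1 + norm (\<tau> :: real, y)"
  using norm_fst_le[of \<tau> y] norm_snd_le[of y \<tau>] by simp_all

lemma wt_le_norm_prod: "wt \<xi> \<le> 1 + norm (\<tau> :: real, - zvec \<xi>)"
  using abs_le_norm_prod(2)[of "- zvec \<xi>" \<tau>] by (simp add: wt_def)

lemma norm_zvec_ge_1:
  assumes "\<xi> \<noteq> 0"
  shows "1 \<le> norm (zvec \<xi>)"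
proof -
  obtain i where i: "\<xi> $ i \<noteq> 0" using assms by (auto simp: vec_eq_iff)
  then have "1 \<le> \<bar>real_of_int (\<xi> $ i)\<bar>" by linarith
  also have "\<dots> \<le> norm (zvec \<xi>)" using component_le_norm_cart[of "zvec \<xi>" i] by (simp add: zvec_def)
  finally show ?thesis .
qed

lemma powr_norm_zvec_le:
  assumes "1 \<le> norm (zvec \<xi>)"
  shows "norm (zvec \<xi>) powr \<nu> \<le> wt \<xi> ^ nat \<lceil>\<nu>\<rceil>"
proof -
  have "norm (zvec \<xi>) powr \<nu> \<le> norm (zvec \<xi>) powr real (nat \<lceil>\<nu>\<rceil>)"
    using assms by (intro powr_mono real_nat_ceiling_ge)
  also have "\<dots> = norm (zvec \<xi>) ^ nat \<lceil>\<nu>\<rceil>"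
    using assms by (intro powr_realpow) linarith
  also have "\<dots> \<le> wt \<xi> ^ nat \<lceil>\<nu>\<rceil>" by (intro power_mono) (simp_all add: wt_def)
  finally show ?thesis .
qed

text \<open>A symbol is controlled only away from 0, so its value there is added to the constant; a
  negative order is rounded up to 0.\<close>

lemma pdo_symbol_wt:
  fixes a :: "int ^ 'n::finite \<Rightarrow> complex"
  assumes "pdo_symbol a"
  obtains C M where "0 \<le> C" "\<And>\<xi>. cmod (a \<xi>) \<le> C * wt \<xi> ^ M"
proof -
  obtain C \<nu> where C: "C > 0" "\<And>\<xi>. \<xi> \<noteq> 0 \<Longrightarrow> cmod (a \<xi>) \<le> C * norm (zvec \<xi>) powr \<nu>"
    using assms unfolding pdo_symbol_def by blast
  let ?M = "nat \<lceil>\<nu>\<rceil>"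
  have W: "1 \<le> wt \<xi> ^ ?M" for \<xi> :: "int ^ 'n" using wt_ge_1 by (intro one_le_power)
  have "cmod (a \<xi>) \<le> (C + cmod (a 0)) * wt \<xi> ^ ?M" for \<xi>
  proof (cases "\<xi> = 0")
    case True
    have "cmod (a 0) * 1 \<le> (C + cmod (a 0)) * wt \<xi> ^ ?M"
      using C(1) W by (intro mult_mono) auto
    then show ?thesis using True by simp
  next
    case False
    have "cmod (a \<xi>) \<le> C * wt \<xi> ^ ?M"
      using C(2)[OF False] mult_left_mono[OF powr_norm_zvec_le[OF norm_zvec_ge_1[OF False]], of C \<nu>] C(1) by linarith
    also have "\<dots> \<le> (C + cmod (a 0)) * wt \<xi> ^ ?M"
      using W[of \<xi>] by (intro mult_right_mono) auto
    finally show ?thesis .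
  qed
  then show thesis using that[of "C + cmod (a 0)" ?M] C(1) by simp
qed

section \<open>Derivatives of smooth functions on the circle\<close>

lemma torus_smooth_has_vector_derivative:
  fixes f :: "real \<Rightarrow> complex"
  assumes "torus_smooth f"
  shows "(f has_vector_derivative vector_derivative f (at t)) (at t)"
  using torus_smooth_differentiable[OF assms] vector_derivative_works by blast

lemma frechet_eq_vector_derivative:
  fixes f :: "real \<Rightarrow> complex"
  assumes "torus_smooth f"
  shows "frechet_derivative f (at t) v = v *\<^sub>R vector_derivative f (at t)"
  using frechet_derivative_at[OF torus_smooth_has_vector_derivative[OF assms, unfolded has_vector_derivative_def], symmetric]
  by simp

lemma torus_smooth_vector_derivative:
  fixes f :: "real \<Rightarrow> complex"
  assumes "torus_smooth f"
  shows "torus_smooth (\<lambda>t. vector_derivative f (at t))"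
  using torus_smooth_frechet[OF assms, of 1] by (simp add: frechet_eq_vector_derivative[OF assms])

lemma torus_smooth_D_t: "torus_smooth f \<Longrightarrow> torus_smooth (D_t f)"
  unfolding D_t_def[abs_def] by (intro torus_smooth_cmult torus_smooth_vector_derivative)

lemma t_deriv_0: "t_deriv 0 f = f"
  by (simp add: t_deriv_def)

lemma t_deriv_Suc: "t_deriv (Suc \<alpha>) f = t_deriv \<alpha> (\<lambda>t. vector_derivative f (at t))"
  by (simp only: t_deriv_def funpow_Suc_right o_apply)

lemma t_deriv_Suc': "t_deriv (Suc \<alpha>) f = (\<lambda>t. vector_derivative (t_deriv \<alpha> f) (at t))"
  by (simp add: t_deriv_def)

lemma torus_smooth_t_deriv: "torus_smooth f \<Longrightarrow> torus_smooth (t_deriv \<alpha> f)"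
  for f :: "real \<Rightarrow> complex"
  by (induction \<alpha>) (simp_all add: t_deriv_0 t_deriv_Suc' torus_smooth_vector_derivative)

lemma iter_partial_real:
  fixes f :: "real \<Rightarrow> complex"
  assumes f: "torus_smooth f" and bs: "set bs \<subseteq> Basis"
  shows "iter_partial bs f = t_deriv (length bs) f"
  using bs
proof (induction bs)
  case (Cons b bs)
  then show ?case
    using frechet_eq_vector_derivative[OF torus_smooth_t_deriv[OF f]] by (simp add: t_deriv_Suc')
qed (simp add: t_deriv_0)

lemma torus_smooth_real_periodic: "torus_smooth f \<Longrightarrow> f (t + 2 * pi) = f t"
  for f :: "real \<Rightarrow> complex"
  using torus_smooth_periodic[of f 1 t] by simp

definition mode :: "(real \<Rightarrow> complex) \<Rightarrow> int ^ 'n::finite \<Rightarrow> real \<times> (real ^ 'n) \<Rightarrow> complex" where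
  "mode \<psi> \<xi> = (\<lambda>(t, x). \<psi> t * cis (- (x \<bullet> zvec \<xi>)))"

lemma partial_fourier_mode: "partial_fourier u \<xi> \<psi> = u (mode \<psi> \<xi>) / (2 * of_real pi) ^ CARD('n)"
  for u :: "'n::finite distr"
  by (simp add: partial_fourier_def mode_def)

lemma torus_smooth_fst:
  assumes "torus_smooth \<psi>"
  shows "torus_smooth (\<lambda>p::real \<times> (real ^ 'n::finite). \<psi> (fst p))"
  unfolding torus_smooth_def
proof (intro conjI allI ballI)
  show "C_diff k (\<lambda>p::real \<times> (real ^ 'n). \<psi> (fst p))" for k
    using assms by (intro C_diff_compose_linear[OF bounded_linear_fst]) (simp add: torus_smooth_def)
  fix p b :: "real \<times> (real ^ 'n)" assume "b \<in> Basis"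
  then have "fst b = 0 \<or> fst b = 1" by (auto simp: Basis_prod_def)
  then show "\<psi> (fst (p + (2 * pi) *\<^sub>R b)) = \<psi> (fst p)"
    using torus_smooth_real_periodic[OF assms, of "fst p"] by auto
qed

lemma mode_lattice: "\<tau> \<in> \<int> \<Longrightarrow> (\<tau>::real, - zvec \<xi>) \<in> torus_lattice"
  by (simp add: torus_lattice_prod torus_lattice_real torus_lattice_uminus zvec_in_lattice)

lemma mode_char: "mode (torus_char \<tau>) \<xi> = torus_char (\<tau>, - zvec \<xi>)"
  by (rule ext) (auto simp: mode_def torus_char_prod torus_char_def cis_mult)

lemma partial_fourier_char:
  "partial_fourier u \<xi> (torus_char \<tau>) = u (torus_char (\<tau>, - zvec \<xi>)) / (2 * of_real pi) ^ CARD('n)"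
  for u :: "'n::finite distr"
  by (simp add: partial_fourier_mode mode_char)

text \<open>The coefficients, on the product torus, of a function of \<open>t\<close> times one
  character in \<open>x\<close>. The frequency is \<open>- zvec \<xi>\<close> because partial
  Fourier coefficients test against the conjugate character.\<close>

definition lift_coef :: "int ^ 'n::finite \<Rightarrow> (real \<Rightarrow> complex) \<Rightarrow> real \<times> (real ^ 'n) \<Rightarrow> complex" where
  "lift_coef \<xi> a = (\<lambda>(\<tau>, y). if y = - zvec \<xi> then a \<tau> else 0)"

lemma has_sum_lift_coef:
  fixes \<xi> :: "int ^ 'n::finite"
  shows "((\<lambda>z. lift_coef \<xi> a z * g z) has_sum s) torus_lattice \<longleftrightarrow>
    ((\<lambda>\<tau>. a \<tau> * g (\<tau>, - zvec \<xi>)) has_sum s) torus_lattice"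
proof -
  let ?i = "\<lambda>\<tau>::real. (\<tau>, - zvec \<xi>)"
  have "((\<lambda>z. lift_coef \<xi> a z * g z) has_sum s) torus_lattice \<longleftrightarrow>
    ((\<lambda>z. lift_coef \<xi> a z * g z) has_sum s) (?i ` torus_lattice)"
    by (rule has_sum_cong_neutral)
      (auto simp: lift_coef_def torus_lattice_prod torus_lattice_uminus zvec_in_lattice)
  also have "\<dots> \<longleftrightarrow> ((\<lambda>\<tau>. a \<tau> * g (\<tau>, - zvec \<xi>)) has_sum s) torus_lattice"
    by (subst has_sum_reindex) (auto simp: inj_on_def lift_coef_def o_def)
  finally show ?thesis .
qed

lemma rapid_lift_coef:
  assumes a: "rapid a"
  shows "rapid (lift_coef \<xi> a)"
  unfolding rapid_def
proof
  fix N
  obtain C where C: "\<And>\<tau>. \<tau> \<in> torus_lattice \<Longrightarrow> cmod (a \<tau>) * (1 + norm \<tau>) ^ N \<le> C"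
    using a unfolding rapid_def by blast
  have C0: "0 \<le> C" by (rule order_trans[OF _ C[OF torus_lattice_zero]]) simp
  have "cmod (lift_coef \<xi> a z) * (1 + norm z) ^ N \<le> C * wt \<xi> ^ N" if z: "z \<in> torus_lattice" for z
  proof (cases "snd z = - zvec \<xi>")
    case True
    obtain \<tau> where \<tau>: "z = (\<tau>, - zvec \<xi>)" using True by (cases z) auto
    have "cmod (a \<tau>) * (1 + norm z) ^ N \<le> cmod (a \<tau>) * ((1 + \<bar>\<tau>\<bar>) * wt \<xi>) ^ N"
      unfolding \<tau> by (intro mult_left_mono power_mono norm_prod_le_wt) simp_all
    also have "\<dots> = cmod (a \<tau>) * (1 + norm \<tau>) ^ N * wt \<xi> ^ N" by (simp add: power_mult_distrib)
    also have "\<dots> \<le> C * wt \<xi> ^ N"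
      using z \<tau> wt_pos[of \<xi>] by (intro mult_right_mono C) (simp_all add: torus_lattice_prod)
    finally show ?thesis by (simp add: \<tau> lift_coef_def)
  next
    case False
    then have "lift_coef \<xi> a z = 0" by (simp add: lift_coef_def split_beta)
    then show ?thesis using C0 wt_pos[of \<xi>] by simp
  qed
  then show "\<exists>C. \<forall>z\<in>torus_lattice. cmod (lift_coef \<xi> a z) * (1 + norm z) ^ N \<le> C" by blast
qed

lemma mode_fseries:
  assumes a: "rapid a"
  shows "mode (fseries a) \<xi> = fseries (lift_coef \<xi> a)"
proof
  fix p :: "real \<times> (real ^ 'a)"
  obtain t x where p: "p = (t, x)" by (cases p)
  have "((\<lambda>\<tau>. a \<tau> * torus_char \<tau> t * torus_char (- zvec \<xi>) x) has_sum fseries a t * torus_char (- zvec \<xi>) x) torus_lattice"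
    by (intro has_sum_cmult_left fseries_has_sum a)
  then have "((\<lambda>z. lift_coef \<xi> a z * torus_char z p) has_sum fseries a t * torus_char (- zvec \<xi>) x) torus_lattice"
    unfolding has_sum_lift_coef by (simp add: p torus_char_prod mult.assoc)
  from has_sum_unique[OF this fseries_has_sum[OF rapid_lift_coef[OF a]]]
  show "mode (fseries a) \<xi> p = fseries (lift_coef \<xi> a) p" by (simp add: mode_def p torus_char_def)
qed

lemma partial_fourier_has_sum:
  fixes u :: "'n::finite distr"
  assumes u: "torus_distribution u" and a: "rapid a"
  shows "((\<lambda>\<tau>. a \<tau> * partial_fourier u \<xi> (torus_char \<tau>)) has_sum partial_fourier u \<xi> (fseries a)) torus_lattice"
proof -
  let ?c = "(2 * of_real pi) ^ CARD('n) :: complex"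
  have "((\<lambda>\<tau>. a \<tau> * u (torus_char (\<tau>, - zvec \<xi>))) has_sum u (mode (fseries a) \<xi>)) torus_lattice"
    unfolding mode_fseries[OF a] using torus_distribution_fseries[OF u rapid_lift_coef[OF a, of \<xi>]]
    by (subst (asm) has_sum_lift_coef)
  from has_sum_cmult_left[OF this, of "1 / ?c"] show ?thesis
    unfolding partial_fourier_char by (simp add: partial_fourier_mode)
qed

lemma torus_distribution_char_bound_prod:
  fixes u :: "'n::finite distr"
  assumes u: "torus_distribution u"
  obtains C N where "0 \<le> C"
    "\<And>\<tau> \<xi>. \<tau> \<in> \<int> \<Longrightarrow> cmod (u (torus_char (\<tau>, - zvec \<xi>))) \<le> C * (1 + \<bar>\<tau>\<bar>) ^ N * wt \<xi> ^ N"
proof -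
  obtain C N where C: "0 \<le> C" "\<And>z. z \<in> torus_lattice \<Longrightarrow> cmod (u (torus_char z)) \<le> C * (1 + norm z) ^ N"
    by (rule torus_distribution_char_bound[OF u]) blast
  have "cmod (u (torus_char (\<tau>, - zvec \<xi>))) \<le> C * (1 + \<bar>\<tau>\<bar>) ^ N * wt \<xi> ^ N" if "\<tau> \<in> \<int>" for \<tau> \<xi>
  proof -
    have "cmod (u (torus_char (\<tau>, - zvec \<xi>))) \<le> C * (1 + norm (\<tau>, - zvec \<xi>)) ^ N"
      by (rule C(2)[OF mode_lattice[OF that]])
    also have "\<dots> \<le> C * ((1 + \<bar>\<tau>\<bar>) * wt \<xi>) ^ N"
      by (intro mult_left_mono power_mono norm_prod_le_wt C(1)) simp
    finally show ?thesis by (simp add: power_mult_distrib mult.assoc)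
  qed
  with C(1) show thesis by (rule that)
qed

text \<open>Its values on characters grow polynomially in the frequency and so define a
  distribution. Both are given by the same series on every test function, and continuity is
  inherited along this agreement.\<close>

lemma torus_distribution_partial_fourier:
  fixes u :: "'n::finite distr"
  assumes u: "torus_distribution u"
  shows "torus_distribution (partial_fourier u \<xi>)"
proof -
  obtain C N where C: "0 \<le> C"
    "\<And>\<tau> \<xi>. \<tau> \<in> \<int> \<Longrightarrow> cmod (u (torus_char (\<tau>, - zvec \<xi>))) \<le> C * (1 + \<bar>\<tau>\<bar>) ^ N * wt \<xi> ^ N"
    by (rule torus_distribution_char_bound_prod[OF u]) blast
  let ?c = "(2 * pi) ^ CARD('n)"
  have b: "cmod (partial_fourier u \<xi> (torus_char \<tau>)) \<le> (C * wt \<xi> ^ N / ?c) * (1 + norm \<tau>) ^ N"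
    if "\<tau> \<in> torus_lattice" for \<tau>
    using C(2)[of \<tau> \<xi>] that
    by (simp add: partial_fourier_char torus_lattice_real norm_divide norm_mult norm_power divide_right_mono ac_simps)
  show ?thesis
  proof (rule torus_distribution_cong[OF torus_distribution_coef[of "\<lambda>\<tau>. partial_fourier u \<xi> (torus_char \<tau>)", OF b]])
    fix \<psi> :: "real \<Rightarrow> complex" assume \<psi>: "torus_smooth \<psi>"
    have "((\<lambda>\<tau>. fcoef \<psi> \<tau> * partial_fourier u \<xi> (torus_char \<tau>)) has_sum partial_fourier u \<xi> \<psi>) torus_lattice"
      using partial_fourier_has_sum[OF u rapid_fcoef[OF \<psi>]] by (simp add: fourier_inversion[OF \<psi>])
    from has_sum_unique[OF this coef_distribution_has_sum[of "\<lambda>\<tau>. partial_fourier u \<xi> (torus_char \<tau>)", OF b \<psi>]]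
    show "partial_fourier u \<xi> \<psi> = coef_distribution (\<lambda>\<tau>. partial_fourier u \<xi> (torus_char \<tau>)) \<psi>" .
  qed
qed

subsection \<open>Operators on distributions\<close>

lemma torus_distribution_scale:
  fixes u :: "('a::euclidean_space \<Rightarrow> complex) \<Rightarrow> complex"
  assumes u: "torus_distribution u"
  shows "torus_distribution (\<lambda>\<phi>. c * u \<phi>)"
proof -
  obtain C N where CN: "0 \<le> C" "\<And>\<phi>. torus_smooth \<phi> \<Longrightarrow> cmod (u \<phi>) \<le> C * test_seminorm N \<phi>"
    by (rule torus_distribution_bound[OF u]) blast
  show ?thesis
    unfolding torus_distribution_def
  proof (intro conjI allI impI exI)
    fix f g :: "'a \<Rightarrow> complex" and a b assume "torus_smooth f" "torus_smooth g"
    then show "c * u (\<lambda>x. a * f x + b * g x) = a * (c * u f) + b * (c * u g)"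
      by (simp add: torus_distribution_lincomb[OF u] algebra_simps)
  next
    fix f :: "'a \<Rightarrow> complex" assume "torus_smooth f"
    from mult_left_mono[OF CN(2)[OF this], of "cmod c"]
    show "cmod (c * u f) \<le> (cmod c * C) * test_seminorm N f" by (simp add: norm_mult mult.assoc)
  qed
qed

lemma torus_distribution_plus:
  fixes u v :: "('a::euclidean_space \<Rightarrow> complex) \<Rightarrow> complex"
  assumes u: "torus_distribution u" and v: "torus_distribution v"
  shows "torus_distribution (\<lambda>\<phi>. u \<phi> + v \<phi>)"
proof -
  obtain C N where CN: "0 \<le> C" "\<And>\<phi>. torus_smooth \<phi> \<Longrightarrow> cmod (u \<phi>) \<le> C * test_seminorm N \<phi>"
    by (rule torus_distribution_bound[OF u]) blast
  obtain D M where DM: "0 \<le> D" "\<And>\<phi>. torus_smooth \<phi> \<Longrightarrow> cmod (v \<phi>) \<le> D * test_seminorm M \<phi>"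
    by (rule torus_distribution_bound[OF v]) blast
  show ?thesis
    unfolding torus_distribution_def
  proof (intro conjI allI impI exI)
    fix f g :: "'a \<Rightarrow> complex" and a b assume "torus_smooth f" "torus_smooth g"
    then show "u (\<lambda>x. a * f x + b * g x) + v (\<lambda>x. a * f x + b * g x) = a * (u f + v f) + b * (u g + v g)"
      by (simp add: torus_distribution_lincomb[OF u] torus_distribution_lincomb[OF v] algebra_simps)
  next
    fix f :: "'a \<Rightarrow> complex" assume f: "torus_smooth f"
    have "cmod (u f + v f) \<le> C * test_seminorm N f + D * test_seminorm M f"
      by (rule norm_triangle_le[OF add_mono[OF CN(2)[OF f] DM(2)[OF f]]])
    also have "\<dots> \<le> C * test_seminorm (max N M) f + D * test_seminorm (max N M) f"
      by (intro add_mono mult_left_mono test_seminorm_mono f CN(1) DM(1)) simp_all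
    finally show "cmod (u f + v f) \<le> (C + D) * test_seminorm (max N M) f" by (simp add: distrib_right)
  qed
qed

lemma torus_distribution_zero: "torus_distribution (\<lambda>\<phi>. 0)"
  unfolding torus_distribution_def by (auto intro!: exI[of _ 0])

lemma torus_distribution_sum:
  "(\<And>k. k \<in> A \<Longrightarrow> torus_distribution (u k)) \<Longrightarrow> torus_distribution (\<lambda>\<phi>. \<Sum>k\<in>A. u k \<phi>)"
  by (induction A rule: infinite_finite_induct) (simp_all add: torus_distribution_zero torus_distribution_plus)

lemma torus_distribution_mult:
  fixes u :: "('a::euclidean_space \<Rightarrow> complex) \<Rightarrow> complex"
  assumes u: "torus_distribution u" and g: "torus_smooth g"
  shows "torus_distribution (\<lambda>\<phi>. u (\<lambda>x. g x * \<phi> x))"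
proof -
  obtain C N where CN: "0 \<le> C" "\<And>\<phi>. torus_smooth \<phi> \<Longrightarrow> cmod (u \<phi>) \<le> C * test_seminorm N \<phi>"
    by (rule torus_distribution_bound[OF u]) blast
  obtain D where D: "0 \<le> D" "\<And>f. torus_smooth f \<Longrightarrow> test_seminorm N (\<lambda>x. g x * f x) \<le> D * test_seminorm N f"
    by (rule test_seminorm_mult[OF g]) blast
  show ?thesis
    unfolding torus_distribution_def
  proof (intro conjI allI impI exI)
    fix f h :: "'a \<Rightarrow> complex" and a b assume fh: "torus_smooth f" "torus_smooth h"
    have "(\<lambda>x. g x * (a * f x + b * h x)) = (\<lambda>x. a * (g x * f x) + b * (g x * h x))"
      by (auto simp: algebra_simps)
    then show "u (\<lambda>x. g x * (a * f x + b * h x)) = a * u (\<lambda>x. g x * f x) + b * u (\<lambda>x. g x * h x)"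
      by (simp add: torus_distribution_lincomb[OF u] torus_smooth_mult g fh)
  next
    fix f :: "'a \<Rightarrow> complex" assume f: "torus_smooth f"
    have "cmod (u (\<lambda>x. g x * f x)) \<le> C * test_seminorm N (\<lambda>x. g x * f x)"
      by (rule CN(2)[OF torus_smooth_mult[OF g f]])
    also have "\<dots> \<le> C * (D * test_seminorm N f)" by (rule mult_left_mono[OF D(2)[OF f] CN(1)])
    finally show "cmod (u (\<lambda>x. g x * f x)) \<le> (C * D) * test_seminorm N f" by (simp add: mult.assoc)
  qed
qed

lemma torus_distribution_frechet:
  fixes u :: "('a::euclidean_space \<Rightarrow> complex) \<Rightarrow> complex"
  assumes u: "torus_distribution u" and b: "b \<in> Basis"
  shows "torus_distribution (\<lambda>\<phi>. u (\<lambda>x. frechet_derivative \<phi> (at x) b))"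
proof -
  obtain C N where CN: "0 \<le> C" "\<And>\<phi>. torus_smooth \<phi> \<Longrightarrow> cmod (u \<phi>) \<le> C * test_seminorm N \<phi>"
    by (rule torus_distribution_bound[OF u]) blast
  show ?thesis
    unfolding torus_distribution_def
  proof (intro conjI allI impI exI)
    fix f g :: "'a \<Rightarrow> complex" and a c assume fg: "torus_smooth f" "torus_smooth g"
    have "frechet_derivative (\<lambda>x. a * f x + c * g x) (at x) b =
        a * frechet_derivative f (at x) b + c * frechet_derivative g (at x) b" for x
    proof -
      have "((\<lambda>x. a * f x + c * g x) has_derivative
          (\<lambda>v. a * frechet_derivative f (at x) v + c * frechet_derivative g (at x) v)) (at x)"
        by (intro has_derivative_add has_derivative_mult_right torus_smooth_has_derivative fg)
      from frechet_derivative_at[OF this, symmetric] show ?thesis by simp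
    qed
    then show "u (\<lambda>x. frechet_derivative (\<lambda>x. a * f x + c * g x) (at x) b) =
        a * u (\<lambda>x. frechet_derivative f (at x) b) + c * u (\<lambda>x. frechet_derivative g (at x) b)"
      by (simp add: torus_distribution_lincomb[OF u] torus_smooth_frechet fg)
  next
    fix f :: "'a \<Rightarrow> complex" assume f: "torus_smooth f"
    show "cmod (u (\<lambda>x. frechet_derivative f (at x) b)) \<le> C * test_seminorm (Suc N) f"
      by (rule order_trans[OF CN(2)[OF torus_smooth_frechet[OF f]] mult_left_mono[OF test_seminorm_frechet[OF f b] CN(1)]])
  qed
qed

lemma frechet_slice:
  fixes \<phi> :: "real \<times> 'b::euclidean_space \<Rightarrow> complex"
  assumes "torus_smooth \<phi>"
  shows "D_t (\<lambda>s. \<phi> (s, x)) t = inverse \<i> * frechet_derivative \<phi> (at (t, x)) (1, 0)"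
proof -
  let ?F = "frechet_derivative \<phi> (at (t, x))"
  have "((\<lambda>s. \<phi> (s, x)) has_derivative (\<lambda>h. ?F (h, 0))) (at t)"
    by (rule has_derivative_compose[OF _ torus_smooth_has_derivative[OF assms], of "\<lambda>s. (s, x)"])
      (auto intro!: derivative_eq_intros)
  moreover have "?F (h, 0) = h *\<^sub>R ?F (1, 0)" for h
    using linear_cmul[OF has_derivative_linear[OF torus_smooth_has_derivative[OF assms]], of "(t, x)" h "(1, 0)"] by simp
  then have "(\<lambda>h. ?F (h, 0)) = (\<lambda>h. h *\<^sub>R ?F (1, 0))" by (rule ext)
  ultimately have "((\<lambda>s. \<phi> (s, x)) has_vector_derivative ?F (1, 0)) (at t)"
    unfolding has_vector_derivative_def by (simp only:)
  then show ?thesis unfolding D_t_def by (simp add: vector_derivative_at)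
qed

lemma torus_distribution_distr_Dt:
  fixes u :: "'n::finite distr"
  assumes u: "torus_distribution u"
  shows "torus_distribution (distr_Dt u)"
proof -
  have b: "(1, 0) \<in> (Basis :: (real \<times> (real ^ 'n)) set)" by (simp add: Basis_prod_def)
  show ?thesis
  proof (rule torus_distribution_cong[OF torus_distribution_scale[OF torus_distribution_frechet[OF u b], of "- inverse \<i>"]])
    fix \<phi> :: "real \<times> (real ^ 'n) \<Rightarrow> complex" assume \<phi>: "torus_smooth \<phi>"
    have "(\<lambda>(t, x). D_t (\<lambda>s. \<phi> (s, x)) t) = (\<lambda>p. inverse \<i> * frechet_derivative \<phi> (at p) (1, 0))"
      by (auto simp: frechet_slice[OF \<phi>])
    then show "distr_Dt u \<phi> = - inverse \<i> * u (\<lambda>x. frechet_derivative \<phi> (at x) (1, 0))"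
      unfolding distr_Dt_def by (simp only: torus_distribution_cmult[OF u torus_smooth_frechet[OF \<phi>]] mult_minus_left)
  qed
qed

lemma partial_fourier_Dt:
  fixes u :: "'n::finite distr"
  assumes \<psi>: "torus_smooth \<psi>"
  shows "partial_fourier (distr_Dt u) \<xi> \<psi> = - partial_fourier u \<xi> (D_t \<psi>)"
proof -
  have "D_t (\<lambda>s. mode \<psi> \<xi> (s, x)) t = D_t \<psi> t * cis (- (x \<bullet> zvec \<xi>))" for t x
  proof -
    have "((\<lambda>s. \<psi> s * cis (- (x \<bullet> zvec \<xi>))) has_vector_derivative
        vector_derivative \<psi> (at t) * cis (- (x \<bullet> zvec \<xi>))) (at t)"
      by (intro has_vector_derivative_mult_left torus_smooth_has_vector_derivative \<psi>)
    then show ?thesis by (simp add: D_t_def mode_def vector_derivative_at)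
  qed
  then have "(\<lambda>(t, x). D_t (\<lambda>s. mode \<psi> \<xi> (s, x)) t) = mode (D_t \<psi>) \<xi>"
    by (auto simp: mode_def)
  then show ?thesis by (simp add: partial_fourier_mode distr_Dt_def)
qed

lemma torus_distribution_distr_mult:
  fixes u :: "'n::finite distr"
  assumes "torus_distribution u" "torus_smooth c"
  shows "torus_distribution (distr_mult c u)"
proof -
  have "distr_mult c u \<phi> = u (\<lambda>p. c (fst p) * \<phi> p)" for \<phi>
    unfolding distr_mult_def by (rule arg_cong[where f = u]) auto
  then show ?thesis
    using torus_distribution_mult[OF assms(1) torus_smooth_fst[OF assms(2)]] by presburger
qed

lemma partial_fourier_mult:
  fixes u :: "'n::finite distr"
  shows "partial_fourier (distr_mult c u) \<xi> \<psi> = partial_fourier u \<xi> (\<lambda>t. c t * \<psi> t)"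
proof -
  have "(\<lambda>(t, x). c t * mode \<psi> \<xi> (t, x)) = mode (\<lambda>t. c t * \<psi> t) \<xi>" by (auto simp: mode_def)
  then show ?thesis by (simp add: partial_fourier_mode distr_mult_def)
qed

lemma rapid_slice:
  fixes a :: "real \<times> (real ^ 'n::finite) \<Rightarrow> complex"
  assumes a: "rapid a"
  shows "rapid (\<lambda>\<tau>. c * a (\<tau>, - zvec \<xi>))"
  unfolding rapid_def
proof
  fix N
  obtain C where C: "\<And>z. z \<in> torus_lattice \<Longrightarrow> cmod (a z) * (1 + norm z) ^ N \<le> C"
    using a unfolding rapid_def by blast
  have "cmod (c * a (\<tau>, - zvec \<xi>)) * (1 + norm \<tau>) ^ N \<le> cmod c * C" if "\<tau> \<in> torus_lattice" for \<tau>
  proof -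
    have "cmod (a (\<tau>, - zvec \<xi>)) * (1 + norm \<tau>) ^ N \<le> cmod (a (\<tau>, - zvec \<xi>)) * (1 + norm (\<tau>, - zvec \<xi>)) ^ N"
      using abs_le_norm_prod(1)[of \<tau> "- zvec \<xi>"] by (intro mult_left_mono power_mono) simp_all
    also have "\<dots> \<le> C" using that by (intro C mode_lattice) (simp add: torus_lattice_real)
    finally show ?thesis by (simp add: norm_mult mult.assoc mult_left_mono)
  qed
  then show "\<exists>C. \<forall>\<tau>\<in>torus_lattice. cmod (c * a (\<tau>, - zvec \<xi>)) * (1 + norm \<tau>) ^ N \<le> C" by blast
qed

text \<open>Integrating the Fourier series of \<open>\<phi>\<close> term by term in \<open>x\<close>
  leaves only the frequencies \<open>(\<tau>, - zvec \<xi>)\<close>. The slice is therefore a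
  Fourier series in \<open>t\<close>, on which \<open>partial_fourier\<close> can be evaluated
  termwise.\<close>

lemma integral_slice:
  fixes \<phi> :: "real \<times> (real ^ 'n::finite) \<Rightarrow> complex"
  assumes \<phi>: "torus_smooth \<phi>"
  shows "(\<lambda>t. integral torus_cell (\<lambda>x. cis (x \<bullet> zvec \<xi>) * \<phi> (t, x))) =
    fseries (\<lambda>\<tau>. (2 * of_real pi) ^ CARD('n) * fcoef \<phi> (\<tau>, - zvec \<xi>))"
proof
  fix t
  let ?c = "(2 * of_real pi) ^ CARD('n) :: complex"
  let ?I = "integral torus_cell (\<lambda>x. cis (x \<bullet> zvec \<xi>) * \<phi> (t, x))"
  note r = rapid_fcoef[OF \<phi>]
  have "((\<lambda>z. fcoef \<phi> z * integral torus_cell (\<lambda>x. torus_char z (t, x) * torus_char (zvec \<xi>) x)) has_sum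
      integral torus_cell (\<lambda>x. fseries (fcoef \<phi>) (t, x) * torus_char (zvec \<xi>) x)) torus_lattice"
    by (rule fseries_integral_has_sum[OF r]) (auto simp: torus_char_def intro!: continuous_intros)
  also have "(\<lambda>x. fseries (fcoef \<phi>) (t, x) * torus_char (zvec \<xi>) x) = (\<lambda>x. cis (x \<bullet> zvec \<xi>) * \<phi> (t, x))"
    by (simp add: fourier_inversion[OF \<phi>] torus_char_def mult.commute)
  finally have 1: "((\<lambda>z. fcoef \<phi> z * integral torus_cell (\<lambda>x. torus_char z (t, x) * torus_char (zvec \<xi>) x)) has_sum ?I) torus_lattice" .
  have 2: "fcoef \<phi> z * integral torus_cell (\<lambda>x. torus_char z (t, x) * torus_char (zvec \<xi>) x) =
      lift_coef \<xi> (\<lambda>\<tau>. ?c * fcoef \<phi> (\<tau>, - zvec \<xi>)) z * torus_char (fst z) t"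
    if z: "z \<in> torus_lattice" for z
  proof -
    obtain \<tau> y where \<tau>: "z = (\<tau>, y)" by (cases z)
    have y: "y + zvec \<xi> \<in> torus_lattice"
      using torus_lattice_diff[of y "- zvec \<xi>"] z \<tau> by (simp add: torus_lattice_prod torus_lattice_uminus zvec_in_lattice)
    have "integral torus_cell (\<lambda>x. torus_char z (t, x) * torus_char (zvec \<xi>) x) =
        integral torus_cell (\<lambda>x. torus_char \<tau> t * torus_char (y + zvec \<xi>) x)"
      by (simp add: \<tau> torus_char_prod torus_char_add mult.assoc)
    also have "\<dots> = torus_char \<tau> t * (if y + zvec \<xi> = 0 then ?c else 0)"
      by (simp add: integral_torus_char[OF y])
    finally show ?thesis
      unfolding eq_neg_iff_add_eq_0[of y "zvec \<xi>", symmetric]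
      by (cases "y = - zvec \<xi>") (simp_all add: \<tau> lift_coef_def)
  qed
  have "((\<lambda>z. lift_coef \<xi> (\<lambda>\<tau>. ?c * fcoef \<phi> (\<tau>, - zvec \<xi>)) z * torus_char (fst z) t) has_sum ?I) torus_lattice"
    using 1 by (simp add: 2 cong: has_sum_cong)
  then have "((\<lambda>\<tau>. ?c * fcoef \<phi> (\<tau>, - zvec \<xi>) * torus_char \<tau> t) has_sum ?I) torus_lattice"
    by (subst (asm) has_sum_lift_coef) simp
  from has_sum_unique[OF this fseries_has_sum[OF rapid_slice[OF r]]]
  show "?I = fseries (\<lambda>\<tau>. ?c * fcoef \<phi> (\<tau>, - zvec \<xi>)) t" .
qed

definition zvec_inv :: "real ^ 'n \<Rightarrow> int ^ 'n" where
  "zvec_inv y = (\<chi> i. \<lfloor>y $ i\<rfloor>)"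

lemma zvec_inv_zvec [simp]: "zvec_inv (zvec \<xi>) = \<xi>"
  by (simp add: zvec_inv_def zvec_def vec_eq_iff)

text \<open>The operator is diagonal on characters: frequency \<open>(\<tau>, y)\<close> is
  multiplied by the symbol at \<open>- y\<close>. The sums over \<open>\<tau>\<close> and then over
  \<open>\<xi>\<close> regroup one unconditionally convergent sum over the product lattice, so the
  infinite sum in \<open>distr_pdo\<close> does converge to the intended value.\<close>

lemma distr_pdo_coef:
  fixes u :: "'n::finite distr"
  assumes u: "torus_distribution u" and a: "pdo_symbol a"
  defines "B \<equiv> \<lambda>z. a (zvec_inv (- snd z)) * u (torus_char z)"
  obtains C N where "\<And>z. z \<in> torus_lattice \<Longrightarrow> cmod (B z) \<le> C * (1 + norm z) ^ N"
    "\<And>\<phi>. torus_smooth \<phi> \<Longrightarrow> distr_pdo a u \<phi> = coef_distribution B \<phi>"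
proof -
  obtain C N where C: "0 \<le> C" "\<And>z. z \<in> torus_lattice \<Longrightarrow> cmod (u (torus_char z)) \<le> C * (1 + norm z) ^ N"
    by (rule torus_distribution_char_bound[OF u]) blast
  obtain D M where D: "0 \<le> D" "\<And>\<xi>. cmod (a \<xi>) \<le> D * wt \<xi> ^ M"
    by (rule pdo_symbol_wt[OF a]) blast
  have bound: "cmod (B z) \<le> (D * C) * (1 + norm z) ^ (M + N)" if z: "z \<in> torus_lattice" for z
  proof -
    obtain \<tau> y where \<tau>: "z = (\<tau>, y)" by (cases z)
    have "- y \<in> torus_lattice" using z \<tau> by (simp add: torus_lattice_prod torus_lattice_uminus)
    then obtain \<xi> where \<xi>: "y = - zvec \<xi>" unfolding torus_lattice_vec by (metis imageE minus_minus)
    have "cmod (B z) = cmod (a \<xi>) * cmod (u (torus_char z))" by (simp add: B_def \<tau> \<xi> norm_mult)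
    also have "\<dots> \<le> (D * (1 + norm z) ^ M) * (C * (1 + norm z) ^ N)"
    proof (rule mult_mono[OF _ C(2)[OF z]])
      have "wt \<xi> ^ M \<le> (1 + norm z) ^ M"
        unfolding \<tau> \<xi> by (rule power_mono[OF wt_le_norm_prod]) (rule less_imp_le[OF wt_pos])
      from mult_left_mono[OF this D(1)] show "cmod (a \<xi>) \<le> D * (1 + norm z) ^ M" using D(2)[of \<xi>] by linarith
    qed (use D(1) in simp_all)
    finally show ?thesis by (simp add: power_add ac_simps)
  qed
  have "distr_pdo a u \<phi> = coef_distribution B \<phi>" if \<phi>: "torus_smooth \<phi>" for \<phi>
  proof -
    let ?c = "(2 * of_real pi) ^ CARD('n) :: complex"
    let ?i = "\<lambda>(\<xi>, \<tau>). (\<tau>::real, - zvec (\<xi> :: int ^ 'n))"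
    have "bij_betw ?i (UNIV \<times> torus_lattice) torus_lattice"
    proof (rule bij_betwI')
      fix p q :: "(int ^ 'n) \<times> real"
      show "(?i p = ?i q) = (p = q)" by (cases p, cases q) (auto simp: inj_eq[OF inj_zvec])
      show "p \<in> UNIV \<times> torus_lattice \<Longrightarrow> ?i p \<in> torus_lattice"
        by (auto simp: torus_lattice_prod torus_lattice_uminus zvec_in_lattice)
    next
      fix z :: "real \<times> (real ^ 'n)" assume z: "z \<in> torus_lattice"
      obtain \<tau> y where \<tau>: "z = (\<tau>, y)" by (cases z)
      have "- y \<in> torus_lattice" using z \<tau> by (simp add: torus_lattice_prod torus_lattice_uminus)
      then obtain \<xi> where \<xi>: "y = - zvec \<xi>" unfolding torus_lattice_vec by (metis imageE minus_minus)
      show "\<exists>p\<in>UNIV \<times> torus_lattice. z = ?i p"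
        using z by (intro bexI[of _ "(\<xi>, \<tau>)"]) (simp_all add: \<tau> \<xi> torus_lattice_prod)
    qed
    from has_sum_reindex_bij_betw[OF this, of "\<lambda>z. fcoef \<phi> z * B z"]
      coef_distribution_has_sum[OF bound \<phi>]
    have hs: "((\<lambda>p. fcoef \<phi> (?i p) * B (?i p)) has_sum coef_distribution B \<phi>) (SIGMA \<xi>:UNIV. torus_lattice)"
      by simp
    have row: "((\<lambda>\<tau>. fcoef \<phi> (?i (\<xi>, \<tau>)) * B (?i (\<xi>, \<tau>))) has_sum
        a \<xi> * partial_fourier u \<xi> (\<lambda>t. integral torus_cell (\<lambda>x. cis (x \<bullet> zvec \<xi>) * \<phi> (t, x)))) torus_lattice" for \<xi>
      using has_sum_cmult_right[OF partial_fourier_has_sum[OF u rapid_slice[OF rapid_fcoef[OF \<phi>], of ?c \<xi>], of \<xi>], of "a \<xi>"]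
      unfolding integral_slice[OF \<phi>] by (simp add: B_def partial_fourier_char ac_simps)
    have "((\<lambda>\<xi>. a \<xi> * partial_fourier u \<xi> (\<lambda>t. integral torus_cell (\<lambda>x. cis (x \<bullet> zvec \<xi>) * \<phi> (t, x))))
        has_sum coef_distribution B \<phi>) UNIV"
      by (rule has_sum_SigmaD[OF hs row])
    then show ?thesis unfolding distr_pdo_def by (rule infsumI)
  qed
  with bound show thesis by (rule that)
qed

lemma torus_distribution_distr_pdo:
  fixes u :: "'n::finite distr"
  assumes "torus_distribution u" "pdo_symbol a"
  shows "torus_distribution (distr_pdo a u)"
proof -
  let ?B = "\<lambda>z. a (zvec_inv (- snd z)) * u (torus_char z)"
  obtain C N where CN: "\<And>z. z \<in> torus_lattice \<Longrightarrow> cmod (?B z) \<le> C * (1 + norm z) ^ N"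
    "\<And>\<phi>. torus_smooth \<phi> \<Longrightarrow> distr_pdo a u \<phi> = coef_distribution ?B \<phi>"
    by (rule distr_pdo_coef[OF assms]) blast
  show ?thesis by (rule torus_distribution_cong[OF torus_distribution_coef[of ?B, OF CN(1)] CN(2)])
qed

lemma partial_fourier_pdo:
  fixes u :: "'n::finite distr"
  assumes u: "torus_distribution u" and a: "pdo_symbol a" and \<psi>: "torus_smooth \<psi>"
  shows "partial_fourier (distr_pdo a u) \<xi> \<psi> = a \<xi> * partial_fourier u \<xi> \<psi>"
proof (rule torus_distribution_eqI[OF _ _ _ \<psi>])
  show "torus_distribution (partial_fourier (distr_pdo a u) \<xi>)"
    by (intro torus_distribution_partial_fourier torus_distribution_distr_pdo u a)
  show "torus_distribution (\<lambda>\<psi>. a \<xi> * partial_fourier u \<xi> \<psi>)"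
    by (intro torus_distribution_scale torus_distribution_partial_fourier u)
  fix \<tau> :: real assume "\<tau> \<in> torus_lattice"
  then have L: "(\<tau>, - zvec \<xi>) \<in> torus_lattice" by (intro mode_lattice) (simp add: torus_lattice_real)
  have "distr_pdo a u (torus_char (\<tau>, - zvec \<xi>)) = a \<xi> * u (torus_char (\<tau>, - zvec \<xi>))"
  proof -
    let ?B = "\<lambda>z. a (zvec_inv (- snd z)) * u (torus_char z)"
    obtain C N where CN: "\<And>z. z \<in> torus_lattice \<Longrightarrow> cmod (?B z) \<le> C * (1 + norm z) ^ N"
      "\<And>\<phi>. torus_smooth \<phi> \<Longrightarrow> distr_pdo a u \<phi> = coef_distribution ?B \<phi>"
      by (rule distr_pdo_coef[OF u a]) blast
    show ?thesis
      unfolding CN(2)[OF torus_smooth_char[OF L]] using coef_distribution_char[of ?B, OF CN(1) L] by simp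
  qed
  then show "partial_fourier (distr_pdo a u) \<xi> (torus_char \<tau>) = a \<xi> * partial_fourier u \<xi> (torus_char \<tau>)"
    by (simp add: partial_fourier_char)
qed

lemma torus_distribution_system_op:
  assumes "\<And>k. torus_distribution (u k)" "\<And>j k. torus_smooth (c j k)" "\<And>j k. pdo_symbol (q j k)"
  shows "torus_distribution (system_op c q u j)"
  unfolding system_op_def[abs_def]
  by (intro torus_distribution_plus torus_distribution_sum torus_distribution_distr_Dt
      torus_distribution_distr_mult torus_distribution_distr_pdo assms)

text \<open>Transposing \<open>D_t\<close> produces the minus sign, and multiplication by
  \<open>c j k\<close> moves onto the test function. The partial coefficient is still a distribution
  in \<open>t\<close> here, so the equation holds only in this weak form.\<close>

lemma partial_fourier_system_op:
  assumes "\<And>k. torus_distribution (u k)" "\<And>j k. torus_smooth (c j k)" "\<And>j k. pdo_symbol (q j k)"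
    and \<psi>: "torus_smooth \<psi>"
  shows "partial_fourier (system_op c q u j) \<xi> \<psi> =
    - partial_fourier (u j) \<xi> (D_t \<psi>) + (\<Sum>k\<in>UNIV. q j k \<xi> * partial_fourier (u k) \<xi> (\<lambda>t. c j k t * \<psi> t))"
proof -
  have "partial_fourier (system_op c q u j) \<xi> \<psi> = partial_fourier (distr_Dt (u j)) \<xi> \<psi> +
      (\<Sum>k\<in>UNIV. partial_fourier (distr_mult (c j k) (distr_pdo (q j k) (u k))) \<xi> \<psi>)"
    by (simp add: partial_fourier_def system_op_def add_divide_distrib sum_divide_distrib)
  then show ?thesis
    by (simp add: partial_fourier_Dt[OF \<psi>] partial_fourier_mult partial_fourier_pdo assms torus_smooth_mult)
qed

subsection \<open>Families of functions indexed by frequency\<close>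

text \<open>Only an upper bound is imposed; sign conditions are added where products are
  formed.\<close>

definition poly_growth :: "(int ^ 'n::finite \<Rightarrow> real) set" where
  "poly_growth = {g. \<exists>C N. \<forall>\<xi>. g \<xi> \<le> C * wt \<xi> ^ N}"

definition rapid_decay :: "(int ^ 'n::finite \<Rightarrow> real) set" where
  "rapid_decay = {g. \<forall>N. \<exists>C. \<forall>\<xi>. g \<xi> * wt \<xi> ^ N \<le> C}"

text \<open>The last clause absorbs bounds that are only known for large \<open>\<xi>\<close>.\<close>

definition growth_ideal :: "(int ^ 'n::finite \<Rightarrow> real) set \<Rightarrow> bool" where
  "growth_ideal I \<longleftrightarrow> (\<lambda>\<xi>. 0) \<in> I \<and>
     (\<forall>g\<in>I. \<forall>h\<in>I. (\<lambda>\<xi>. g \<xi> + h \<xi>) \<in> I) \<and>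
     (\<forall>g\<in>I. \<forall>h\<in>poly_growth. (\<forall>\<xi>. 0 \<le> g \<xi>) \<longrightarrow> (\<forall>\<xi>. 0 \<le> h \<xi>) \<longrightarrow> (\<lambda>\<xi>. g \<xi> * h \<xi>) \<in> I) \<and>
     (\<forall>g\<in>I. \<forall>h. finite {\<xi>. g \<xi> < h \<xi>} \<longrightarrow> (\<forall>\<xi>. 0 \<le> g \<xi>) \<longrightarrow> h \<in> I)"

lemma poly_growthI: "(\<And>\<xi>. g \<xi> \<le> C * wt \<xi> ^ N) \<Longrightarrow> g \<in> poly_growth"
  unfolding poly_growth_def by blast

lemma poly_growthE:
  assumes "g \<in> poly_growth"
  obtains C N where "0 \<le> C" "\<And>\<xi>. g \<xi> \<le> C * wt \<xi> ^ N"
proof -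
  obtain C N where C: "\<And>\<xi>. g \<xi> \<le> C * wt \<xi> ^ N" using assms unfolding poly_growth_def by blast
  have "g \<xi> \<le> \<bar>C\<bar> * wt \<xi> ^ N" for \<xi>
    by (rule order_trans[OF C mult_right_mono]) (simp_all add: less_imp_le[OF wt_pos])
  then show thesis using that[of "\<bar>C\<bar>" N] by simp
qed

lemma wt_power_mono: "N \<le> M \<Longrightarrow> wt \<xi> ^ N \<le> wt \<xi> ^ M"
  by (rule power_increasing[OF _ wt_ge_1])

lemma wt_power_nonneg [simp]: "0 \<le> wt \<xi> ^ N"
  by (simp add: less_imp_le[OF wt_pos])

lemma growth_ideal_add:
  "growth_ideal I \<Longrightarrow> g \<in> I \<Longrightarrow> h \<in> I \<Longrightarrow> (\<lambda>\<xi>. g \<xi> + h \<xi>) \<in> I"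
  by (simp add: growth_ideal_def)

lemma growth_ideal_mult:
  "growth_ideal I \<Longrightarrow> g \<in> I \<Longrightarrow> h \<in> poly_growth \<Longrightarrow> (\<And>\<xi>. 0 \<le> g \<xi>) \<Longrightarrow> (\<And>\<xi>. 0 \<le> h \<xi>) \<Longrightarrow>
   (\<lambda>\<xi>. g \<xi> * h \<xi>) \<in> I"
  by (simp add: growth_ideal_def)

lemma growth_ideal_cofinite:
  "growth_ideal I \<Longrightarrow> g \<in> I \<Longrightarrow> (\<And>\<xi>. 0 \<le> g \<xi>) \<Longrightarrow> finite {\<xi>. g \<xi> < h \<xi>} \<Longrightarrow> h \<in> I"
  unfolding growth_ideal_def by blast

lemma finite_max_bound:
  fixes f :: "'a \<Rightarrow> real"
  assumes "finite A"
  obtains K where "0 \<le> K" "\<And>x. x \<in> A \<Longrightarrow> f x \<le> K"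
proof
  show "f x \<le> (\<Sum>x\<in>A. \<bar>f x\<bar>)" if "x \<in> A" for x
    using member_le_sum[of x A "\<lambda>x. \<bar>f x\<bar>"] assms that by auto
qed (simp add: sum_nonneg)

lemma growth_ideal_poly: "growth_ideal poly_growth"
  unfolding growth_ideal_def
proof (intro conjI ballI allI impI)
  show "(\<lambda>\<xi>. 0) \<in> poly_growth" by (rule poly_growthI[of _ 0 0]) simp
next
  fix g h :: "int ^ 'n \<Rightarrow> real" assume "g \<in> poly_growth" "h \<in> poly_growth"
  obtain C N where C: "0 \<le> C" "\<And>\<xi>. g \<xi> \<le> C * wt \<xi> ^ N"
    by (rule poly_growthE[OF \<open>g \<in> poly_growth\<close>]) blast
  obtain D M where D: "0 \<le> D" "\<And>\<xi>. h \<xi> \<le> D * wt \<xi> ^ M"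
    by (rule poly_growthE[OF \<open>h \<in> poly_growth\<close>]) blast
  show "(\<lambda>\<xi>. g \<xi> + h \<xi>) \<in> poly_growth"
  proof (rule poly_growthI)
    fix \<xi> :: "int ^ 'n"
    have "g \<xi> + h \<xi> \<le> C * wt \<xi> ^ N + D * wt \<xi> ^ M" by (intro add_mono C D)
    also have "\<dots> \<le> C * wt \<xi> ^ (N + M) + D * wt \<xi> ^ (N + M)"
      by (intro add_mono mult_left_mono wt_power_mono C D) simp_all
    finally show "g \<xi> + h \<xi> \<le> (C + D) * wt \<xi> ^ (N + M)" by (simp add: distrib_right)
  qed
next
  fix g h :: "int ^ 'n \<Rightarrow> real" assume g: "g \<in> poly_growth" and h: "h \<in> poly_growth"
    and pos: "\<forall>\<xi>. 0 \<le> g \<xi>" "\<forall>\<xi>. 0 \<le> h \<xi>"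
  obtain C N where C: "0 \<le> C" "\<And>\<xi>. g \<xi> \<le> C * wt \<xi> ^ N"
    by (rule poly_growthE[OF g]) blast
  obtain D M where D: "0 \<le> D" "\<And>\<xi>. h \<xi> \<le> D * wt \<xi> ^ M"
    by (rule poly_growthE[OF h]) blast
  show "(\<lambda>\<xi>. g \<xi> * h \<xi>) \<in> poly_growth"
  proof (rule poly_growthI)
    fix \<xi> :: "int ^ 'n"
    have "g \<xi> * h \<xi> \<le> (C * wt \<xi> ^ N) * (D * wt \<xi> ^ M)"
      by (intro mult_mono C D) (use pos C(1) in simp_all)
    then show "g \<xi> * h \<xi> \<le> (C * D) * wt \<xi> ^ (N + M)" by (simp add: power_add ac_simps)
  qed
next
  fix g h :: "int ^ 'n \<Rightarrow> real" assume g: "g \<in> poly_growth" and fin: "finite {\<xi>. g \<xi> < h \<xi>}"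
  obtain C N where C: "0 \<le> C" "\<And>\<xi>. g \<xi> \<le> C * wt \<xi> ^ N"
    by (rule poly_growthE[OF g]) blast
  obtain K where K: "0 \<le> K" "\<And>\<xi>. \<xi> \<in> {\<xi>. g \<xi> < h \<xi>} \<Longrightarrow> h \<xi> \<le> K" by (rule finite_max_bound[OF fin, of h]) blast
  show "h \<in> poly_growth"
  proof (rule poly_growthI)
    fix \<xi> :: "int ^ 'n"
    have W: "1 \<le> wt \<xi> ^ N" by (rule one_le_power[OF wt_ge_1])
    have "h \<xi> \<le> C * wt \<xi> ^ N + K * 1"
    proof (cases "g \<xi> < h \<xi>")
      case True
      then show ?thesis using K(2)[of \<xi>] mult_nonneg_nonneg[OF C(1), of "wt \<xi> ^ N"] W by simp
    qed (use C(2)[of \<xi>] K(1) in linarith)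
    also have "\<dots> \<le> C * wt \<xi> ^ N + K * wt \<xi> ^ N" by (intro add_left_mono mult_left_mono W K(1))
    finally show "h \<xi> \<le> (C + K) * wt \<xi> ^ N" by (simp add: distrib_right)
  qed
qed

lemma growth_ideal_rapid: "growth_ideal rapid_decay"
  unfolding growth_ideal_def
proof (intro conjI ballI allI impI)
  show "(\<lambda>\<xi>. 0) \<in> rapid_decay" unfolding rapid_decay_def by (auto intro!: exI[of _ 0])
next
  fix g h :: "int ^ 'n \<Rightarrow> real" assume g: "g \<in> rapid_decay" and h: "h \<in> rapid_decay"
  have "\<exists>C. \<forall>\<xi>. (g \<xi> + h \<xi>) * wt \<xi> ^ N \<le> C" for N
  proof -
    obtain C where C: "\<And>\<xi>. g \<xi> * wt \<xi> ^ N \<le> C" using g unfolding rapid_decay_def by blast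
    obtain D where D: "\<And>\<xi>. h \<xi> * wt \<xi> ^ N \<le> D" using h unfolding rapid_decay_def by blast
    have "(g \<xi> + h \<xi>) * wt \<xi> ^ N \<le> C + D" for \<xi> using add_mono[OF C[of \<xi>] D[of \<xi>]] by (simp add: distrib_right)
    then show ?thesis by blast
  qed
  then show "(\<lambda>\<xi>. g \<xi> + h \<xi>) \<in> rapid_decay" unfolding rapid_decay_def by blast
next
  fix g h :: "int ^ 'n \<Rightarrow> real" assume g: "g \<in> rapid_decay" and h: "h \<in> poly_growth"
    and pos: "\<forall>\<xi>. 0 \<le> g \<xi>" "\<forall>\<xi>. 0 \<le> h \<xi>"
  obtain D M where D: "0 \<le> D" "\<And>\<xi>. h \<xi> \<le> D * wt \<xi> ^ M"
    by (rule poly_growthE[OF h]) blast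
  have "\<exists>C. \<forall>\<xi>. (g \<xi> * h \<xi>) * wt \<xi> ^ N \<le> C" for N
  proof -
    obtain C where C: "\<And>\<xi>. g \<xi> * wt \<xi> ^ (M + N) \<le> C" using g unfolding rapid_decay_def by blast
    have "(g \<xi> * h \<xi>) * wt \<xi> ^ N \<le> D * C" for \<xi>
    proof -
      have "(g \<xi> * h \<xi>) * wt \<xi> ^ N \<le> (g \<xi> * (D * wt \<xi> ^ M)) * wt \<xi> ^ N"
        by (intro mult_right_mono mult_left_mono D) (use pos in simp_all)
      also have "\<dots> = D * (g \<xi> * wt \<xi> ^ (M + N))" by (simp add: power_add ac_simps)
      also have "\<dots> \<le> D * C" by (intro mult_left_mono C D(1))
      finally show ?thesis .
    qed
    then show ?thesis by blast
  qed
  then show "(\<lambda>\<xi>. g \<xi> * h \<xi>) \<in> rapid_decay" unfolding rapid_decay_def by blast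
next
  fix g h :: "int ^ 'n \<Rightarrow> real" assume g: "g \<in> rapid_decay" and fin: "finite {\<xi>. g \<xi> < h \<xi>}"
    and pos: "\<forall>\<xi>. 0 \<le> g \<xi>"
  have "\<exists>C. \<forall>\<xi>. h \<xi> * wt \<xi> ^ N \<le> C" for N
  proof -
    obtain C where C: "\<And>\<xi>. g \<xi> * wt \<xi> ^ N \<le> C" using g unfolding rapid_decay_def by blast
    obtain K where K: "0 \<le> K" "\<And>\<xi>. \<xi> \<in> {\<xi>. g \<xi> < h \<xi>} \<Longrightarrow> h \<xi> * wt \<xi> ^ N \<le> K"
      by (rule finite_max_bound[OF fin, of "\<lambda>\<xi>. h \<xi> * wt \<xi> ^ N"]) blast
    have "h \<xi> * wt \<xi> ^ N \<le> C + K" for \<xi>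
    proof (cases "g \<xi> < h \<xi>")
      case True
      have "0 \<le> g \<xi> * wt \<xi> ^ N" using pos by simp
      then show ?thesis using K(2)[of \<xi>] True C[of \<xi>] by simp
    next
      case False
      have "h \<xi> * wt \<xi> ^ N \<le> g \<xi> * wt \<xi> ^ N"
        using False by (intro mult_right_mono) simp_all
      then show ?thesis using C[of \<xi>] K(1) by linarith
    qed
    then show ?thesis by blast
  qed
  then show "h \<in> rapid_decay" unfolding rapid_decay_def by blast
qed

definition dominated :: "(int ^ 'n::finite \<Rightarrow> real) set \<Rightarrow> (int ^ 'n \<Rightarrow> real \<Rightarrow> complex) \<Rightarrow> bool" where
  "dominated I w \<longleftrightarrow> (\<exists>g\<in>I. \<forall>\<xi> t. cmod (w \<xi> t) \<le> g \<xi>)"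

text \<open>With \<open>I = rapid_decay\<close> these are the partial Fourier coefficients of smooth
  functions; with \<open>I = poly_growth\<close> they are those of the distributions that can occur
  as solutions.\<close>

definition family :: "(int ^ 'n::finite \<Rightarrow> real) set \<Rightarrow> (int ^ 'n \<Rightarrow> real \<Rightarrow> complex) \<Rightarrow> bool" where
  "family I w \<longleftrightarrow> (\<forall>\<xi>. torus_smooth (w \<xi>)) \<and> (\<forall>\<alpha>. dominated I (\<lambda>\<xi>. t_deriv \<alpha> (w \<xi>)))"

lemma dominatedE:
  assumes "dominated I w"
  obtains g where "g \<in> I" "\<And>\<xi> t. cmod (w \<xi> t) \<le> g \<xi>" "\<And>\<xi>. 0 \<le> g \<xi>"
proof -
  obtain g where g: "g \<in> I" "\<And>\<xi> t. cmod (w \<xi> t) \<le> g \<xi>" using assms unfolding dominated_def by blast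
  have "0 \<le> g \<xi>" for \<xi> by (rule order_trans[OF norm_ge_zero g(2)[of _ 0]])
  with g show thesis by (rule that)
qed

lemma dominatedI: "g \<in> I \<Longrightarrow> (\<And>\<xi> t. cmod (w \<xi> t) \<le> g \<xi>) \<Longrightarrow> dominated I w"
  unfolding dominated_def by blast

lemma dominated_zero: "growth_ideal I \<Longrightarrow> dominated I (\<lambda>\<xi> t. 0)"
  by (rule dominatedI[of "\<lambda>\<xi>. 0"]) (simp_all add: growth_ideal_def)

lemma dominated_add:
  assumes I: "growth_ideal I" and "dominated I v" "dominated I w"
  shows "dominated I (\<lambda>\<xi> t. v \<xi> t + w \<xi> t)"
proof -
  obtain g where g: "g \<in> I" "\<And>\<xi> t. cmod (v \<xi> t) \<le> g \<xi>"
    by (rule dominatedE[OF assms(2)]) blast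
  obtain h where h: "h \<in> I" "\<And>\<xi> t. cmod (w \<xi> t) \<le> h \<xi>"
    by (rule dominatedE[OF assms(3)]) blast
  show ?thesis
  proof (rule dominatedI)
    show "(\<lambda>\<xi>. g \<xi> + h \<xi>) \<in> I" by (rule growth_ideal_add[OF I g(1) h(1)])
    show "cmod (v \<xi> t + w \<xi> t) \<le> g \<xi> + h \<xi>" for \<xi> t by (intro norm_triangle_le add_mono g h)
  qed
qed

lemma dominated_mult:
  assumes I: "growth_ideal I" and "dominated I v" "dominated poly_growth w"
  shows "dominated I (\<lambda>\<xi> t. v \<xi> t * w \<xi> t)"
proof -
  obtain g where g: "g \<in> I" "\<And>\<xi> t. cmod (v \<xi> t) \<le> g \<xi>" "\<And>\<xi>. 0 \<le> g \<xi>"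
    by (rule dominatedE[OF assms(2)]) blast
  obtain h where h: "h \<in> poly_growth" "\<And>\<xi> t. cmod (w \<xi> t) \<le> h \<xi>" "\<And>\<xi>. 0 \<le> h \<xi>"
    by (rule dominatedE[OF assms(3)]) blast
  show ?thesis
  proof (rule dominatedI)
    show "(\<lambda>\<xi>. g \<xi> * h \<xi>) \<in> I" by (rule growth_ideal_mult[OF I g(1) h(1) g(3) h(3)])
    show "cmod (v \<xi> t * w \<xi> t) \<le> g \<xi> * h \<xi>" for \<xi> t
      unfolding norm_mult by (intro mult_mono g h norm_ge_zero)
  qed
qed

lemma finite_small_zvec: "finite {\<xi>::int ^ 'n::finite. norm (zvec \<xi>) < R}"
proof -
  let ?B = "{- \<lceil>\<bar>R\<bar>\<rceil>..\<lceil>\<bar>R\<bar>\<rceil>}"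
  have "{\<xi>::int ^ 'n. norm (zvec \<xi>) < R} \<subseteq> vec_lambda ` (PiE UNIV (\<lambda>_. ?B))"
  proof
    fix \<xi> :: "int ^ 'n" assume "\<xi> \<in> {\<xi>. norm (zvec \<xi>) < R}"
    then have R: "norm (zvec \<xi>) < R" by simp
    have "\<xi> $ i \<in> ?B" for i
    proof -
      have "\<bar>real_of_int (\<xi> $ i)\<bar> \<le> norm (zvec \<xi>)" using component_le_norm_cart[of "zvec \<xi>" i] by (simp add: zvec_def)
      then have "\<bar>real_of_int (\<xi> $ i)\<bar> \<le> of_int \<lceil>\<bar>R\<bar>\<rceil>" using R by linarith
      then have "\<bar>\<xi> $ i\<bar> \<le> \<lceil>\<bar>R\<bar>\<rceil>" by linarith
      then show ?thesis by auto
    qed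
    then have "vec_nth \<xi> \<in> PiE UNIV (\<lambda>_. ?B)" by auto
    then show "\<xi> \<in> vec_lambda ` (PiE UNIV (\<lambda>_. ?B))" by (rule image_eqI[rotated]) (simp add: vec_nth_inverse)
  qed
  then show ?thesis by (rule finite_subset) (auto intro!: finite_imageI finite_PiE)
qed

lemma torus_smooth_bounded:
  assumes "torus_smooth f"
  obtains B where "\<And>x. cmod (f x) \<le> B"
  using torus_smooth_bdd_above[OF assms] by (auto simp: bdd_above_def)

text \<open>Below the radius \<open>R\<close> there are only finitely many frequencies, and there
  the supremum of \<open>w \<xi>\<close> itself serves as majorant.\<close>

lemma dominated_cofinite:
  fixes w :: "int ^ 'n::finite \<Rightarrow> real \<Rightarrow> complex"
  assumes I: "growth_ideal I" and w: "\<And>\<xi>. torus_smooth (w \<xi>)"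
    and g: "g \<in> I" "\<And>\<xi>. 0 \<le> g \<xi>" "\<And>\<xi> t. norm (zvec \<xi>) \<ge> R \<Longrightarrow> cmod (w \<xi> t) \<le> g \<xi>"
  shows "dominated I w"
proof -
  define h where "h \<xi> = (if norm (zvec \<xi>) \<ge> R then g \<xi> else (SUP t. cmod (w \<xi> t)))" for \<xi>
  have "{\<xi>. g \<xi> < h \<xi>} \<subseteq> {\<xi>. norm (zvec \<xi>) < R}" by (auto simp: h_def)
  then have "finite {\<xi>. g \<xi> < h \<xi>}" by (rule finite_subset[OF _ finite_small_zvec])
  then have "h \<in> I" by (rule growth_ideal_cofinite[OF I g(1,2)])
  moreover have "cmod (w \<xi> t) \<le> h \<xi>" for \<xi> t
    using g(3) cSUP_upper[OF UNIV_I torus_smooth_bdd_above[OF w]] by (auto simp: h_def)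
  ultimately show ?thesis by (rule dominatedI)
qed

text \<open>The bounds for different \<open>N\<close> come with different constants; the supremum
  over \<open>t\<close> is a single majorant that satisfies all of them.\<close>

lemma dominated_rapidI:
  assumes "\<And>N. \<exists>C. \<forall>\<xi> t. cmod (w \<xi> t) * wt \<xi> ^ N \<le> C"
  shows "dominated rapid_decay w"
proof (rule dominatedI)
  let ?g = "\<lambda>\<xi>. SUP t. cmod (w \<xi> t)"
  obtain B where B: "\<And>\<xi> t. cmod (w \<xi> t) * wt \<xi> ^ 0 \<le> B" using assms[of 0] by blast
  show "cmod (w \<xi> t) \<le> ?g \<xi>" for \<xi> t
    by (rule cSUP_upper) (use B in \<open>auto intro!: bdd_aboveI[of _ B]\<close>)
  have "\<exists>C. \<forall>\<xi>. ?g \<xi> * wt \<xi> ^ N \<le> C" for N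
  proof -
    obtain C where C: "\<And>\<xi> t. cmod (w \<xi> t) * wt \<xi> ^ N \<le> C" using assms[of N] by blast
    have "?g \<xi> * wt \<xi> ^ N \<le> C" for \<xi>
    proof -
      have W: "0 < wt \<xi> ^ N" by (rule zero_less_power[OF wt_pos])
      have "?g \<xi> \<le> C / wt \<xi> ^ N"
        by (rule cSUP_least) (use C W in \<open>auto simp: pos_le_divide_eq\<close>)
      then show ?thesis using W by (simp add: pos_le_divide_eq)
    qed
    then show ?thesis by blast
  qed
  then show "?g \<in> rapid_decay" unfolding rapid_decay_def by blast
qed

lemma dominated_rapidE:
  assumes "dominated rapid_decay w"
  obtains C where "\<And>\<xi> t. cmod (w \<xi> t) * wt \<xi> ^ N \<le> C"
proof -
  obtain g where g: "g \<in> rapid_decay" "\<And>\<xi> t. cmod (w \<xi> t) \<le> g \<xi>"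
    by (rule dominatedE[OF assms]) blast
  obtain C where C: "\<And>\<xi>. g \<xi> * wt \<xi> ^ N \<le> C" using g(1) unfolding rapid_decay_def by blast
  have "cmod (w \<xi> t) * wt \<xi> ^ N \<le> C" for \<xi> t
    by (rule order_trans[OF mult_right_mono[OF g(2)] C]) (simp add: less_imp_le[OF wt_pos])
  then show thesis by (rule that)
qed

section \<open>Closure properties of families\<close>

lemma vector_derivative_add:
  fixes f g :: "real \<Rightarrow> complex"
  assumes "torus_smooth f" "torus_smooth g"
  shows "vector_derivative (\<lambda>t. f t + g t) (at t) = vector_derivative f (at t) + vector_derivative g (at t)"
  by (rule vector_derivative_at) (intro has_vector_derivative_add torus_smooth_has_vector_derivative assms)

lemma vector_derivative_product:
  fixes f g :: "real \<Rightarrow> complex"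
  assumes "torus_smooth f" "torus_smooth g"
  shows "vector_derivative (\<lambda>t. f t * g t) (at t) = f t * vector_derivative g (at t) + vector_derivative f (at t) * g t"
  by (rule vector_derivative_at) (intro has_vector_derivative_mult torus_smooth_has_vector_derivative assms)

lemma t_deriv_add:
  fixes f g :: "real \<Rightarrow> complex"
  assumes "torus_smooth f" "torus_smooth g"
  shows "t_deriv \<alpha> (\<lambda>t. f t + g t) = (\<lambda>t. t_deriv \<alpha> f t + t_deriv \<alpha> g t)"
  by (induction \<alpha>) (simp_all add: t_deriv_0 t_deriv_Suc' vector_derivative_add torus_smooth_t_deriv assms)

text \<open>The Leibniz rule with control of \<open>v\<close> up to order \<open>\<alpha>\<close>:
  this is the form that a bootstrap can feed, where the higher derivatives of \<open>v\<close> are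
  not yet bounded.\<close>

lemma dominated_t_deriv_mult:
  assumes I: "growth_ideal I" and "\<And>\<xi>. torus_smooth (v \<xi>)"
    and "\<And>\<beta>. \<beta> \<le> \<alpha> \<Longrightarrow> dominated I (\<lambda>\<xi>. t_deriv \<beta> (v \<xi>))" and "family poly_growth w"
  shows "dominated I (\<lambda>\<xi>. t_deriv \<alpha> (\<lambda>t. v \<xi> t * w \<xi> t))"
  using assms(2-)
proof (induction \<alpha> arbitrary: v w)
  case 0
  have "dominated I v" using 0(2)[of 0] by (simp add: t_deriv_0)
  moreover have "dominated poly_growth w"
    using 0(3) unfolding family_def by (auto dest!: spec[of _ 0] simp: t_deriv_0)
  ultimately show ?case using dominated_mult[OF I] by (simp add: t_deriv_0)
next
  case (Suc \<alpha>)
  let ?d = "\<lambda>v \<xi> t. vector_derivative (v \<xi>) (at t)"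
  note sv = Suc.prems(1)
  have sw: "torus_smooth (w \<xi>)" for \<xi> using Suc.prems(3) unfolding family_def by blast
  have "dominated I (\<lambda>\<xi>. t_deriv \<beta> (v \<xi>))" if "\<beta> \<le> \<alpha>" for \<beta> using Suc.prems(2) that by simp
  moreover have fw': "family poly_growth (?d w)"
    using Suc.prems(3) by (simp add: family_def torus_smooth_vector_derivative flip: t_deriv_Suc)
  ultimately have 1: "dominated I (\<lambda>\<xi>. t_deriv \<alpha> (\<lambda>t. v \<xi> t * ?d w \<xi> t))"
    by (intro Suc.IH sv) simp_all
  have "dominated I (\<lambda>\<xi>. t_deriv \<beta> (?d v \<xi>))" if "\<beta> \<le> \<alpha>" for \<beta>
    using Suc.prems(2)[of "Suc \<beta>"] that by (simp add: t_deriv_Suc)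
  then have 2: "dominated I (\<lambda>\<xi>. t_deriv \<alpha> (\<lambda>t. ?d v \<xi> t * w \<xi> t))"
    by (intro Suc.IH torus_smooth_vector_derivative sv Suc.prems(3)) simp_all
  have "t_deriv (Suc \<alpha>) (\<lambda>t. v \<xi> t * w \<xi> t) = (\<lambda>t. t_deriv \<alpha> (\<lambda>t. v \<xi> t * ?d w \<xi> t) t + t_deriv \<alpha> (\<lambda>t. ?d v \<xi> t * w \<xi> t) t)" for \<xi>
    unfolding t_deriv_Suc vector_derivative_product[OF sv sw]
    by (intro t_deriv_add torus_smooth_mult torus_smooth_vector_derivative sv sw)
  then show ?case using dominated_add[OF I 1 2] by simp
qed

lemma family_smooth: "family I w \<Longrightarrow> torus_smooth (w \<xi>)"
  by (simp add: family_def)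

lemma family_dominated_deriv: "family I w \<Longrightarrow> dominated I (\<lambda>\<xi>. t_deriv \<alpha> (w \<xi>))"
  by (simp add: family_def)

lemma family_dominated: "family I w \<Longrightarrow> dominated I w"
  using family_dominated_deriv[of I w 0] by (simp add: t_deriv_0)

lemma family_mult:
  assumes "growth_ideal I" "family I v" "family poly_growth w"
  shows "family I (\<lambda>\<xi> t. v \<xi> t * w \<xi> t)"
  unfolding family_def
proof (intro conjI allI)
  show "torus_smooth (\<lambda>t. v \<xi> t * w \<xi> t)" for \<xi>
    by (rule torus_smooth_mult[OF family_smooth[OF assms(2)] family_smooth[OF assms(3)]])
  show "dominated I (\<lambda>\<xi>. t_deriv \<alpha> (\<lambda>t. v \<xi> t * w \<xi> t))" for \<alpha>
    by (rule dominated_t_deriv_mult[OF assms(1) family_smooth[OF assms(2)] family_dominated_deriv[OF assms(2)] assms(3)])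
qed

lemma family_add:
  assumes "growth_ideal I" "family I v" "family I w"
  shows "family I (\<lambda>\<xi> t. v \<xi> t + w \<xi> t)"
  unfolding family_def
  using assms by (simp add: family_smooth torus_smooth_add t_deriv_add dominated_add family_dominated_deriv)

lemma t_deriv_zero: "t_deriv \<alpha> (\<lambda>t. 0 :: complex) = (\<lambda>t. 0)"
  by (induction \<alpha>) (simp_all add: t_deriv_0 t_deriv_Suc)

lemma family_zero: "growth_ideal I \<Longrightarrow> family I (\<lambda>\<xi> t. 0)"
  by (simp add: family_def torus_smooth_const t_deriv_zero dominated_zero)

lemma family_sum:
  assumes "growth_ideal I" "\<And>k. k \<in> A \<Longrightarrow> family I (w k)"
  shows "family I (\<lambda>\<xi> t. \<Sum>k\<in>A. w k \<xi> t)"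
  using assms(2) by (induction A rule: infinite_finite_induct) (simp_all add: family_zero family_add assms(1))

lemma family_const:
  fixes a :: "int ^ 'n::finite \<Rightarrow> complex"
  assumes "growth_ideal I" "(\<lambda>\<xi>. cmod (a \<xi>)) \<in> I"
  shows "family I (\<lambda>\<xi> t. a \<xi>)"
  unfolding family_def
proof (intro conjI allI)
  fix \<alpha>
  show "dominated I (\<lambda>\<xi>. t_deriv \<alpha> (\<lambda>t. a \<xi>))"
  proof (cases \<alpha>)
    case 0
    then show ?thesis using assms(2) by (auto simp: t_deriv_0 intro!: dominatedI)
  next
    case (Suc \<beta>)
    then show ?thesis by (simp add: t_deriv_Suc t_deriv_zero dominated_zero assms(1))
  qed
qed (rule torus_smooth_const)

lemma poly_growth_const: "(\<lambda>\<xi>. c) \<in> poly_growth"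
  by (rule poly_growthI[of _ c 0]) simp

lemma family_cmult:
  assumes "growth_ideal I" "family I w"
  shows "family I (\<lambda>\<xi> t. c * w \<xi> t)"
  using family_mult[OF assms family_const[OF growth_ideal_poly poly_growth_const[of "cmod c"]]]
  by (simp add: mult.commute)

lemma family_minus: "growth_ideal I \<Longrightarrow> family I w \<Longrightarrow> family I (\<lambda>\<xi> t. - w \<xi> t)"
  using family_cmult[of I w "-1"] by simp

lemma family_independent:
  assumes f: "torus_smooth f"
  shows "family poly_growth (\<lambda>\<xi>. f)"
  unfolding family_def
proof (intro conjI allI f)
  fix \<alpha>
  obtain B where "\<And>t. cmod (t_deriv \<alpha> f t) \<le> B" using torus_smooth_bounded[OF torus_smooth_t_deriv[OF f]] by blast
  then show "dominated poly_growth (\<lambda>\<xi>. t_deriv \<alpha> f)" by (intro dominatedI[OF poly_growth_const[of B]])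
qed

lemma family_vector_derivative:
  "family I w \<Longrightarrow> family I (\<lambda>\<xi> t. vector_derivative (w \<xi>) (at t))"
  by (simp add: family_def torus_smooth_vector_derivative flip: t_deriv_Suc)

lemma family_D_t: "growth_ideal I \<Longrightarrow> family I w \<Longrightarrow> family I (\<lambda>\<xi>. D_t (w \<xi>))"
  unfolding D_t_def[abs_def] by (intro family_cmult family_vector_derivative)

lemma rapid_decay_subset: "rapid_decay \<subseteq> poly_growth"
proof
  fix g :: "int ^ 'n \<Rightarrow> real" assume "g \<in> rapid_decay"
  then obtain C where "\<And>\<xi>. g \<xi> * wt \<xi> ^ 0 \<le> C" unfolding rapid_decay_def by blast
  then show "g \<in> poly_growth" by (intro poly_growthI[of _ C 0]) simp
qed

lemma family_rapid_poly: "family rapid_decay w \<Longrightarrow> family poly_growth w"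
  unfolding family_def dominated_def using rapid_decay_subset by blast

text \<open>Bootstrap: the equation expresses a derivative of order \<open>Suc \<beta>\<close>
  through derivatives of order \<open>\<beta>\<close> of \<open>g\<close> and of the product of
  \<open>v\<close> and \<open>h\<close>, so a sup bound on \<open>v\<close> in the class
  \<open>I\<close> spreads to all derivatives.\<close>

lemma family_ode:
  assumes I: "growth_ideal I" and v: "\<And>\<xi>. torus_smooth (v \<xi>)" "dominated I v"
    and g: "family I g" and h: "family poly_growth h"
    and eq: "\<And>\<xi> t. vector_derivative (v \<xi>) (at t) = g \<xi> t + v \<xi> t * h \<xi> t"
  shows "family I v"
  unfolding family_def
proof (intro conjI allI v(1))
  fix \<alpha>
  show "dominated I (\<lambda>\<xi>. t_deriv \<alpha> (v \<xi>))"
  proof (induction \<alpha> rule: less_induct)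
    case (less \<alpha>)
    show ?case
    proof (cases \<alpha>)
      case 0
      then show ?thesis using v(2) by (simp add: t_deriv_0)
    next
      case (Suc \<beta>)
      have "t_deriv \<alpha> (v \<xi>) = (\<lambda>t. t_deriv \<beta> (g \<xi>) t + t_deriv \<beta> (\<lambda>t. v \<xi> t * h \<xi> t) t)" for \<xi>
        unfolding Suc t_deriv_Suc eq
        by (intro t_deriv_add torus_smooth_mult v family_smooth[OF g] family_smooth[OF h])
      moreover have "dominated I (\<lambda>\<xi>. t_deriv \<beta> (\<lambda>t. v \<xi> t * h \<xi> t))"
        by (intro dominated_t_deriv_mult I v h less.IH) (simp add: Suc)
      ultimately show ?thesis using dominated_add[OF I family_dominated_deriv[OF g]] by simp
    qed
  qed
qed

text \<open>The finitely many derivatives up to order \<open>N\<close> share one majorant, the sum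
  of the individual ones.\<close>

lemma family_test_seminorm:
  assumes I: "growth_ideal I" and w: "family I w"
  obtains g where "g \<in> I" "\<And>\<xi>. test_seminorm N (w \<xi>) \<le> g \<xi>"
proof -
  have "\<exists>g\<in>I. (\<forall>\<xi>. 0 \<le> g \<xi>) \<and> (\<forall>\<xi> t. \<forall>\<alpha>\<le>N. cmod (t_deriv \<alpha> (w \<xi>) t) \<le> g \<xi>)"
  proof (induction N)
    case 0
    show ?case by (rule dominatedE[OF family_dominated_deriv[OF w, of 0]]) auto
  next
    case (Suc N)
    then obtain g where g: "g \<in> I" "\<And>\<xi>. 0 \<le> g \<xi>" "\<And>\<xi> t \<alpha>. \<alpha> \<le> N \<Longrightarrow> cmod (t_deriv \<alpha> (w \<xi>) t) \<le> g \<xi>" by blast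
    obtain h where h: "h \<in> I" "\<And>\<xi> t. cmod (t_deriv (Suc N) (w \<xi>) t) \<le> h \<xi>" "\<And>\<xi>. 0 \<le> h \<xi>"
    by (rule dominatedE[OF family_dominated_deriv[OF w, of "Suc N"]]) blast
    have "(\<lambda>\<xi>. g \<xi> + h \<xi>) \<in> I" by (rule growth_ideal_add[OF I g(1) h(1)])
    moreover have "cmod (t_deriv \<alpha> (w \<xi>) t) \<le> g \<xi> + h \<xi>" if "\<alpha> \<le> Suc N" for \<xi> t \<alpha>
    proof (cases "\<alpha> = Suc N")
      case True then show ?thesis using h(2)[of \<xi> t] g(2)[of \<xi>] by simp
    next
      case False
      then have "\<alpha> \<le> N" using that by simp
      from g(3)[OF this, of \<xi> t] h(3)[of \<xi>] show ?thesis by simp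
    qed
    ultimately show ?case using g(2) h(3) by (intro bexI[of _ "\<lambda>\<xi>. g \<xi> + h \<xi>"]) (auto intro: add_nonneg_nonneg)
  qed
  then obtain g where g: "g \<in> I" "\<And>\<xi>. 0 \<le> g \<xi>" "\<And>\<xi> t \<alpha>. \<alpha> \<le> N \<Longrightarrow> cmod (t_deriv \<alpha> (w \<xi>) t) \<le> g \<xi>" by blast
  define K where "K = real (card {bs. set bs \<subseteq> (Basis :: real set) \<and> length bs \<le> N})"
  show thesis
  proof
    have "0 \<le> K" by (simp add: K_def)
    then show "(\<lambda>\<xi>. g \<xi> * K) \<in> I" by (intro growth_ideal_mult I g poly_growth_const)
    show "test_seminorm N (w \<xi>) \<le> g \<xi> * K" for \<xi>
      using test_seminorm_leI[of N "w \<xi>" "g \<xi>"] g(3) iter_partial_real[OF family_smooth[OF w]]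
      by (simp add: K_def mult.commute)
  qed
qed

subsection \<open>Distributions represented by families\<close>

definition represents :: "'n::finite distr \<Rightarrow> (int ^ 'n \<Rightarrow> real \<Rightarrow> complex) \<Rightarrow> bool" where
  "represents u w \<longleftrightarrow> (\<forall>\<xi> \<psi>. torus_smooth \<psi> \<longrightarrow>
     partial_fourier u \<xi> \<psi> = integral torus_cell (\<lambda>t. w \<xi> t * \<psi> t))"

text \<open>The factor by which a bound with two spare powers of \<open>\<tau>\<close> turns into a
  bound on a Fourier series in \<open>t\<close>.\<close>

definition lattice_mass :: real where
  "lattice_mass = (\<Sum>\<^sub>\<infinity>\<tau>\<in>(torus_lattice :: real set). inverse ((1 + norm \<tau>) ^ 2))"

lemma t_deriv_le_fcoef:
  fixes w :: "real \<Rightarrow> complex"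
  assumes w: "torus_smooth w"
    and K: "\<And>\<tau>. \<tau> \<in> torus_lattice \<Longrightarrow> cmod (fcoef w \<tau>) * (1 + norm \<tau>) ^ (\<alpha> + 2) \<le> K"
  shows "cmod (t_deriv \<alpha> w t) \<le> K * lattice_mass"
proof -
  let ?bs = "replicate \<alpha> (1::real)"
  have bs: "set ?bs \<subseteq> Basis" by auto
  have hs: "((\<lambda>\<tau>::real. K * inverse ((1 + norm \<tau>) ^ 2)) has_sum (K * lattice_mass)) torus_lattice"
    unfolding lattice_mass_def using torus_lattice_summable[where 'a = real]
    by (intro has_sum_cmult_right has_sum_infsum) simp
  have "t_deriv \<alpha> w t = iter_partial ?bs (fseries (fcoef w)) t"
    using iter_partial_real[OF w bs] by (simp add: fourier_inversion[OF w])
  also have "cmod \<dots> \<le> (\<Sum>\<^sub>\<infinity>\<tau>\<in>torus_lattice. cmod (fcoef w \<tau>) * (1 + norm \<tau>) ^ \<alpha>)"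
    by (rule iter_partial_fseries_le[OF rapid_fcoef[OF w] bs]) simp
  also have "\<dots> \<le> (\<Sum>\<^sub>\<infinity>\<tau>\<in>torus_lattice. K * inverse ((1 + norm (\<tau>::real)) ^ 2))"
  proof (rule infsum_mono[OF rapid_summable[OF rapid_fcoef[OF w]] has_sum_imp_summable[OF hs]])
    fix \<tau> :: real assume "\<tau> \<in> torus_lattice"
    have "0 < (1 + norm \<tau>) ^ 2" by (intro zero_less_power add_pos_nonneg) auto
    then show "cmod (fcoef w \<tau>) * (1 + norm \<tau>) ^ \<alpha> \<le> K * inverse ((1 + norm \<tau>) ^ 2)"
      using K[OF \<open>\<tau> \<in> torus_lattice\<close>] unfolding power_add
      by (simp add: pos_le_divide_eq mult.assoc flip: divide_inverse)
  qed
  also have "\<dots> = K * lattice_mass" by (rule infsumI[OF hs])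
  finally show ?thesis .
qed

text \<open>All but one of the factors 2 pi come from the normalisation of
  \<open>partial_fourier\<close>, the last one from the coefficient in \<open>t\<close>; the sign of
  \<open>\<tau>\<close> flips because the pairing is without conjugation.\<close>

lemma represents_char:
  fixes u :: "'n::finite distr"
  assumes "represents u w" "\<tau> \<in> \<int>"
  shows "u (torus_char (\<tau>, - zvec \<xi>)) = (2 * of_real pi) ^ (CARD('n) + 1) * fcoef (w \<xi>) (- \<tau>)"
proof -
  have "torus_smooth (torus_char \<tau>)" using assms(2) by (intro torus_smooth_char) (simp add: torus_lattice_real)
  then have "partial_fourier u \<xi> (torus_char \<tau>) = integral torus_cell (\<lambda>t. w \<xi> t * torus_char \<tau> t)"
    using assms(1) unfolding represents_def by blast
  then have "partial_fourier u \<xi> (torus_char \<tau>) = 2 * of_real pi * fcoef (w \<xi>) (- \<tau>)"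
    unfolding integral_mult_char by simp
  then show ?thesis unfolding partial_fourier_char by (simp add: field_simps)
qed

lemma lattice_prodE:
  fixes z :: "real \<times> (real ^ 'n::finite)"
  assumes "z \<in> torus_lattice"
  obtains \<tau> \<xi> where "\<tau> \<in> \<int>" "z = (\<tau>, - zvec \<xi>)"
proof -
  obtain \<tau> y where z: "z = (\<tau>, y)" by (cases z)
  have "\<tau> \<in> \<int>" "- y \<in> torus_lattice"
    using assms z by (simp_all add: torus_lattice_prod torus_lattice_uminus torus_lattice_real)
  moreover obtain \<xi> where "- y = zvec \<xi>" using calculation(2) unfolding torus_lattice_vec by blast
  then have "y = - zvec \<xi>" by (metis minus_minus)
  ultimately show thesis using that z by blast
qed

text \<open>Decay of order \<open>\<alpha> + 2 + N\<close> in the joint frequency is divided up: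
  \<open>\<alpha>\<close> powers of \<open>\<tau>\<close> pay for the derivatives, two for the
  summation over \<open>\<tau>\<close>, and \<open>N\<close> are left for
  \<open>\<xi>\<close>.\<close>

lemma smooth_distribution_imp_rapid_family:
  fixes u :: "'n::finite distr"
  assumes u: "smooth_distribution u" and w: "\<And>\<xi>. torus_smooth (w \<xi>)" and r: "represents u w"
  shows "family rapid_decay w"
  unfolding family_def
proof (intro conjI allI w dominated_rapidI)
  fix \<alpha> N
  define c where "c = (2 * pi) ^ (CARD('n) + 1)"
  have c: "0 < c" by (simp add: c_def)
  have "rapid (\<lambda>z. u (torus_char z))"
    using smooth_distribution_iff_rapid[OF smooth_imp_torus_distribution[OF u]] u by blast
  then obtain C where C: "\<And>z. z \<in> torus_lattice \<Longrightarrow> cmod (u (torus_char z)) * (1 + norm z) ^ (\<alpha> + 2 + N) \<le> C"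
    unfolding rapid_def by blast
  have "cmod (t_deriv \<alpha> (w \<xi>) t) * wt \<xi> ^ N \<le> C / c * lattice_mass" for \<xi> t
  proof -
    have W: "0 < wt \<xi> ^ N" by (rule zero_less_power[OF wt_pos])
    have "cmod (t_deriv \<alpha> (w \<xi>) t) \<le> (C / c / wt \<xi> ^ N) * lattice_mass"
    proof (rule t_deriv_le_fcoef[OF w])
      fix \<tau> :: real assume "\<tau> \<in> torus_lattice"
      then have \<tau>: "- \<tau> \<in> \<int>" by (simp add: torus_lattice_real)
      let ?z = "(- \<tau>, - zvec \<xi>)"
      have "cmod (u (torus_char ?z)) = c * cmod (fcoef (w \<xi>) \<tau>)"
        unfolding represents_char[OF r \<tau>] c_def by (simp add: norm_mult norm_power)
      moreover have "(1 + norm \<tau>) ^ (\<alpha> + 2) * wt \<xi> ^ N \<le> (1 + norm ?z) ^ (\<alpha> + 2) * (1 + norm ?z) ^ N"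
        using abs_le_norm_prod(1)[of "- \<tau>" "- zvec \<xi>"] wt_le_norm_prod[of \<xi> "- \<tau>"] wt_pos[of \<xi>]
        by (intro mult_mono power_mono) simp_all
      ultimately have "c * cmod (fcoef (w \<xi>) \<tau>) * ((1 + norm \<tau>) ^ (\<alpha> + 2) * wt \<xi> ^ N)
          \<le> cmod (u (torus_char ?z)) * (1 + norm ?z) ^ (\<alpha> + 2 + N)"
        by (simp only: power_add) (intro mult_left_mono mult_nonneg_nonneg; simp add: less_imp_le[OF c])
      also have "\<dots> \<le> C" by (rule C[OF mode_lattice[OF \<tau>]])
      finally show "cmod (fcoef (w \<xi>) \<tau>) * (1 + norm \<tau>) ^ (\<alpha> + 2) \<le> C / c / wt \<xi> ^ N"
        using c W by (simp add: pos_le_divide_eq ac_simps)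
    qed
    then have "cmod (t_deriv \<alpha> (w \<xi>) t) * wt \<xi> ^ N \<le> (C / c / wt \<xi> ^ N) * lattice_mass * wt \<xi> ^ N"
      by (rule mult_right_mono) simp
    moreover have "wt \<xi> \<noteq> 0" using wt_pos[of \<xi>] by simp
    ultimately show ?thesis by simp
  qed
  then show "\<exists>C. \<forall>\<xi> t. cmod (t_deriv \<alpha> (w \<xi>) t) * wt \<xi> ^ N \<le> C" by blast
qed

text \<open>Derivatives in \<open>t\<close> up to order \<open>N\<close> give decay of order
  \<open>N\<close> in \<open>\<tau>\<close>, and the majorant gives order \<open>N\<close> in
  \<open>\<xi>\<close>. This suffices because the weight of the joint frequency is at most the
  product of the two weights.\<close>

lemma rapid_family_imp_smooth_distribution:
  fixes u :: "'n::finite distr"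
  assumes u: "torus_distribution u" and w: "family rapid_decay w" and r: "represents u w"
  shows "smooth_distribution u"
  unfolding smooth_distribution_iff_rapid[OF u] rapid_def
proof
  fix N
  define c where "c = (2 * pi) ^ (CARD('n) + 1)"
  have c: "0 < c" by (simp add: c_def)
  obtain g where g: "g \<in> rapid_decay" "\<And>\<xi>. test_seminorm N (w \<xi>) \<le> g \<xi>"
    by (rule family_test_seminorm[OF growth_ideal_rapid w, of N]) blast
  obtain C where C: "\<And>\<xi>. g \<xi> * wt \<xi> ^ N \<le> C" using g(1) unfolding rapid_decay_def by blast
  have "cmod (u (torus_char z)) * (1 + norm z) ^ N \<le> c * (2 ^ N * C)" if z: "z \<in> torus_lattice" for z
  proof -
    obtain \<tau> \<xi> where \<tau>: "\<tau> \<in> \<int>" "z = (\<tau>, - zvec \<xi>)" by (rule lattice_prodE[OF z]) blast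
    have \<tau>': "- \<tau> \<in> torus_lattice" using \<tau> by (simp add: torus_lattice_real)
    have "cmod (u (torus_char z)) * (1 + norm z) ^ N \<le> (c * cmod (fcoef (w \<xi>) (- \<tau>))) * ((1 + \<bar>\<tau>\<bar>) * wt \<xi>) ^ N"
      unfolding \<tau>(2) represents_char[OF r \<tau>(1)] c_def
      by (intro mult_mono power_mono norm_prod_le_wt) (simp_all add: norm_mult norm_power)
    also have "\<dots> = c * ((cmod (fcoef (w \<xi>) (- \<tau>)) * (1 + norm (- \<tau>)) ^ N) * wt \<xi> ^ N)"
      by (simp add: power_mult_distrib)
    also have "\<dots> \<le> c * ((2 ^ N * test_seminorm N (w \<xi>)) * wt \<xi> ^ N)"
    proof -
      have "cmod (fcoef (w \<xi>) (- \<tau>)) * (1 + norm (- \<tau>)) ^ N \<le> 2 ^ N * test_seminorm N (w \<xi>)"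
        using fcoef_decay[OF \<tau>' family_smooth[OF w], where N = N] by simp
      then show ?thesis by (intro mult_left_mono mult_right_mono) (simp_all add: less_imp_le[OF c])
    qed
    also have "\<dots> \<le> c * ((2 ^ N * g \<xi>) * wt \<xi> ^ N)"
      by (intro mult_left_mono mult_right_mono g(2)) (simp_all add: less_imp_le[OF c])
    also have "\<dots> = c * (2 ^ N * (g \<xi> * wt \<xi> ^ N))" by simp
    also have "\<dots> \<le> c * (2 ^ N * C)"
      by (intro mult_left_mono C) (simp_all add: less_imp_le[OF c])
    finally show ?thesis .
  qed
  then show "\<exists>C. \<forall>z\<in>torus_lattice. cmod (u (torus_char z)) * (1 + norm z) ^ N \<le> C" by blast
qed

text \<open>The distribution is prescribed on characters, with the signs dictated by
  \<open>represents_char\<close>. The coefficients of \<open>w \<xi>\<close> are at most its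
  supremum, hence of polynomial growth in the joint frequency.\<close>

lemma poly_family_distribution:
  fixes w :: "int ^ 'n::finite \<Rightarrow> real \<Rightarrow> complex"
  assumes w: "family poly_growth w"
  obtains u :: "'n distr" where "torus_distribution u" "represents u w"
proof -
  let ?c = "(2 * of_real pi) ^ (CARD('n) + 1) :: complex"
  define b :: "real \<times> (real ^ 'n) \<Rightarrow> complex"
    where "b z = ?c * fcoef (w (zvec_inv (- snd z))) (- fst z)" for z
  obtain g where g: "g \<in> poly_growth" "\<And>\<xi> t. cmod (w \<xi> t) \<le> g \<xi>" by (rule dominatedE[OF family_dominated[OF w]]) blast
  obtain C N where C: "0 \<le> C" "\<And>\<xi>. g \<xi> \<le> C * wt \<xi> ^ N" by (rule poly_growthE[OF g(1)]) blast
  have b: "cmod (b z) \<le> (cmod ?c * C) * (1 + norm z) ^ N" if z: "z \<in> torus_lattice" for z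
  proof -
    obtain \<tau> \<xi> where \<tau>: "\<tau> \<in> \<int>" "z = (\<tau>, - zvec \<xi>)" by (rule lattice_prodE[OF z]) blast
    have "cmod (fcoef (w \<xi>) (- \<tau>)) \<le> g \<xi>"
      by (rule cmod_fcoef_le[OF torus_smooth_continuous[OF family_smooth[OF w]] g(2)])
    also have "\<dots> \<le> C * wt \<xi> ^ N" by (rule C)
    also have "\<dots> \<le> C * (1 + norm z) ^ N"
      using wt_pos[of \<xi>] unfolding \<tau>(2) by (intro mult_left_mono power_mono wt_le_norm_prod C) simp
    finally have "cmod ?c * cmod (fcoef (w \<xi>) (- \<tau>)) \<le> cmod ?c * (C * (1 + norm z) ^ N)"
      by (rule mult_left_mono) simp
    then show ?thesis unfolding b_def \<tau>(2) by (simp add: norm_mult mult.assoc)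
  qed
  let ?u = "coef_distribution b"
  have u: "torus_distribution ?u" by (rule torus_distribution_coef[of b, OF b])
  have "partial_fourier ?u \<xi> \<psi> = integral torus_cell (\<lambda>t. w \<xi> t * \<psi> t)" if \<psi>: "torus_smooth \<psi>" for \<xi> \<psi>
  proof (rule torus_distribution_eqI[OF torus_distribution_partial_fourier[OF u]
        torus_distribution_integral[OF family_smooth[OF w]] _ \<psi>])
    fix \<tau> :: real assume "\<tau> \<in> torus_lattice"
    then have L: "(\<tau>, - zvec \<xi>) \<in> torus_lattice" by (intro mode_lattice) (simp add: torus_lattice_real)
    show "partial_fourier ?u \<xi> (torus_char \<tau>) = integral torus_cell (\<lambda>t. w \<xi> t * torus_char \<tau> t)"
    proof -
      have "?u (torus_char (\<tau>, - zvec \<xi>)) = ?c * fcoef (w \<xi>) (- \<tau>)"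
        using coef_distribution_char[of b, OF b L] by (simp add: b_def)
      then show ?thesis unfolding partial_fourier_char integral_mult_char by simp
    qed
  qed
  then have "represents ?u w" unfolding represents_def by blast
  with u show thesis by (rule that)
qed

lemma integral_D_t:
  fixes w \<psi> :: "real \<Rightarrow> complex"
  assumes w: "torus_smooth w" and \<psi>: "torus_smooth \<psi>"
  shows "integral torus_cell (\<lambda>t. w t * D_t \<psi> t) = - integral torus_cell (\<lambda>t. D_t w t * \<psi> t)"
proof -
  have "0 = integral torus_cell (\<lambda>t. frechet_derivative (\<lambda>t. w t * \<psi> t) (at t) 1)"
    using integral_torus_partial[OF torus_smooth_mult[OF w \<psi>], of 1] by simp
  also have "\<dots> = integral torus_cell (\<lambda>t. \<i> * (w t * D_t \<psi> t + D_t w t * \<psi> t))"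
    by (simp add: frechet_mult w \<psi> frechet_eq_vector_derivative D_t_def algebra_simps)
  also have "\<dots> = \<i> * (integral torus_cell (\<lambda>t. w t * D_t \<psi> t) + integral torus_cell (\<lambda>t. D_t w t * \<psi> t))"
    by (subst integral_mult_right, subst integral_add)
      (intro torus_integrable torus_smooth_mult torus_smooth_D_t w \<psi> refl)+
  finally show ?thesis by (simp add: add_eq_0_iff2)
qed

definition system_family ::
    "('m::finite \<Rightarrow> 'm \<Rightarrow> real \<Rightarrow> complex) \<Rightarrow> ('m \<Rightarrow> 'm \<Rightarrow> int ^ 'n \<Rightarrow> complex) \<Rightarrow>
     ('m \<Rightarrow> int ^ 'n::finite \<Rightarrow> real \<Rightarrow> complex) \<Rightarrow> 'm \<Rightarrow> int ^ 'n \<Rightarrow> real \<Rightarrow> complex" where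
  "system_family c q w j \<xi> t = D_t (w j \<xi>) t + (\<Sum>k\<in>UNIV. c j k t * q j k \<xi> * w k \<xi> t)"

lemma torus_smooth_system_family:
  assumes "\<And>k \<xi>. torus_smooth (w k \<xi>)" "\<And>j k. torus_smooth (c j k)"
  shows "torus_smooth (system_family c q w j \<xi>)"
  unfolding system_family_def[abs_def]
  by (intro torus_smooth_add torus_smooth_D_t torus_smooth_sum torus_smooth_mult torus_smooth_const assms)

lemma represents_system_op:
  fixes c :: "'m::finite \<Rightarrow> 'm \<Rightarrow> real \<Rightarrow> complex" and u :: "'m \<Rightarrow> 'n::finite distr"
  assumes u: "\<And>k. torus_distribution (u k)" and c: "\<And>j k. torus_smooth (c j k)" and q: "\<And>j k. pdo_symbol (q j k)"
    and w: "\<And>k \<xi>. torus_smooth (w k \<xi>)" and r: "\<And>k. represents (u k) (w k)"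
  shows "represents (system_op c q u j) (system_family c q w j)"
  unfolding represents_def
proof (intro allI impI)
  fix \<xi> :: "int ^ 'n" and \<psi> :: "real \<Rightarrow> complex" assume \<psi>: "torus_smooth \<psi>"
  have pf: "partial_fourier (u k) \<xi> \<psi>' = integral torus_cell (\<lambda>t. w k \<xi> t * \<psi>' t)" if "torus_smooth \<psi>'" for k \<psi>'
    using r that unfolding represents_def by blast
  note i = torus_integrable[OF torus_smooth_mult]
  have "integral torus_cell (\<lambda>t. system_family c q w j \<xi> t * \<psi> t) =
      integral torus_cell (\<lambda>t. D_t (w j \<xi>) t * \<psi> t + (\<Sum>k\<in>UNIV. q j k \<xi> * (w k \<xi> t * (c j k t * \<psi> t))))"
    by (intro integral_cong) (simp add: system_family_def distrib_left sum_distrib_left ac_simps)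
  also have "\<dots> = integral torus_cell (\<lambda>t. D_t (w j \<xi>) t * \<psi> t) +
      integral torus_cell (\<lambda>t. \<Sum>k\<in>UNIV. q j k \<xi> * (w k \<xi> t * (c j k t * \<psi> t)))"
    by (intro integral_add torus_integrable torus_smooth_sum torus_smooth_cmult torus_smooth_mult torus_smooth_D_t w c \<psi>)
  also have "integral torus_cell (\<lambda>t. \<Sum>k\<in>UNIV. q j k \<xi> * (w k \<xi> t * (c j k t * \<psi> t))) =
      (\<Sum>k\<in>UNIV. integral torus_cell (\<lambda>t. q j k \<xi> * (w k \<xi> t * (c j k t * \<psi> t))))"
    by (intro integral_sum torus_integrable torus_smooth_cmult torus_smooth_mult w c \<psi>) simp
  finally show "partial_fourier (system_op c q u j) \<xi> \<psi> = integral torus_cell (\<lambda>t. system_family c q w j \<xi> t * \<psi> t)"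
    using integral_D_t[OF w \<psi>]
    by (simp add: partial_fourier_system_op[OF u c q \<psi>] pf torus_smooth_D_t torus_smooth_mult c \<psi>)
qed

subsection \<open>Regularity of solutions in t\<close>

lemma growth_ideal_sum:
  assumes "growth_ideal I" "\<And>k. k \<in> A \<Longrightarrow> g k \<in> I"
  shows "(\<lambda>\<xi>. \<Sum>k\<in>A. g k \<xi>) \<in> I"
  using assms(2)
proof (induction A rule: infinite_finite_induct)
  case (insert k A)
  then show ?case using growth_ideal_add[OF assms(1), of "g k" "\<lambda>\<xi>. \<Sum>k\<in>A. g k \<xi>"] by simp
qed (use assms(1) in \<open>simp_all add: growth_ideal_def\<close>)

lemma vector_derivative_torus_char:
  assumes "\<tau> \<in> \<int>"
  shows "vector_derivative (torus_char \<tau>) (at t) = \<i> * of_real \<tau> * torus_char \<tau> t"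
proof -
  have "torus_smooth (torus_char \<tau>)" using assms by (intro torus_smooth_char) (simp add: torus_lattice_real)
  from frechet_eq_vector_derivative[OF this, of t 1] show ?thesis by (simp add: frechet_torus_char)
qed

lemma D_t_mult_char:
  assumes g: "torus_smooth g" and \<tau>: "\<tau> \<in> \<int>"
  shows "D_t (\<lambda>t. g t * torus_char \<tau> t) = (\<lambda>t. 1 * (D_t g t * torus_char \<tau> t) + of_real \<tau> * (g t * torus_char \<tau> t))"
proof
  fix t
  have e: "torus_smooth (torus_char \<tau>)" using \<tau> by (intro torus_smooth_char) (simp add: torus_lattice_real)
  show "D_t (\<lambda>t. g t * torus_char \<tau> t) t = 1 * (D_t g t * torus_char \<tau> t) + of_real \<tau> * (g t * torus_char \<tau> t)"
    unfolding D_t_def vector_derivative_product[OF g e] vector_derivative_torus_char[OF \<tau>]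
    by (simp add: algebra_simps)
qed

lemma smooth_distribution_mult:
  fixes u :: "'n::finite distr"
  assumes u: "smooth_distribution u" and g: "torus_smooth g"
  shows "smooth_distribution (distr_mult g u)"
proof -
  obtain f where f: "torus_smooth f" "\<And>\<phi>. torus_smooth \<phi> \<Longrightarrow> u \<phi> = integral torus_cell (\<lambda>x. f x * \<phi> x)"
    using u unfolding smooth_distribution_def by blast
  note G = torus_smooth_fst[OF g, where 'n = 'n]
  have "distr_mult g u \<phi> = integral torus_cell (\<lambda>x. (f x * g (fst x)) * \<phi> x)" if \<phi>: "torus_smooth \<phi>" for \<phi>
  proof -
    have "distr_mult g u \<phi> = u (\<lambda>p. g (fst p) * \<phi> p)"
      unfolding distr_mult_def by (rule arg_cong[where f = u]) auto
    then show ?thesis using f(2)[OF torus_smooth_mult[OF G \<phi>]] by (simp add: mult.assoc)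
  qed
  with torus_smooth_mult[OF f(1) G] show ?thesis unfolding smooth_distribution_def by blast
qed

text \<open>The equation trades a factor \<open>\<tau>\<close> for a power of \<open>\<xi>\<close>, since \<open>D\<^sub>t (g e\<^sub>\<tau>) = (D\<^sub>t g) e\<^sub>\<tau> + \<tau> g e\<^sub>\<tau>\<close>;
  allowing an arbitrary smooth factor \<open>g\<close> closes the induction under multiplication by the
  coefficients \<open>c\<close>.\<close>

lemma regularity_in_t:
  fixes c :: "'m::finite \<Rightarrow> 'm \<Rightarrow> real \<Rightarrow> complex" and u :: "'m \<Rightarrow> 'n::finite distr"
  assumes u: "\<And>k. torus_distribution (u k)" and c: "\<And>j k. torus_smooth (c j k)" and q: "\<And>j k. pdo_symbol (q j k)"
    and P: "\<And>j. smooth_distribution (system_op c q u j)"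
  obtains h where "h \<in> poly_growth" "\<And>\<xi> \<tau>. \<tau> \<in> \<int> \<Longrightarrow>
    cmod (partial_fourier (u k) \<xi> (torus_char \<tau>)) * (1 + \<bar>\<tau>\<bar>) ^ p \<le> h \<xi>"
proof -
  define Z where "Z k g \<tau> \<xi> = partial_fourier (u k) \<xi> (\<lambda>t. g t * torus_char \<tau> t)" for k g \<tau> \<xi>
  have "\<forall>k. \<exists>CN. 0 \<le> fst CN \<and> (\<forall>\<phi>. torus_smooth \<phi> \<longrightarrow> cmod (u k \<phi>) \<le> fst CN * test_seminorm (snd CN) \<phi>)"
  proof
    fix k
    obtain C N where "0 \<le> C" "\<And>\<phi>. torus_smooth \<phi> \<Longrightarrow> cmod (u k \<phi>) \<le> C * test_seminorm N \<phi>"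
      by (rule torus_distribution_bound[OF u]) blast
    then show "\<exists>CN. 0 \<le> fst CN \<and> (\<forall>\<phi>. torus_smooth \<phi> \<longrightarrow> cmod (u k \<phi>) \<le> fst CN * test_seminorm (snd CN) \<phi>)"
      by (intro exI[of _ "(C, N)"]) simp
  qed
  from choice[OF this] obtain CN where CN: "\<And>k. 0 \<le> fst (CN k)"
    "\<And>k \<phi>. torus_smooth \<phi> \<Longrightarrow> cmod (u k \<phi>) \<le> fst (CN k) * test_seminorm (snd (CN k)) \<phi>" by blast
  \<comment> \<open>One order for all components, so that the loss of powers of
    \<open>\<tau>\<close> stays the same throughout the induction.\<close>
  define N where "N = (\<Sum>k\<in>UNIV. snd (CN k))"
  have N: "snd (CN k) \<le> N" for k
    unfolding N_def by (rule member_le_sum) simp_all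
  \<comment> \<open>The exponent \<open>p\<close> on the left is arbitrary while the loss on the
    right stays at \<open>N\<close>; this is what yields decay of any order in the end.\<close>
  have claim: "\<exists>h\<in>poly_growth. (\<forall>\<xi>. 0 \<le> h \<xi>) \<and>
      (\<forall>\<tau>\<in>\<int>. \<forall>\<xi>. cmod (Z k g \<tau> \<xi>) * (1 + \<bar>\<tau>\<bar>) ^ p \<le> h \<xi> * (1 + \<bar>\<tau>\<bar>) ^ N)"
    if "torus_smooth g" for g k p
    using that
  proof (induction p arbitrary: g k)
    case (0 g k)
    obtain D where D: "0 \<le> D" "\<And>f. torus_smooth f \<Longrightarrow>
        test_seminorm N (\<lambda>x::real \<times> (real ^ 'n). g (fst x) * f x) \<le> D * test_seminorm N f"
      by (rule test_seminorm_mult[OF torus_smooth_fst[OF 0]]) blast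
    define K where "K = real (card {bs. set bs \<subseteq> (Basis :: (real \<times> (real ^ 'n)) set) \<and> length bs \<le> N})"
    let ?c = "(2 * pi) ^ CARD('n)"
    let ?C = "fst (CN k) * D * K / ?c"
    have K: "0 \<le> K" by (simp add: K_def)
    show ?case
    proof (intro bexI[of _ "\<lambda>\<xi>. ?C * wt \<xi> ^ N"] conjI allI ballI)
      show "(\<lambda>\<xi>. ?C * wt \<xi> ^ N) \<in> poly_growth" by (rule poly_growthI) (rule order_refl)
      show "0 \<le> ?C * wt \<xi> ^ N" for \<xi> :: "int ^ 'n" using CN(1) D(1) K by simp
      fix \<tau> :: real and \<xi> :: "int ^ 'n" assume \<tau>: "\<tau> \<in> \<int>"
      let ?e = "torus_char (\<tau>, - zvec \<xi>)"
      note L = mode_lattice[OF \<tau>, of \<xi>]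
      have e: "torus_smooth ?e" by (rule torus_smooth_char[OF L])
      have m: "mode (\<lambda>t. g t * torus_char \<tau> t) \<xi> = (\<lambda>p. g (fst p) * ?e p)"
        by (rule ext) (auto simp: mode_def torus_char_prod torus_char_def cis_mult)
      have s: "torus_smooth (\<lambda>p::real \<times> (real ^ 'n). g (fst p) * ?e p)"
        by (rule torus_smooth_mult[OF torus_smooth_fst[OF 0] e])
      have "cmod (u k (\<lambda>p. g (fst p) * ?e p)) \<le> fst (CN k) * test_seminorm (snd (CN k)) (\<lambda>p. g (fst p) * ?e p)"
        by (rule CN(2)[OF s])
      also have "\<dots> \<le> fst (CN k) * (D * (K * ((1 + \<bar>\<tau>\<bar>) * wt \<xi>) ^ N))"
      proof (rule mult_left_mono[OF _ CN(1)])
        have "test_seminorm (snd (CN k)) (\<lambda>p. g (fst p) * ?e p) \<le> D * test_seminorm N ?e"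
          by (rule order_trans[OF test_seminorm_mono[OF s N] D(2)[OF e]])
        also have "test_seminorm N ?e \<le> K * (1 + norm (\<tau>, - zvec \<xi>)) ^ N"
          unfolding K_def by (rule test_seminorm_leI) (rule iter_partial_char_le[OF L])
        also have "\<dots> \<le> K * ((1 + \<bar>\<tau>\<bar>) * wt \<xi>) ^ N"
          by (intro mult_left_mono power_mono norm_prod_le_wt K) simp
        finally show "test_seminorm (snd (CN k)) (\<lambda>p. g (fst p) * ?e p) \<le> D * (K * ((1 + \<bar>\<tau>\<bar>) * wt \<xi>) ^ N)"
          using D(1) by (simp add: mult_left_mono)
      qed
      finally have "cmod (u k (\<lambda>p. g (fst p) * ?e p)) \<le> fst (CN k) * D * K * wt \<xi> ^ N * (1 + \<bar>\<tau>\<bar>) ^ N"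
        by (simp add: power_mult_distrib ac_simps)
      from divide_right_mono[OF this, of ?c]
      show "cmod (Z k g \<tau> \<xi>) * (1 + \<bar>\<tau>\<bar>) ^ 0 \<le> ?C * wt \<xi> ^ N * (1 + \<bar>\<tau>\<bar>) ^ N"
        by (simp add: Z_def partial_fourier_mode m norm_divide norm_mult norm_power)
    qed
  next
    case (Suc p g j)
    let ?F = "system_op c q u j"
    have "rapid (\<lambda>z. distr_mult g ?F (torus_char z))"
      using smooth_distribution_iff_rapid[OF smooth_imp_torus_distribution] smooth_distribution_mult[OF P Suc.prems] by blast
    then obtain C0 where C0: "\<And>z. z \<in> torus_lattice \<Longrightarrow> cmod (distr_mult g ?F (torus_char z)) * (1 + norm z) ^ p \<le> C0"
      unfolding rapid_def by blast
    obtain h1 where h1: "h1 \<in> poly_growth" "\<And>\<xi>. 0 \<le> h1 \<xi>"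
      "\<And>\<tau> \<xi>. \<tau> \<in> \<int> \<Longrightarrow> cmod (Z j g \<tau> \<xi>) * (1 + \<bar>\<tau>\<bar>) ^ p \<le> h1 \<xi> * (1 + \<bar>\<tau>\<bar>) ^ N"
      using Suc.IH[OF Suc.prems, of j] by blast
    obtain h2 where h2: "h2 \<in> poly_growth" "\<And>\<xi>. 0 \<le> h2 \<xi>"
      "\<And>\<tau> \<xi>. \<tau> \<in> \<int> \<Longrightarrow> cmod (Z j (D_t g) \<tau> \<xi>) * (1 + \<bar>\<tau>\<bar>) ^ p \<le> h2 \<xi> * (1 + \<bar>\<tau>\<bar>) ^ N"
      using Suc.IH[OF torus_smooth_D_t[OF Suc.prems], of j] by blast
    have "\<forall>k. \<exists>h. h \<in> poly_growth \<and> (\<forall>\<xi>. 0 \<le> h \<xi>) \<and>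
      (\<forall>\<tau>\<in>\<int>. \<forall>\<xi>. cmod (Z k (\<lambda>t. c j k t * g t) \<tau> \<xi>) * (1 + \<bar>\<tau>\<bar>) ^ p \<le> h \<xi> * (1 + \<bar>\<tau>\<bar>) ^ N)"
      using Suc.IH[OF torus_smooth_mult[OF c Suc.prems]] by blast
    from choice[OF this] obtain h3 where h3: "\<And>k. h3 k \<in> poly_growth" "\<And>k \<xi>. 0 \<le> h3 k \<xi>"
      "\<And>k \<tau> \<xi>. \<tau> \<in> \<int> \<Longrightarrow> cmod (Z k (\<lambda>t. c j k t * g t) \<tau> \<xi>) * (1 + \<bar>\<tau>\<bar>) ^ p \<le> h3 k \<xi> * (1 + \<bar>\<tau>\<bar>) ^ N"
      by blast
    \<comment> \<open>\<open>h1\<close> pays for the summand 1 in the new factor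
      \<open>1 + \<bar>\<tau>\<bar>\<close>; the other terms bound \<tau> times the coefficient by
      means of the equation.\<close>
    define H where "H \<xi> = h1 \<xi> + (\<bar>C0\<bar> + (h2 \<xi> + (\<Sum>k\<in>UNIV. h3 k \<xi> * cmod (q j k \<xi>))))" for \<xi>
    have q': "(\<lambda>\<xi>. cmod (q j k \<xi>)) \<in> poly_growth" for k
      by (rule pdo_symbol_wt[OF q[of j k]]) (blast intro: poly_growthI)
    note T = growth_ideal_poly
    show ?case
    proof (intro bexI[of _ H] conjI allI ballI)
      show "H \<in> poly_growth"
        unfolding H_def[abs_def]
        by (intro growth_ideal_add[OF T] growth_ideal_sum[OF T] growth_ideal_mult[OF T] h1 h2 h3 q' poly_growth_const norm_ge_zero)
      show "0 \<le> H \<xi>" for \<xi>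
        unfolding H_def by (intro add_nonneg_nonneg sum_nonneg mult_nonneg_nonneg h1 h2 h3) simp_all
      fix \<tau> :: real and \<xi> :: "int ^ 'n" assume \<tau>: "\<tau> \<in> \<int>"
      let ?W = "(1 + \<bar>\<tau>\<bar>) ^ p" and ?V = "(1 + \<bar>\<tau>\<bar>) ^ N"
      have V: "1 \<le> ?V" by (rule one_le_power) simp
      have e: "torus_smooth (torus_char \<tau>)" using \<tau> by (intro torus_smooth_char) (simp add: torus_lattice_real)
      note ge = torus_smooth_mult[OF Suc.prems e]
      let ?pF = "partial_fourier ?F \<xi> (\<lambda>t. g t * torus_char \<tau> t)"
      have "partial_fourier (u j) \<xi> (D_t (\<lambda>t. g t * torus_char \<tau> t)) = 1 * Z j (D_t g) \<tau> \<xi> + of_real \<tau> * Z j g \<tau> \<xi>"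
        unfolding D_t_mult_char[OF Suc.prems \<tau>] Z_def
        by (intro torus_distribution_lincomb torus_distribution_partial_fourier u torus_smooth_mult torus_smooth_D_t Suc.prems e)
      then have eq: "of_real \<tau> * Z j g \<tau> \<xi> =
          - ?pF + (- Z j (D_t g) \<tau> \<xi> + (\<Sum>k\<in>UNIV. q j k \<xi> * Z k (\<lambda>t. c j k t * g t) \<tau> \<xi>))"
        unfolding partial_fourier_system_op[OF u c q ge] by (simp add: Z_def mult.assoc)
      have pF: "cmod ?pF * ?W \<le> \<bar>C0\<bar>"
      proof -
        let ?c = "(2 * pi) ^ CARD('n)"
        have "1 \<le> ?c" using pi_gt3 by (intro one_le_power) simp
        have m: "mode (\<lambda>t. g t * torus_char \<tau> t) \<xi> = (\<lambda>(t, x). g t * torus_char (\<tau>, - zvec \<xi>) (t, x))"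
          by (rule ext) (auto simp: mode_def torus_char_prod torus_char_def cis_mult)
        have "cmod ?pF = cmod (distr_mult g ?F (torus_char (\<tau>, - zvec \<xi>))) / ?c"
          unfolding partial_fourier_mode m distr_mult_def by (simp add: norm_divide norm_mult norm_power)
        also have "\<dots> \<le> cmod (distr_mult g ?F (torus_char (\<tau>, - zvec \<xi>))) / 1"
          using \<open>1 \<le> ?c\<close> by (intro divide_left_mono) simp_all
        finally have "cmod ?pF * ?W \<le> cmod (distr_mult g ?F (torus_char (\<tau>, - zvec \<xi>))) * (1 + norm (\<tau>, - zvec \<xi>)) ^ p"
          using abs_le_norm_prod(1)[of \<tau> "- zvec \<xi>"] by (intro mult_mono power_mono) simp_all
        also have "\<dots> \<le> C0" by (rule C0[OF mode_lattice[OF \<tau>]])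
        finally show ?thesis by simp
      qed
      have "\<bar>\<tau>\<bar> * cmod (Z j g \<tau> \<xi>) = cmod (of_real \<tau> * Z j g \<tau> \<xi>)" by (simp add: norm_mult)
      also have "\<dots> \<le> cmod ?pF + (cmod (Z j (D_t g) \<tau> \<xi>) + (\<Sum>k\<in>UNIV. cmod (q j k \<xi>) * cmod (Z k (\<lambda>t. c j k t * g t) \<tau> \<xi>)))"
        unfolding eq norm_mult[symmetric]
        by (intro norm_triangle_le add_mono norm_sum) simp_all
      finally have "\<bar>\<tau>\<bar> * cmod (Z j g \<tau> \<xi>) * ?W \<le>
          (cmod ?pF + (cmod (Z j (D_t g) \<tau> \<xi>) + (\<Sum>k\<in>UNIV. cmod (q j k \<xi>) * cmod (Z k (\<lambda>t. c j k t * g t) \<tau> \<xi>)))) * ?W"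
        by (rule mult_right_mono) simp
      also have "\<dots> = cmod ?pF * ?W + (cmod (Z j (D_t g) \<tau> \<xi>) * ?W +
          (\<Sum>k\<in>UNIV. cmod (q j k \<xi>) * (cmod (Z k (\<lambda>t. c j k t * g t) \<tau> \<xi>) * ?W)))"
        by (simp add: distrib_right sum_distrib_right mult.assoc)
      also have "\<dots> \<le> \<bar>C0\<bar> * ?V + (h2 \<xi> * ?V + (\<Sum>k\<in>UNIV. cmod (q j k \<xi>) * (h3 k \<xi> * ?V)))"
      proof (intro add_mono sum_mono mult_left_mono h2 h3 \<tau>)
        show "cmod ?pF * ?W \<le> \<bar>C0\<bar> * ?V"
          using pF mult_left_mono[OF V abs_ge_zero[of C0]] by simp
      qed simp_all
      finally have 1: "\<bar>\<tau>\<bar> * cmod (Z j g \<tau> \<xi>) * ?W \<le> \<bar>C0\<bar> * ?V + (h2 \<xi> * ?V + (\<Sum>k\<in>UNIV. cmod (q j k \<xi>) * (h3 k \<xi> * ?V)))" .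
      have "cmod (Z j g \<tau> \<xi>) * (1 + \<bar>\<tau>\<bar>) ^ Suc p = cmod (Z j g \<tau> \<xi>) * ?W + \<bar>\<tau>\<bar> * cmod (Z j g \<tau> \<xi>) * ?W"
        by (simp add: algebra_simps)
      also have "\<dots> \<le> h1 \<xi> * ?V + (\<bar>C0\<bar> * ?V + (h2 \<xi> * ?V + (\<Sum>k\<in>UNIV. cmod (q j k \<xi>) * (h3 k \<xi> * ?V))))"
        by (intro add_mono h1 \<tau> 1)
      also have "\<dots> = H \<xi> * ?V" by (simp add: H_def distrib_left sum_distrib_left ac_simps)
      finally show "cmod (Z j g \<tau> \<xi>) * (1 + \<bar>\<tau>\<bar>) ^ Suc p \<le> H \<xi> * ?V" .
    qed
  qed
  \<comment> \<open>Asking for \<open>N + p\<close> powers in place of \<open>p\<close> cancels the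
    fixed loss.\<close>
  from claim[OF torus_smooth_const[of 1], of k "N + p"] obtain h where h: "h \<in> poly_growth"
    "\<And>\<tau> \<xi>. \<tau> \<in> \<int> \<Longrightarrow> cmod (Z k (\<lambda>_. 1) \<tau> \<xi>) * (1 + \<bar>\<tau>\<bar>) ^ (N + p) \<le> h \<xi> * (1 + \<bar>\<tau>\<bar>) ^ N" by blast
  have "cmod (partial_fourier (u k) \<xi> (torus_char \<tau>)) * (1 + \<bar>\<tau>\<bar>) ^ p \<le> h \<xi>" if \<tau>: "\<tau> \<in> \<int>" for \<xi> \<tau>
  proof -
    have "0 < (1 + \<bar>\<tau>\<bar>) ^ N" by (intro zero_less_power add_pos_nonneg) auto
    moreover have "(cmod (partial_fourier (u k) \<xi> (torus_char \<tau>)) * (1 + \<bar>\<tau>\<bar>) ^ p) * (1 + \<bar>\<tau>\<bar>) ^ N \<le> h \<xi> * (1 + \<bar>\<tau>\<bar>) ^ N"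
      using h(2)[OF \<tau>, of \<xi>] by (simp add: Z_def power_add ac_simps)
    ultimately show ?thesis by (simp only: mult_le_cancel_right_pos)
  qed
  with h(1) show thesis by (rule that)
qed

text \<open>For each \<open>\<xi>\<close>, decay in \<open>\<tau>\<close> of every order makes the
  partial coefficient a smooth function of \<open>t\<close>. The majorants in that decay are
  polynomial in \<open>\<xi>\<close>, and two extra powers of \<open>\<tau>\<close> convert them
  into bounds on the derivatives.\<close>

lemma solution_family:
  fixes c :: "'m::finite \<Rightarrow> 'm \<Rightarrow> real \<Rightarrow> complex" and u :: "'m \<Rightarrow> 'n::finite distr"
  assumes u: "\<And>k. torus_distribution (u k)" and c: "\<And>j k. torus_smooth (c j k)" and q: "\<And>j k. pdo_symbol (q j k)"
    and P: "\<And>j. smooth_distribution (system_op c q u j)"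
  obtains w where "family poly_growth w" "represents (u k) w"
proof -
  have "\<exists>f. torus_smooth f \<and> (\<forall>\<psi>. torus_smooth \<psi> \<longrightarrow> partial_fourier (u k) \<xi> \<psi> = integral torus_cell (\<lambda>t. f t * \<psi> t))" for \<xi>
  proof -
    have "rapid (\<lambda>\<tau>. partial_fourier (u k) \<xi> (torus_char \<tau>))"
      unfolding rapid_def
    proof
      fix p
      obtain h where "\<And>\<xi> \<tau>. \<tau> \<in> \<int> \<Longrightarrow> cmod (partial_fourier (u k) \<xi> (torus_char \<tau>)) * (1 + \<bar>\<tau>\<bar>) ^ p \<le> h \<xi>"
        by (rule regularity_in_t[OF u c q P, of k p]) blast
      then show "\<exists>C. \<forall>\<tau>\<in>torus_lattice. cmod (partial_fourier (u k) \<xi> (torus_char \<tau>)) * (1 + norm \<tau>) ^ p \<le> C"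
        by (intro exI[of _ "h \<xi>"]) (simp add: torus_lattice_real)
    qed
    then have "smooth_distribution (partial_fourier (u k) \<xi>)"
      using smooth_distribution_iff_rapid[OF torus_distribution_partial_fourier[OF u]] by blast
    then show ?thesis unfolding smooth_distribution_def by blast
  qed
  then have "\<forall>\<xi>. \<exists>f. torus_smooth f \<and> (\<forall>\<psi>. torus_smooth \<psi> \<longrightarrow> partial_fourier (u k) \<xi> \<psi> = integral torus_cell (\<lambda>t. f t * \<psi> t))"
    by blast
  from choice[OF this] obtain w where w: "\<And>\<xi>. torus_smooth (w \<xi>)"
    "\<And>\<xi> \<psi>. torus_smooth \<psi> \<Longrightarrow> partial_fourier (u k) \<xi> \<psi> = integral torus_cell (\<lambda>t. w \<xi> t * \<psi> t)" by blast
  have "family poly_growth w"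
    unfolding family_def
  proof (intro conjI allI w(1))
    fix \<alpha>
    obtain h where h: "h \<in> poly_growth" "\<And>\<xi> \<tau>. \<tau> \<in> \<int> \<Longrightarrow>
        cmod (partial_fourier (u k) \<xi> (torus_char \<tau>)) * (1 + \<bar>\<tau>\<bar>) ^ (\<alpha> + 2) \<le> h \<xi>"
      by (rule regularity_in_t[OF u c q P, of k "\<alpha> + 2"]) blast
    have h0: "0 \<le> h \<xi>" for \<xi>
      by (rule order_trans[OF _ h(2)[of 0]]) simp_all
    have "cmod (fcoef (w \<xi>) \<tau>) * (1 + norm \<tau>) ^ (\<alpha> + 2) \<le> h \<xi>" if "\<tau> \<in> torus_lattice" for \<xi> \<tau>
    proof -
      have \<tau>: "- \<tau> \<in> \<int>" using that by (simp add: torus_lattice_real)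
      then have "torus_smooth (torus_char (- \<tau>))" by (intro torus_smooth_char) (simp add: torus_lattice_real)
      from w(2)[OF this, of \<xi>]
      have "cmod (partial_fourier (u k) \<xi> (torus_char (- \<tau>))) = 2 * pi * cmod (fcoef (w \<xi>) \<tau>)"
        unfolding integral_mult_char by (simp add: norm_mult)
      then have "cmod (fcoef (w \<xi>) \<tau>) \<le> cmod (partial_fourier (u k) \<xi> (torus_char (- \<tau>)))"
        using pi_gt3 by (simp add: mult_le_cancel_right1)
      then have "cmod (fcoef (w \<xi>) \<tau>) * (1 + norm \<tau>) ^ (\<alpha> + 2) \<le>
          cmod (partial_fourier (u k) \<xi> (torus_char (- \<tau>))) * (1 + \<bar>- \<tau>\<bar>) ^ (\<alpha> + 2)"
        by (intro mult_mono) simp_all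
      also have "\<dots> \<le> h \<xi>" by (rule h(2)[OF \<tau>])
      finally show ?thesis .
    qed
    from t_deriv_le_fcoef[OF w(1) this]
    have le: "cmod (t_deriv \<alpha> (w \<xi>) t) \<le> h \<xi> * lattice_mass" for \<xi> t .
    have "0 \<le> lattice_mass" unfolding lattice_mass_def by (rule infsum_nonneg) simp
    then have "(\<lambda>\<xi>. h \<xi> * lattice_mass) \<in> poly_growth"
      by (intro growth_ideal_mult[OF growth_ideal_poly] h(1) poly_growth_const h0)
    from dominatedI[OF this le] show "dominated poly_growth (\<lambda>\<xi>. t_deriv \<alpha> (w \<xi>))" .
  qed
  moreover have "represents (u k) w" unfolding represents_def using w(2) by blast
  ultimately show thesis by (rule that)
qed

definition family_hypoelliptic ::
    "('m::finite \<Rightarrow> 'm \<Rightarrow> real \<Rightarrow> complex) \<Rightarrow> ('m \<Rightarrow> 'm \<Rightarrow> int ^ 'n::finite \<Rightarrow> complex) \<Rightarrow> bool" where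
  "family_hypoelliptic c q \<longleftrightarrow> (\<forall>w. (\<forall>k. family poly_growth (w k)) \<longrightarrow>
     (\<forall>j. family rapid_decay (system_family c q w j)) \<longrightarrow> (\<forall>k. family rapid_decay (w k)))"

text \<open>Every polynomial family comes from distributions, and distributions with a smooth image
  under the system come from such a family by regularity in \<open>t\<close>. Under this
  correspondence smoothness is rapid decay.\<close>

theorem globally_hypoelliptic_iff_family:
  fixes c :: "'m::finite \<Rightarrow> 'm \<Rightarrow> real \<Rightarrow> complex" and q :: "'m \<Rightarrow> 'm \<Rightarrow> int ^ 'n::finite \<Rightarrow> complex"
  assumes c: "\<And>j k. torus_smooth (c j k)" and q: "\<And>j k. pdo_symbol (q j k)"
  shows "globally_hypoelliptic (system_op c q) \<longleftrightarrow> family_hypoelliptic c q"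
proof
  assume GH: "globally_hypoelliptic (system_op c q)"
  show "family_hypoelliptic c q"
    unfolding family_hypoelliptic_def
  proof (intro allI impI)
    fix w and k :: 'm assume w: "\<forall>k. family poly_growth (w k)" and Lw: "\<forall>j. family rapid_decay (system_family c q w j)"
    have "\<forall>k. \<exists>u. torus_distribution u \<and> represents u (w k)"
      using poly_family_distribution[OF spec[OF w]] by blast
    from choice[OF this] obtain u where u: "\<And>k. torus_distribution (u k)" "\<And>k. represents (u k) (w k)" by blast
    have ws: "torus_smooth (w k \<xi>)" for k \<xi> by (rule family_smooth[OF spec[OF w]])
    have "smooth_distribution (system_op c q u j)" for j
      by (rule rapid_family_imp_smooth_distribution[OF torus_distribution_system_op[OF u(1) c q] spec[OF Lw]
            represents_system_op[OF u(1) c q ws u(2)]])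
    then have "smooth_distribution (u k)" using GH u(1) unfolding globally_hypoelliptic_def by blast
    then show "family rapid_decay (w k)" by (rule smooth_distribution_imp_rapid_family[OF _ ws u(2)])
  qed
next
  assume FH: "family_hypoelliptic c q"
  show "globally_hypoelliptic (system_op c q)"
    unfolding globally_hypoelliptic_def
  proof (intro allI impI)
    fix u :: "'m \<Rightarrow> 'n distr" and k assume u: "\<forall>k. torus_distribution (u k)"
      and P: "\<forall>k. smooth_distribution (system_op c q u k)"
    have "\<forall>k. \<exists>w. family poly_growth w \<and> represents (u k) w"
      using solution_family[OF spec[OF u] c q spec[OF P]] by metis
    from choice[OF this] obtain w where w: "\<And>k. family poly_growth (w k)" "\<And>k. represents (u k) (w k)" by blast
    have ws: "torus_smooth (w k \<xi>)" for k \<xi> by (rule family_smooth[OF w(1)])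
    have "family rapid_decay (system_family c q w j)" for j
      by (rule smooth_distribution_imp_rapid_family[OF spec[OF P] torus_smooth_system_family[OF ws c]
            represents_system_op[OF spec[OF u] c q ws w(2)]])
    then have "family rapid_decay (w k)" using FH w(1) unfolding family_hypoelliptic_def by blast
    then show "smooth_distribution (u k)"
      by (rule rapid_family_imp_smooth_distribution[OF spec[OF u] _ w(2)])
  qed
qed

subsection \<open>First order equations on the circle\<close>

lemma antiderivative_real:
  fixes f :: "real \<Rightarrow> complex"
  assumes "continuous_on UNIV f"
  obtains F where "\<And>x. (F has_vector_derivative f x) (at x)"
proof -
  have c: "isCont f x" for x
    using assms by (simp add: continuous_on_eq_continuous_at)
  have "\<exists>F. \<forall>x::real. - \<infinity> < ereal x \<longrightarrow> ereal x < \<infinity> \<longrightarrow> (F has_vector_derivative f x) (at x)"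
    by (rule einterval_antiderivative) (use c in auto)
  then show thesis using that by auto
qed

text \<open>The right-hand side is as smooth as \<open>v\<close>, so each order of differentiability
  yields the next.\<close>

lemma C_diff_ode:
  fixes v g h :: "real \<Rightarrow> complex"
  assumes v: "\<And>t. (v has_vector_derivative g t + v t * h t) (at t)"
    and g: "\<And>k. C_diff k g" and h: "\<And>k. C_diff k h"
  shows "C_diff k v"
proof (induction k)
  case 0
  show ?case
    using v by (auto simp: continuous_on_eq_continuous_at intro: has_vector_derivative_continuous)
next
  case (Suc k)
  show ?case
  proof (rule C_diff_Suc_has_derivativeI)
    show "(v has_derivative (\<lambda>r. of_real r * (g t + v t * h t))) (at t)" for t
      using v[of t] by (simp add: has_vector_derivative_def scaleR_conv_of_real)
    show "C_diff k (\<lambda>x. of_real r * (g x + v x * h x))" for r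
      by (intro C_diff_mult C_diff_add C_diff_const g h Suc)
  qed
qed

lemma torus_smooth_ode:
  fixes v g h :: "real \<Rightarrow> complex"
  assumes "\<And>t. (v has_vector_derivative g t + v t * h t) (at t)"
    and "torus_smooth g" "torus_smooth h" and "\<And>t. v (t + 2 * pi) = v t"
  shows "torus_smooth v"
  using C_diff_ode[OF assms(1)] assms(2-) unfolding torus_smooth_def by simp

lemma constant_of_zero_derivative:
  fixes f :: "real \<Rightarrow> complex"
  assumes "\<And>t. (f has_vector_derivative 0) (at t)"
  shows "f s = f t"
proof -
  obtain c where "\<And>x. x \<in> UNIV \<Longrightarrow> f x = c"
    by (rule has_vector_derivative_zero_constant[of UNIV f]) (use assms in auto)
  then show ?thesis by simp
qed

lemma shifted_derivative:
  fixes f :: "real \<Rightarrow> complex"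
  assumes "\<And>t. (f has_vector_derivative f' t) (at t)"
  shows "((\<lambda>t. f (t + c)) has_vector_derivative f' (t + c)) (at t)"
proof -
  have "((f \<circ> (\<lambda>t. t + c)) has_vector_derivative 1 *\<^sub>R f' (t + c)) (at t)"
    by (rule vector_diff_chain_at) (auto intro!: derivative_eq_intros assms)
  then show ?thesis by (simp add: o_def)
qed

text \<open>The increment of a primitive over one period has zero derivative, so it equals its value
  over the base period.\<close>

lemma primitive_mean:
  fixes \<kappa> :: "real \<Rightarrow> complex"
  assumes \<kappa>: "torus_smooth \<kappa>"
  obtains L where "\<And>t. (L has_vector_derivative \<kappa> t) (at t)"
    "\<And>t. L (t + 2 * pi) = L t + integral {0..2 * pi} \<kappa>"
proof -
  obtain L where L: "\<And>t. (L has_vector_derivative \<kappa> t) (at t)" by (rule antiderivative_real[OF torus_smooth_continuous[OF \<kappa>]]) blast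
  have "((\<lambda>t. L (t + 2 * pi) - L t) has_vector_derivative \<kappa> (t + 2 * pi) - \<kappa> t) (at t)" for t
    by (intro has_vector_derivative_diff shifted_derivative L)
  then have "((\<lambda>t. L (t + 2 * pi) - L t) has_vector_derivative 0) (at t)" for t
    by (simp add: torus_smooth_real_periodic[OF \<kappa>])
  from constant_of_zero_derivative[OF this] have "L (t + 2 * pi) - L t = L (0 + 2 * pi) - L 0" for t .
  moreover have "(\<kappa> has_integral (L (2 * pi) - L 0)) {0..2 * pi}"
    by (rule fundamental_theorem_of_calculus) (use L in \<open>auto intro: has_vector_derivative_at_within\<close>)
  then have "integral {0..2 * pi} \<kappa> = L (2 * pi) - L 0" by (rule integral_unique)
  ultimately have "L (t + 2 * pi) - L t = integral {0..2 * pi} \<kappa>" for t by simp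
  then have "L (t + 2 * pi) = L t + integral {0..2 * pi} \<kappa>" for t by (simp add: diff_eq_eq add.commute)
  with L show thesis by (rule that)
qed

lemma exp_primitive_derivative:
  fixes L :: "real \<Rightarrow> complex"
  assumes "(L has_vector_derivative l) (at t)"
  shows "((\<lambda>t. exp (c * L t)) has_vector_derivative exp (c * L t) * (c * l)) (at t)"
proof -
  have "((\<lambda>t. c * L t) has_vector_derivative c * l) (at t)"
    by (intro has_vector_derivative_mult_right assms)
  from field_vector_diff_chain_at[OF this DERIV_exp] show ?thesis by (simp add: o_def mult.commute)
qed

text \<open>If the coefficient has mean \<open>m\<close> and primitive \<open>L\<close>, then
  \<open>exp (\<i> * L t)\<close> is multiplied by \<open>gap m + 1\<close> over one period. The gap
  vanishes exactly when \<open>m\<close> is an integer, that is, when the homogeneous equation has a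
  non-zero periodic solution.\<close>

definition gap :: "complex \<Rightarrow> complex" where
  "gap m = exp (2 * of_real pi * \<i> * m) - 1"

lemma D_t_has_vector_derivative:
  assumes "torus_smooth v" "D_t v t + l * v t = f"
  shows "(v has_vector_derivative \<i> * f + v t * (- \<i> * l)) (at t)"
proof -
  have "vector_derivative v (at t) = \<i> * D_t v t" by (simp add: D_t_def)
  also have "D_t v t = f - l * v t" using assms(2) by (simp add: eq_diff_eq)
  finally have "vector_derivative v (at t) = \<i> * f + v t * (- \<i> * l)" by (simp add: algebra_simps)
  then show ?thesis using torus_smooth_has_vector_derivative[OF assms(1), of t] by simp
qed

lemma has_vector_derivative_D_t:
  assumes "(v has_vector_derivative \<i> * f + v t * (- \<i> * l)) (at t)"
  shows "D_t v t + l * v t = f"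
  unfolding D_t_def vector_derivative_at[OF assms] by (simp add: algebra_simps)

text \<open>With \<open>E = exp (\<i> \<integral>\<kappa>)\<close> the equation reads \<open>(v E)' = \<i> f E\<close>. Integrating forward from \<open>t\<close> to
  \<open>t + 2\<pi>\<close>, the lower bound on \<open>Im \<kappa>\<close> bounds \<open>\<bar>E s / E t\<bar>\<close> from above.\<close>

lemma circle_ode_bound:
  fixes v f \<kappa> :: "real \<Rightarrow> complex"
  assumes \<kappa>: "torus_smooth \<kappa>" and v: "torus_smooth v"
    and eq: "\<And>t. D_t v t + \<kappa> t * v t = f t"
    and B: "\<And>t. cmod (f t) \<le> B" and \<theta>: "0 \<le> \<theta>" "\<And>t. Im (\<kappa> t) \<ge> - \<theta>"
  shows "cmod (gap (integral {0..2 * pi} \<kappa> / (2 * of_real pi))) * cmod (v t) \<le> B * (exp (2 * pi * \<theta>) * (2 * pi))"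
proof -
  obtain L where L: "\<And>t. (L has_vector_derivative \<kappa> t) (at t)"
    and L2: "\<And>t. L (t + 2 * pi) = L t + integral {0..2 * pi} \<kappa>" by (rule primitive_mean[OF \<kappa>]) blast
  define E where "E t = exp (\<i> * L t)" for t
  let ?gap = "gap (integral {0..2 * pi} \<kappa> / (2 * of_real pi))"
  have E': "(E has_vector_derivative E t * (\<i> * \<kappa> t)) (at t)" for t
    unfolding E_def[abs_def] by (rule exp_primitive_derivative[OF L])
  have E2: "E (t + 2 * pi) = E t * (?gap + 1)"
    by (simp add: E_def gap_def L2 distrib_left exp_add)
  have B0: "0 \<le> B" by (rule order_trans[OF norm_ge_zero B])
  have vE: "((\<lambda>t. v t * E t) has_vector_derivative \<i> * f s * E s) (at s)" for s
  proof -
    have "((\<lambda>t. v t * E t) has_vector_derivative v s * (E s * (\<i> * \<kappa> s)) + (\<i> * f s + v s * (- \<i> * \<kappa> s)) * E s) (at s)"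
      by (intro has_vector_derivative_mult E' D_t_has_vector_derivative v eq)
    then show ?thesis by (simp add: algebra_simps)
  qed
  \<comment> \<open>Adding \<open>\<theta> * t\<close> makes the imaginary part of the primitive
    non-decreasing, which turns the one-sided bound on \<open>\<kappa>\<close> into a bound on the
    growth of \<open>E\<close> over one period.\<close>
  have mono: "cmod (E s) \<le> exp (2 * pi * \<theta>) * cmod (E t)" if s: "t \<le> s" "s \<le> t + 2 * pi" for s
  proof -
    have "Im (L t) + \<theta> * t \<le> Im (L s) + \<theta> * s"
    proof (rule DERIV_nonneg_imp_nondecreasing[OF s(1)])
      fix x
      have "((\<lambda>t. Im (L t)) has_real_derivative Im (\<kappa> x)) (at x)"
        unfolding has_real_derivative_iff_has_vector_derivative
        by (rule bounded_linear.has_vector_derivative[OF bounded_linear_Im L])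
      then have "((\<lambda>t. Im (L t) + \<theta> * t) has_real_derivative Im (\<kappa> x) + \<theta>) (at x)"
        by (rule DERIV_add[OF _ DERIV_cmult_Id])
      moreover have "0 \<le> Im (\<kappa> x) + \<theta>" using \<theta>(2)[of x] by simp
      ultimately show "\<exists>y. ((\<lambda>t. Im (L t) + \<theta> * t) has_real_derivative y) (at x) \<and> 0 \<le> y" by blast
    qed
    moreover have "\<theta> * s \<le> \<theta> * (t + 2 * pi)" by (rule mult_left_mono[OF s(2) \<theta>(1)])
    ultimately have "- Im (L s) \<le> 2 * pi * \<theta> + - Im (L t)" by (simp add: algebra_simps)
    then have "exp (- Im (L s)) \<le> exp (2 * pi * \<theta>) * exp (- Im (L t))" unfolding exp_add[symmetric] by simp
    then show ?thesis by (simp add: E_def)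
  qed
  \<comment> \<open>The mean value inequality over one period; by periodicity of \<open>v\<close>
    the increment of the product of \<open>v\<close> and \<open>E\<close> is the gap times its value
    at \<open>t\<close>.\<close>
  have "\<exists>x\<in>{t<..<t + 2 * pi}. norm (v (t + 2 * pi) * E (t + 2 * pi) - v t * E t) \<le> norm ((t + 2 * pi - t) *\<^sub>R (\<i> * f x * E x))"
    by (rule mvt_general[where f = "\<lambda>t. v t * E t" and f' = "\<lambda>x h. h *\<^sub>R (\<i> * f x * E x)"])
      (use vE in \<open>auto simp: has_vector_derivative_def[symmetric] intro!: continuous_at_imp_continuous_on has_vector_derivative_continuous\<close>)
  then obtain x where x: "t < x" "x < t + 2 * pi"
    and le: "norm (v (t + 2 * pi) * E (t + 2 * pi) - v t * E t) \<le> norm ((t + 2 * pi - t) *\<^sub>R (\<i> * f x * E x))" by auto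
  have "v (t + 2 * pi) * E (t + 2 * pi) - v t * E t = ?gap * v t * E t"
    unfolding E2 torus_smooth_real_periodic[OF v] by (simp add: algebra_simps)
  then have "cmod ?gap * cmod (v t) * cmod (E t) \<le> 2 * pi * (cmod (f x) * cmod (E x))"
    using le by (simp add: norm_mult mult.assoc)
  also have "\<dots> \<le> 2 * pi * (B * (exp (2 * pi * \<theta>) * cmod (E t)))"
    using mono[of x] x B0 by (intro mult_left_mono mult_mono B) auto
  finally have "(cmod ?gap * cmod (v t)) * cmod (E t) \<le> (B * (exp (2 * pi * \<theta>) * (2 * pi))) * cmod (E t)"
    by (simp add: ac_simps)
  then show ?thesis by (simp add: E_def)
qed

text \<open>The solution is the integral of \<open>f * E\<close> over the period starting at
  \<open>t\<close>, times \<open>F = 1 / E\<close> and \<open>\<i> / D\<close>. The multiplier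
  \<open>D + 1\<close> cancels between the integral and \<open>F\<close>, which makes
  \<open>v\<close> periodic; differentiating the integral produces the factor \<open>D\<close> that
  the division removes.\<close>

lemma circle_ode_exists:
  fixes f \<kappa> :: "real \<Rightarrow> complex"
  assumes \<kappa>: "torus_smooth \<kappa>" and f: "torus_smooth f"
    and gap: "gap (integral {0..2 * pi} \<kappa> / (2 * of_real pi)) \<noteq> 0"
  obtains v where "torus_smooth v" "\<And>t. D_t v t + \<kappa> t * v t = f t"
proof -
  obtain L where L: "\<And>t. (L has_vector_derivative \<kappa> t) (at t)"
    and L2: "\<And>t. L (t + 2 * pi) = L t + integral {0..2 * pi} \<kappa>" by (rule primitive_mean[OF \<kappa>]) blast
  define E where "E t = exp (\<i> * L t)" for t
  define D where "D = gap (integral {0..2 * pi} \<kappa> / (2 * of_real pi))"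
  have D: "D \<noteq> 0" using gap by (simp add: D_def)
  have E2: "E (t + 2 * pi) = E t * (D + 1)" for t
    by (simp add: E_def D_def gap_def L2 distrib_left exp_add)
  have D1: "D + 1 \<noteq> 0" by (simp add: D_def gap_def)
  have E': "(E has_vector_derivative E t * (\<i> * \<kappa> t)) (at t)" for t
    unfolding E_def[abs_def] by (rule exp_primitive_derivative[OF L])
  define F where "F t = exp (- \<i> * L t)" for t
  have F': "(F has_vector_derivative F t * (- \<i> * \<kappa> t)) (at t)" for t
    unfolding F_def[abs_def] by (rule exp_primitive_derivative[OF L])
  have EF: "E t * F t = 1" for t by (simp add: E_def F_def exp_minus)
  have F2: "F (t + 2 * pi) * (D + 1) = F t" for t
  proof -
    have "F t = F t * (E (t + 2 * pi) * F (t + 2 * pi))" by (simp add: EF)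
    also have "\<dots> = (E t * F t) * (F (t + 2 * pi) * (D + 1))" unfolding E2 by (simp only: ac_simps)
    finally show ?thesis by (simp add: EF)
  qed
  have "continuous_on UNIV E"
    using E' by (auto simp: continuous_on_eq_continuous_at intro: has_vector_derivative_continuous)
  then have cont: "continuous_on UNIV (\<lambda>t. f t * E t)"
    by (rule continuous_on_mult[OF torus_smooth_continuous[OF f]])
  obtain G where G: "\<And>t. (G has_vector_derivative f t * E t) (at t)"
    by (rule antiderivative_real[OF cont]) blast
  \<comment> \<open>The primitive of \<open>f * E\<close> has the multiplier \<open>D + 1\<close>
    only up to an additive constant, which disappears in the difference \<open>K\<close>.\<close>
  have G2: "G (t + 2 * pi) = (D + 1) * G t + (G (2 * pi) - (D + 1) * G 0)" for t
  proof -
    have "((\<lambda>t. G (t + 2 * pi) - (D + 1) * G t) has_vector_derivative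
        f (s + 2 * pi) * E (s + 2 * pi) - (D + 1) * (f s * E s)) (at s)" for s
      by (intro has_vector_derivative_diff shifted_derivative G has_vector_derivative_mult_right)
    moreover have "f (s + 2 * pi) * E (s + 2 * pi) - (D + 1) * (f s * E s) = 0" for s
      unfolding E2 torus_smooth_real_periodic[OF f] by (simp add: algebra_simps)
    ultimately have "((\<lambda>t. G (t + 2 * pi) - (D + 1) * G t) has_vector_derivative 0) (at s)" for s
      by simp
    from constant_of_zero_derivative[OF this, of t 0] show ?thesis by (simp add: diff_eq_eq add.commute)
  qed
  define K where "K t = G (t + 2 * pi) - G t" for t
  have K': "(K has_vector_derivative D * (f t * E t)) (at t)" for t
  proof -
    have "(K has_vector_derivative f (t + 2 * pi) * E (t + 2 * pi) - f t * E t) (at t)"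
      unfolding K_def[abs_def] by (intro has_vector_derivative_diff shifted_derivative G)
    moreover have "f (t + 2 * pi) * E (t + 2 * pi) - f t * E t = D * (f t * E t)"
      unfolding E2 torus_smooth_real_periodic[OF f] by (simp add: algebra_simps)
    ultimately show ?thesis by simp
  qed
  have K2: "K (t + 2 * pi) = (D + 1) * K t" for t
    unfolding K_def G2[of "t + 2 * pi"] G2[of t] by (simp add: algebra_simps)
  define v where "v t = \<i> / D * (K t * F t)" for t
  have v': "(v has_vector_derivative \<i> * f t + v t * (- \<i> * \<kappa> t)) (at t)" for t
  proof -
    have "(v has_vector_derivative \<i> / D * (K t * (F t * (- \<i> * \<kappa> t)) + D * (f t * E t) * F t)) (at t)"
      unfolding v_def[abs_def] by (intro has_vector_derivative_mult_right has_vector_derivative_mult K' F')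
    also have "D * (f t * E t) * F t = D * f t" using EF[of t] by (simp add: mult.assoc)
    also have "\<i> / D * (K t * (F t * (- \<i> * \<kappa> t)) + D * f t) = \<i> * f t + v t * (- \<i> * \<kappa> t)"
      using D by (simp add: v_def field_simps)
    finally show ?thesis .
  qed
  have per: "v (t + 2 * pi) = v t" for t
  proof -
    have "K (t + 2 * pi) * F (t + 2 * pi) = K t * (F (t + 2 * pi) * (D + 1))"
      unfolding K2 by (simp only: ac_simps)
    then show ?thesis unfolding F2 by (simp only: v_def)
  qed
  show thesis
  proof
    show "torus_smooth v"
      by (rule torus_smooth_ode[OF v' torus_smooth_cmult[OF f] torus_smooth_cmult[OF \<kappa>] per])
    show "D_t v t + \<kappa> t * v t = f t" for t by (rule has_vector_derivative_D_t[OF v'])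
  qed
qed

text \<open>Subtracting \<open>\<mu>\<close> makes the mean an integer, so the exponential of the
  primitive is periodic and solves the shifted equation exactly. Its maximum is scaled to 1 so that
  a family of such solutions is bounded but cannot decay along the frequencies used.\<close>

lemma circle_approximate_kernel:
  fixes \<kappa> :: "real \<Rightarrow> complex"
  assumes \<kappa>: "torus_smooth \<kappa>"
    and \<mu>: "exp (2 * of_real pi * \<i> * \<mu>) = exp (2 * of_real pi * \<i> * (integral {0..2 * pi} \<kappa> / (2 * of_real pi)))"
  obtains v where "torus_smooth v" "\<And>t. D_t v t + \<kappa> t * v t = \<mu> * v t"
    "\<And>t. cmod (v t) \<le> 1" "\<exists>t. cmod (v t) = 1"
proof -
  have \<kappa>': "torus_smooth (\<lambda>t. \<kappa> t - \<mu>)" by (intro torus_smooth_diff \<kappa> torus_smooth_const)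
  obtain L where L: "\<And>t. (L has_vector_derivative \<kappa> t - \<mu>) (at t)"
    and L2: "\<And>t. L (t + 2 * pi) = L t + integral {0..2 * pi} (\<lambda>t. \<kappa> t - \<mu>)" by (rule primitive_mean[OF \<kappa>']) blast
  have "integral {0..2 * pi} (\<lambda>t. \<kappa> t - \<mu>) = integral {0..2 * pi} \<kappa> - 2 * of_real pi * \<mu>"
    by (subst integral_diff[OF integrable_continuous_real[OF torus_smooth_continuous[OF \<kappa>]] integrable_const_ivl])
      (simp add: scaleR_conv_of_real)
  with \<mu> have one: "exp (- \<i> * integral {0..2 * pi} (\<lambda>t. \<kappa> t - \<mu>)) = 1"
  proof -
    have "2 * of_real pi * \<i> * (integral {0..2 * pi} \<kappa> / (2 * of_real pi)) = \<i> * integral {0..2 * pi} \<kappa>" by simp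
    then have "exp (2 * of_real pi * \<i> * \<mu>) = exp (\<i> * integral {0..2 * pi} \<kappa>)" using \<mu> by (simp only:)
    moreover have "- \<i> * (integral {0..2 * pi} \<kappa> - 2 * of_real pi * \<mu>) =
        2 * of_real pi * \<i> * \<mu> - \<i> * integral {0..2 * pi} \<kappa>" by (simp add: algebra_simps)
    ultimately show ?thesis
      using \<open>integral {0..2 * pi} (\<lambda>t. \<kappa> t - \<mu>) = integral {0..2 * pi} \<kappa> - 2 * of_real pi * \<mu>\<close>
      by (simp only: exp_diff) simp
  qed
  define F where "F t = exp (- \<i> * L t)" for t
  have F': "(F has_vector_derivative F t * (- \<i> * (\<kappa> t - \<mu>))) (at t)" for t
    unfolding F_def[abs_def] by (rule exp_primitive_derivative[OF L])
  have F2: "F (t + 2 * pi) = F t" for t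
    using one by (simp only: F_def L2 distrib_left exp_add mult_1_right)
  have F: "torus_smooth F"
    by (rule torus_smooth_ode[of F "\<lambda>_. 0", OF _ torus_smooth_const torus_smooth_cmult[OF \<kappa>', of "- \<i>"] F2])
      (simp only: add_0_left F')
  have cont: "continuous_on (torus_cell :: real set) (\<lambda>t. cmod (F t))"
    by (intro continuous_intros torus_smooth_continuous F)
  have "(torus_cell :: real set) \<noteq> {}" by (simp add: box_ne_empty)
  from continuous_attains_sup[OF compact_cbox this cont] obtain s where "s \<in> (torus_cell :: real set)"
    and s: "\<forall>t\<in>torus_cell. cmod (F t) \<le> cmod (F s)" by (elim bexE)
  have le: "cmod (F t) \<le> cmod (F s)" for t
  proof (rule torus_smooth_cell[OF F, of t])
    fix y assume "y \<in> (torus_cell :: real set)" "F y = F t"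
    then show ?thesis using bspec[OF s, of y] by simp
  qed
  have pos: "0 < cmod (F s)" by (simp add: F_def)
  define v where "v t = 1 / of_real (cmod (F s)) * F t" for t
  have v': "(v has_vector_derivative v t * (- \<i> * (\<kappa> t - \<mu>))) (at t)" for t
    using has_vector_derivative_mult_right[OF F', of "1 / of_real (cmod (F s))"]
    unfolding v_def[abs_def] by (simp only: mult.assoc)
  show thesis
  proof
    show "torus_smooth v" unfolding v_def[abs_def] by (rule torus_smooth_cmult[OF F])
    show "D_t v t + \<kappa> t * v t = \<mu> * v t" for t
      by (rule has_vector_derivative_D_t) (use v'[of t] in \<open>simp add: algebra_simps\<close>)
    show "cmod (v t) \<le> 1" for t using le[of t] pos by (simp add: v_def norm_mult norm_divide)
    show "\<exists>t. cmod (v t) = 1" using pos by (intro exI[of _ s]) (simp add: v_def norm_mult norm_divide)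
  qed
qed

text \<open>The lower bound on the divisor in product form: no division occurs, and the gap is
  non-zero wherever the inequality holds.\<close>

definition nonresonant :: "(int ^ 'n::finite \<Rightarrow> complex) \<Rightarrow> bool" where
  "nonresonant a \<longleftrightarrow> (\<exists>C N R. \<forall>\<xi>. norm (zvec \<xi>) \<ge> R \<longrightarrow> 1 \<le> C * wt \<xi> ^ N * cmod (gap (a \<xi>)))"

lemma nonresonantE:
  assumes "nonresonant a"
  obtains h R where "h \<in> poly_growth" "\<And>\<xi>. 0 \<le> h \<xi>"
    "\<And>\<xi>. norm (zvec \<xi>) \<ge> R \<Longrightarrow> 1 \<le> h \<xi> * cmod (gap (a \<xi>))"
proof -
  obtain C N R where C: "\<And>\<xi>. norm (zvec \<xi>) \<ge> R \<Longrightarrow> 1 \<le> C * wt \<xi> ^ N * cmod (gap (a \<xi>))"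
    using assms unfolding nonresonant_def by blast
  show thesis
  proof (rule that[of "\<lambda>\<xi>. \<bar>C\<bar> * wt \<xi> ^ N" R])
    show "(\<lambda>\<xi>. \<bar>C\<bar> * wt \<xi> ^ N) \<in> poly_growth" by (rule poly_growthI) (rule order_refl)
    show "1 \<le> \<bar>C\<bar> * wt \<xi> ^ N * cmod (gap (a \<xi>))" if "norm (zvec \<xi>) \<ge> R" for \<xi>
      by (rule order_trans[OF C[OF that] mult_right_mono[OF mult_right_mono]]) simp_all
  qed simp
qed

lemma circle_ode_gap_bound:
  assumes \<kappa>: "torus_smooth \<kappa>" and v: "torus_smooth v"
    and eq: "\<And>t. D_t v t + \<kappa> t * v t = f t"
    and B: "\<And>t. cmod (f t) \<le> B" and \<theta>: "0 \<le> \<theta>" "\<And>t. Im (\<kappa> t) \<ge> - \<theta>"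
    and h: "0 \<le> h" "1 \<le> h * cmod (gap (integral {0..2 * pi} \<kappa> / (2 * of_real pi)))"
  shows "cmod (v t) \<le> B * (h * (exp (2 * pi * \<theta>) * (2 * pi)))"
proof -
  let ?gap = "gap (integral {0..2 * pi} \<kappa> / (2 * of_real pi))"
  have "cmod (v t) \<le> (h * cmod ?gap) * cmod (v t)"
    using mult_right_mono[OF h(2), of "cmod (v t)"] by simp
  also have "\<dots> = h * (cmod ?gap * cmod (v t))" by simp
  also have "\<dots> \<le> h * (B * (exp (2 * pi * \<theta>) * (2 * pi)))"
    by (rule mult_left_mono[OF circle_ode_bound[OF \<kappa> v eq B \<theta>] h(1)])
  finally show ?thesis by (simp only: ac_simps)
qed

lemma family_circle_ode:
  assumes I: "growth_ideal I" and eig: "family poly_growth (\<lambda>\<xi> t. eig t \<xi>)"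
    and v: "\<And>\<xi>. torus_smooth (v \<xi>)" "dominated I v" and f: "family I f"
    and eq: "\<And>\<xi> t. D_t (v \<xi>) t + eig t \<xi> * v \<xi> t = f \<xi> t"
  shows "family I v"
proof (rule family_ode[OF I v family_cmult[OF I f, of \<i>] family_cmult[OF growth_ideal_poly eig, of "- \<i>"]])
  fix \<xi> t
  show "vector_derivative (v \<xi>) (at t) = \<i> * f \<xi> t + v \<xi> t * (- \<i> * eig t \<xi>)"
    by (rule vector_derivative_at[OF D_t_has_vector_derivative[OF v(1) eq]])
qed

text \<open>Dividing by the gap costs a polynomial factor, which either class absorbs; the finitely
  many frequencies at which the gap is not controlled are covered by the smoothness of each
  \<open>v \<xi>\<close>.\<close>

lemma family_circle_ode_apriori:
  fixes eig :: "real \<Rightarrow> int ^ 'n::finite \<Rightarrow> complex"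
  assumes I: "growth_ideal I" and eig: "family poly_growth (\<lambda>\<xi> t. eig t \<xi>)"
    and nr: "nonresonant (t_mean eig)" and \<theta>: "0 \<le> \<theta>" "\<And>t \<xi>. Im (eig t \<xi>) \<ge> - \<theta>"
    and v: "\<And>\<xi>. torus_smooth (v \<xi>)" and f: "family I f"
    and eq: "\<And>\<xi> t. D_t (v \<xi>) t + eig t \<xi> * v \<xi> t = f \<xi> t"
  shows "family I v"
proof (rule family_circle_ode[OF I eig v _ f eq])
  obtain h R where h: "h \<in> poly_growth" "\<And>\<xi>. 0 \<le> h \<xi>"
    "\<And>\<xi>. norm (zvec \<xi>) \<ge> R \<Longrightarrow> 1 \<le> h \<xi> * cmod (gap (t_mean eig \<xi>))" by (rule nonresonantE[OF nr]) blast
  obtain g where g: "g \<in> I" "\<And>\<xi> t. cmod (f \<xi> t) \<le> g \<xi>" "\<And>\<xi>. 0 \<le> g \<xi>" by (rule dominatedE[OF family_dominated[OF f]]) blast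
  let ?K = "exp (2 * pi * \<theta>) * (2 * pi)"
  show "dominated I v"
  proof (rule dominated_cofinite[OF I v])
    show "(\<lambda>\<xi>. g \<xi> * (h \<xi> * ?K)) \<in> I"
      by (intro growth_ideal_mult[OF I] growth_ideal_mult[OF growth_ideal_poly] g h poly_growth_const) (simp_all add: h)
    show "0 \<le> g \<xi> * (h \<xi> * ?K)" for \<xi> using g(3) h(2) by simp
    show "cmod (v \<xi> t) \<le> g \<xi> * (h \<xi> * ?K)" if "R \<le> norm (zvec \<xi>)" for \<xi> t
      by (rule circle_ode_gap_bound[OF family_smooth[OF eig] v eq g(2) \<theta> h(2)]) (use h(3)[OF that] in \<open>simp add: t_mean_def\<close>)
  qed
qed

text \<open>The equation is really solved only at the frequencies in \<open>X\<close>, where the gap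
  is controlled; elsewhere the data vanish and the zero solution is taken.\<close>

lemma family_circle_ode_solve:
  fixes eig :: "real \<Rightarrow> int ^ 'n::finite \<Rightarrow> complex"
  assumes eig: "family poly_growth (\<lambda>\<xi> t. eig t \<xi>)" and \<theta>: "0 \<le> \<theta>" "\<And>t \<xi>. Im (eig t \<xi>) \<ge> - \<theta>"
    and f: "family poly_growth f" and X: "\<And>\<xi>. \<xi> \<notin> X \<Longrightarrow> f \<xi> = (\<lambda>t. 0)"
    and h: "h \<in> poly_growth" "\<And>\<xi>. 0 \<le> h \<xi>" "\<And>\<xi>. \<xi> \<in> X \<Longrightarrow> 1 \<le> h \<xi> * cmod (gap (t_mean eig \<xi>))"
  obtains v where "family poly_growth v" "\<And>\<xi> t. D_t (v \<xi>) t + eig t \<xi> * v \<xi> t = f \<xi> t"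
    "\<And>\<xi>. \<xi> \<notin> X \<Longrightarrow> v \<xi> = (\<lambda>t. 0)"
proof -
  note T = growth_ideal_poly
  obtain g where g: "g \<in> poly_growth" "\<And>\<xi> t. cmod (f \<xi> t) \<le> g \<xi>" "\<And>\<xi>. 0 \<le> g \<xi>"
    by (rule dominatedE[OF family_dominated[OF f]]) blast
  have "\<forall>\<xi>. \<exists>v. torus_smooth v \<and> (\<forall>t. D_t v t + eig t \<xi> * v t = f \<xi> t) \<and> (\<xi> \<notin> X \<longrightarrow> v = (\<lambda>t. 0))"
  proof
    fix \<xi>
    show "\<exists>v. torus_smooth v \<and> (\<forall>t. D_t v t + eig t \<xi> * v t = f \<xi> t) \<and> (\<xi> \<notin> X \<longrightarrow> v = (\<lambda>t. 0))"
    proof (cases "\<xi> \<in> X")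
      case True
      then have "gap (integral {0..2 * pi} (\<lambda>t. eig t \<xi>) / (2 * of_real pi)) \<noteq> 0"
        using h(3)[OF True] unfolding t_mean_def by auto
      then obtain v where "torus_smooth v" "\<And>t. D_t v t + eig t \<xi> * v t = f \<xi> t"
        by (rule circle_ode_exists[OF family_smooth[OF eig] family_smooth[OF f]]) blast
      then show ?thesis using True by (intro exI[of _ v]) simp
    next
      case False
      have "D_t (\<lambda>t. 0) t = 0" for t by (simp add: D_t_def)
      then show ?thesis using X[OF False] by (intro exI[of _ "\<lambda>t. 0"]) (simp add: torus_smooth_const)
    qed
  qed
  from choice[OF this] obtain v where v: "\<And>\<xi>. torus_smooth (v \<xi>)"
    "\<And>\<xi> t. D_t (v \<xi>) t + eig t \<xi> * v \<xi> t = f \<xi> t" "\<And>\<xi>. \<xi> \<notin> X \<Longrightarrow> v \<xi> = (\<lambda>t. 0)" by blast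
  let ?K = "exp (2 * pi * \<theta>) * (2 * pi)"
  have "dominated poly_growth v"
  proof (rule dominatedI)
    show "(\<lambda>\<xi>. g \<xi> * (h \<xi> * ?K)) \<in> poly_growth"
      by (intro growth_ideal_mult[OF T] g h poly_growth_const) (simp_all add: h)
    show "cmod (v \<xi> t) \<le> g \<xi> * (h \<xi> * ?K)" for \<xi> t
    proof (cases "\<xi> \<in> X")
      case True
      show ?thesis
        by (rule circle_ode_gap_bound[OF family_smooth[OF eig] v(1,2) g(2) \<theta> h(2)]) (use h(3)[OF True] in \<open>simp add: t_mean_def\<close>)
    qed (use v(3) g(3) h(2) in simp)
  qed
  from family_circle_ode[OF T eig v(1) this f v(2)] v(2,3) show thesis by (rule that)
qed

subsection \<open>Triangular systems\<close>

lemma matrix_inv_cancel: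
  assumes "invertible A"
  shows "A ** matrix_inv A = mat 1" "matrix_inv A ** A = mat 1"
  using someI_ex[OF assms[unfolded invertible_def]] unfolding matrix_inv_def by simp_all

lemma matrix_sum_cancel:
  fixes A B :: "complex ^ 'm::finite ^ 'm"
  assumes "A ** B = mat 1"
  shows "(\<Sum>l\<in>UNIV. A $ k $ l * (\<Sum>m\<in>UNIV. B $ l $ m * x m)) = x k"
proof -
  have "A *v (B *v (\<chi> m. x m)) = (\<chi> m. x m)" by (simp add: matrix_vector_mul_assoc assms)
  then have "(A *v (B *v (\<chi> m. x m))) $ k = x k" by simp
  then show ?thesis by (simp add: matrix_vector_mult_def)
qed

lemma D_t_add: "torus_smooth f \<Longrightarrow> torus_smooth g \<Longrightarrow> D_t (\<lambda>t. f t + g t) t = D_t f t + D_t g t"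
  by (simp add: D_t_def vector_derivative_add algebra_simps)

lemma D_t_zero: "D_t (\<lambda>t. 0) t = 0"
  by (simp add: D_t_def)

lemma D_t_sum:
  assumes "\<And>i. i \<in> A \<Longrightarrow> torus_smooth (f i)"
  shows "D_t (\<lambda>t. \<Sum>i\<in>A. f i t) t = (\<Sum>i\<in>A. D_t (f i) t)"
  using assms
  by (induction A rule: infinite_finite_induct) (simp_all add: D_t_zero D_t_add torus_smooth_sum)

lemma D_t_mult:
  "torus_smooth f \<Longrightarrow> torus_smooth g \<Longrightarrow> D_t (\<lambda>t. f t * g t) t = D_t f t * g t + f t * D_t g t"
  by (simp add: D_t_def vector_derivative_product algebra_simps)

text \<open>The product rule together with \<open>D_t S = S B\<close> and
  \<open>Q S = S (diag_mat e + N)\<close> lets \<open>S\<close> be factored out on the left of the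
  whole system.\<close>

lemma conjugated_system:
  fixes S :: "real \<Rightarrow> complex ^ 'm::finite ^ 'm"
  assumes inv: "invertible (S t)" and S: "\<And>j k. torus_smooth (\<lambda>t. S t $ j $ k)"
    and v: "\<And>l. torus_smooth (v l)"
    and conj: "matrix_inv (S t) ** Q ** S t = diag_mat e + N"
  defines "B \<equiv> matrix_inv (S t) ** matrix_D_t S t"
  shows "D_t (\<lambda>t. \<Sum>l\<in>UNIV. S t $ j $ l * v l t) t + (\<Sum>k\<in>UNIV. Q $ j $ k * (\<Sum>l\<in>UNIV. S t $ k $ l * v l t)) =
    (\<Sum>l\<in>UNIV. S t $ j $ l * (D_t (v l) t + e l * v l t + (\<Sum>m\<in>UNIV. N $ l $ m * v m t) + (\<Sum>m\<in>UNIV. B $ l $ m * v m t)))"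
proof -
  let ?V = "\<chi> l. v l t" and ?DV = "\<chi> l. D_t (v l) t"
  note c = matrix_inv_cancel[OF inv]
  have SB: "S t ** B = matrix_D_t S t" unfolding B_def by (simp add: matrix_mul_assoc c)
  have SN: "S t ** (diag_mat e + N) = Q ** S t"
    unfolding conj[symmetric] by (simp add: matrix_mul_assoc c)
  have "D_t (\<lambda>t. \<Sum>l\<in>UNIV. S t $ j $ l * v l t) t =
      (\<Sum>l\<in>UNIV. D_t (\<lambda>t. S t $ j $ l) t * v l t + S t $ j $ l * D_t (v l) t)"
    by (simp add: D_t_sum D_t_mult torus_smooth_mult S v)
  also have "\<dots> = (matrix_D_t S t *v ?V + S t *v ?DV) $ j"
    by (simp add: matrix_vector_mult_def matrix_D_t_def sum.distrib)
  finally have 1: "D_t (\<lambda>t. \<Sum>l\<in>UNIV. S t $ j $ l * v l t) t = (matrix_D_t S t *v ?V + S t *v ?DV) $ j" .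
  have 2: "(\<Sum>k\<in>UNIV. Q $ j $ k * (\<Sum>l\<in>UNIV. S t $ k $ l * v l t)) = ((Q ** S t) *v ?V) $ j"
    unfolding matrix_vector_mul_assoc[symmetric] by (simp add: matrix_vector_mult_def)
  have D: "diag_mat e *v ?V = (\<chi> l. e l * v l t)"
    by (simp add: vec_eq_iff matrix_vector_mult_def diag_mat_def if_distrib[of "\<lambda>x. x * _"] cong: if_cong)
  have "(\<Sum>l\<in>UNIV. S t $ j $ l * (D_t (v l) t + e l * v l t + (\<Sum>m\<in>UNIV. N $ l $ m * v m t) + (\<Sum>m\<in>UNIV. B $ l $ m * v m t))) =
      (S t *v (?DV + diag_mat e *v ?V + N *v ?V + B *v ?V)) $ j"
    unfolding D by (simp add: matrix_vector_mult_def)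
  also have "S t *v (?DV + diag_mat e *v ?V + N *v ?V + B *v ?V) =
      S t *v ?DV + (S t ** (diag_mat e + N)) *v ?V + (S t ** B) *v ?V"
    by (simp add: matrix_vector_right_distrib matrix_vector_mul_assoc[symmetric] matrix_vector_mult_add_rdistrib)
  finally show ?thesis unfolding 1 2 SB SN by simp
qed

lemma family_diff: "growth_ideal I \<Longrightarrow> family I v \<Longrightarrow> family I w \<Longrightarrow> family I (\<lambda>\<xi> t. v \<xi> t - w \<xi> t)"
  using family_add[of I v "\<lambda>\<xi> t. - w \<xi> t"] family_minus[of I w] by simp

lemma family_mult': "growth_ideal I \<Longrightarrow> family poly_growth v \<Longrightarrow> family I w \<Longrightarrow> family I (\<lambda>\<xi> t. v \<xi> t * w \<xi> t)"
  using family_mult[of I w v] by (simp add: mult.commute)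

lemma family_matrix_vector:
  assumes "growth_ideal I" "\<And>k. family poly_growth (A k)" "\<And>k. family I (w k)"
  shows "family I (\<lambda>\<xi> t. \<Sum>k\<in>UNIV. A k \<xi> t * w k \<xi> t)"
  by (intro family_sum family_mult' assms)

text \<open>Failure of the bound for the constant 1, the exponent \<open>Suc n\<close> and a radius
  growing with \<open>n\<close> provides one frequency for each \<open>n\<close>; along these the
  gap decays faster than any power.\<close>

lemma resonant_sequence:
  fixes a :: "int ^ 'n::finite \<Rightarrow> complex"
  assumes "\<not> nonresonant a"
  obtains X where "\<And>R'. \<exists>\<xi>\<in>X. norm (zvec \<xi>) \<ge> R'" "\<And>\<xi>. \<xi> \<in> X \<Longrightarrow> norm (zvec \<xi>) \<ge> R"
    "\<And>\<xi>. \<xi> \<in> X \<Longrightarrow> cmod (gap (a \<xi>)) < 1 / 2"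
    "(\<lambda>\<xi>. if \<xi> \<in> X then cmod (gap (a \<xi>)) else 0) \<in> rapid_decay"
proof -
  have "\<forall>n. \<exists>\<xi>. norm (zvec \<xi>) \<ge> \<bar>R\<bar> + 1 + real n \<and> wt \<xi> ^ Suc n * cmod (gap (a \<xi>)) < 1"
  proof
    fix n
    \<comment> \<open>The radius is at least 1, so \<open>wt\<close> is at least 2, and the exponent
      is at least 1; together they push the gap below 1/2 already for \<open>n = 0\<close>.\<close>
    have "\<not> (\<forall>\<xi>. norm (zvec \<xi>) \<ge> \<bar>R\<bar> + 1 + real n \<longrightarrow> 1 \<le> 1 * wt \<xi> ^ Suc n * cmod (gap (a \<xi>)))"
      using assms unfolding nonresonant_def by blast
    then show "\<exists>\<xi>. norm (zvec \<xi>) \<ge> \<bar>R\<bar> + 1 + real n \<and> wt \<xi> ^ Suc n * cmod (gap (a \<xi>)) < 1"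
      by (simp add: not_le)
  qed
  from choice[OF this] obtain x where x: "\<And>n. norm (zvec (x n)) \<ge> \<bar>R\<bar> + 1 + real n"
    "\<And>n. wt (x n) ^ Suc n * cmod (gap (a (x n))) < 1" by blast
  show thesis
  proof (rule that[of "range x"])
    fix R' :: real
    have "R' \<le> norm (zvec (x (nat \<lceil>R'\<rceil>)))" using x(1)[of "nat \<lceil>R'\<rceil>"] real_nat_ceiling_ge[of R'] by linarith
    then show "\<exists>\<xi>\<in>range x. R' \<le> norm (zvec \<xi>)" by blast
  next
    fix \<xi> assume "\<xi> \<in> range x"
    then obtain n where n: "\<xi> = x n" by blast
    show "R \<le> norm (zvec \<xi>)" using x(1)[of n] unfolding n by linarith
    have "2 \<le> wt \<xi>" using x(1)[of n] unfolding n wt_def by linarith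
    also have "wt \<xi> ^ 1 \<le> wt \<xi> ^ Suc n" by (rule wt_power_mono) simp
    finally have "2 * cmod (gap (a \<xi>)) \<le> wt \<xi> ^ Suc n * cmod (gap (a \<xi>))" by (intro mult_right_mono) simp_all
    then show "cmod (gap (a \<xi>)) < 1 / 2" using x(2)[of n] n by simp
  next
    have "\<exists>C. \<forall>\<xi>. (if \<xi> \<in> range x then cmod (gap (a \<xi>)) else 0) * wt \<xi> ^ N \<le> C" for N
    proof -
      \<comment> \<open>The members with \<open>n < N\<close> need not satisfy the bound for the
        power \<open>N\<close> with constant 1; a finite maximum covers them.\<close>
      obtain K where K: "0 \<le> K" "\<And>n. n \<in> {..<N} \<Longrightarrow> cmod (gap (a (x n))) * wt (x n) ^ N \<le> K"
        by (rule finite_max_bound[of "{..<N}" "\<lambda>n. cmod (gap (a (x n))) * wt (x n) ^ N"]) auto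
      have "(if \<xi> \<in> range x then cmod (gap (a \<xi>)) else 0) * wt \<xi> ^ N \<le> K + 1" for \<xi>
      proof (cases "\<xi> \<in> range x")
        case True
        then obtain n where n: "\<xi> = x n" by blast
        show ?thesis
        proof (cases "n < N")
          case True
          then show ?thesis using K(2)[of n] n by simp
        next
          case False
          have "cmod (gap (a \<xi>)) * wt \<xi> ^ N \<le> cmod (gap (a \<xi>)) * wt \<xi> ^ Suc n"
            using False by (intro mult_left_mono wt_power_mono) simp_all
          also have "\<dots> \<le> 1" using x(2)[of n] n by (simp add: mult.commute)
          finally show ?thesis using True K(1) by simp
        qed
      qed (use K(1) in simp)
      then show ?thesis by blast
    qed
    then show "(\<lambda>\<xi>. if \<xi> \<in> range x then cmod (gap (a \<xi>)) else 0) \<in> rapid_decay"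
      unfolding rapid_decay_def by blast
  qed
qed

text \<open>What strong triangularizability and the lower bound provide, expressed in terms of
  families, so that the given system and the diagonal one are two interpretations of the same
  result.\<close>

locale triangular_system =
  fixes c :: "'m::{finite, linorder} \<Rightarrow> 'm \<Rightarrow> real \<Rightarrow> complex"
    and q :: "'m \<Rightarrow> 'm \<Rightarrow> int ^ 'n::finite \<Rightarrow> complex"
    and eig :: "'m \<Rightarrow> real \<Rightarrow> int ^ 'n \<Rightarrow> complex"
    and S N :: "real \<Rightarrow> int ^ 'n \<Rightarrow> complex ^ ('m::{finite, linorder}) ^ ('m::{finite, linorder})"
  assumes inv: "\<And>t \<xi>. invertible (S t \<xi>)"
    and conj: "\<And>t \<xi>. matrix_inv (S t \<xi>) ** matrix_symbol c q t \<xi> ** S t \<xi> = diag_mat (\<lambda>k. eig k t \<xi>) + N t \<xi>"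
    and upper: "\<And>t \<xi>. strictly_upper_triangular (N t \<xi>)"
    and fam_eig: "\<And>k. family poly_growth (\<lambda>\<xi> t. eig k t \<xi>)"
    and fam_N: "\<And>j k. family poly_growth (\<lambda>\<xi> t. N t \<xi> $ j $ k)"
    and fam_S: "\<And>j k. family poly_growth (\<lambda>\<xi> t. S t \<xi> $ j $ k)"
    and fam_S': "\<And>j k. family poly_growth (\<lambda>\<xi> t. matrix_inv (S t \<xi>) $ j $ k)"
    and fam_B: "\<And>j k. family rapid_decay (\<lambda>\<xi> t. (matrix_inv (S t \<xi>) ** matrix_D_t (\<lambda>s. S s \<xi>) t) $ j $ k)"
    and below: "diagonal_bounded_below eig"
begin

abbreviation B :: "real \<Rightarrow> int ^ 'n \<Rightarrow> complex ^ ('m::{finite, linorder}) ^ ('m::{finite, linorder})" where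
  "B t \<xi> \<equiv> matrix_inv (S t \<xi>) ** matrix_D_t (\<lambda>s. S s \<xi>) t"

text \<open>The triangular system without \<open>B\<close>, which is kept apart as a rapidly
  decaying perturbation.\<close>

definition tri :: "('m \<Rightarrow> int ^ 'n \<Rightarrow> real \<Rightarrow> complex) \<Rightarrow> 'm \<Rightarrow> int ^ 'n \<Rightarrow> real \<Rightarrow> complex" where
  "tri v l \<xi> t = D_t (v l \<xi>) t + eig l t \<xi> * v l \<xi> t + (\<Sum>m\<in>UNIV. N t \<xi> $ l $ m * v m \<xi> t)"

definition change :: "('m \<Rightarrow> int ^ 'n \<Rightarrow> real \<Rightarrow> complex) \<Rightarrow> 'm \<Rightarrow> int ^ 'n \<Rightarrow> real \<Rightarrow> complex" where
  "change v k \<xi> t = (\<Sum>l\<in>UNIV. S t \<xi> $ k $ l * v l \<xi> t)"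

definition unchange :: "('m \<Rightarrow> int ^ 'n \<Rightarrow> real \<Rightarrow> complex) \<Rightarrow> 'm \<Rightarrow> int ^ 'n \<Rightarrow> real \<Rightarrow> complex" where
  "unchange w l \<xi> t = (\<Sum>k\<in>UNIV. matrix_inv (S t \<xi>) $ l $ k * w k \<xi> t)"

lemma change_unchange: "change (unchange w) = w"
  unfolding change_def unchange_def by (intro ext matrix_sum_cancel matrix_inv_cancel inv)

lemma unchange_change: "unchange (change w) = w"
  unfolding change_def unchange_def by (intro ext matrix_sum_cancel matrix_inv_cancel inv)

lemma family_change: "growth_ideal I \<Longrightarrow> (\<And>k. family I (v k)) \<Longrightarrow> family I (change v j)"
  unfolding change_def[abs_def] by (intro family_matrix_vector fam_S)

lemma family_unchange: "growth_ideal I \<Longrightarrow> (\<And>k. family I (v k)) \<Longrightarrow> family I (unchange v j)"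
  unfolding unchange_def[abs_def] by (intro family_matrix_vector fam_S')

lemma system_family_change:
  assumes v: "\<And>l \<xi>. torus_smooth (v l \<xi>)"
  shows "system_family c q (change v) = change (\<lambda>l \<xi> t. tri v l \<xi> t + (\<Sum>m\<in>UNIV. B t \<xi> $ l $ m * v m \<xi> t))"
proof (intro ext)
  fix j \<xi> t
  have "system_family c q (change v) j \<xi> t = D_t (\<lambda>t. \<Sum>l\<in>UNIV. S t \<xi> $ j $ l * v l \<xi> t) t +
      (\<Sum>k\<in>UNIV. matrix_symbol c q t \<xi> $ j $ k * (\<Sum>l\<in>UNIV. S t \<xi> $ k $ l * v l \<xi> t))"
    by (simp add: system_family_def change_def[abs_def] matrix_symbol_def)
  also have "\<dots> = change (\<lambda>l \<xi> t. tri v l \<xi> t + (\<Sum>m\<in>UNIV. B t \<xi> $ l $ m * v m \<xi> t)) j \<xi> t"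
    unfolding change_def tri_def
    by (rule conjugated_system[of "\<lambda>t. S t \<xi>", OF inv family_smooth[OF fam_S] v conj])
  finally show "system_family c q (change v) j \<xi> t =
      change (\<lambda>l \<xi> t. tri v l \<xi> t + (\<Sum>m\<in>UNIV. B t \<xi> $ l $ m * v m \<xi> t)) j \<xi> t" .
qed

lemma family_B: "(\<And>m. family poly_growth (v m)) \<Longrightarrow> family rapid_decay (\<lambda>\<xi> t. \<Sum>m\<in>UNIV. B t \<xi> $ l $ m * v m \<xi> t)"
  by (intro family_sum family_mult growth_ideal_rapid fam_B)

lemma below_bound: obtains \<theta> where "0 \<le> \<theta>" "\<And>t \<xi>. Im (eig k t \<xi>) \<ge> - \<theta>"
proof -
  obtain \<theta> where "0 < \<theta>" "\<And>t \<xi>. Im (eig k t \<xi>) \<ge> - \<theta>"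
    using below[unfolded diagonal_bounded_below_def, THEN spec, of k] by blast
  then show thesis by (intro that[of \<theta>]) simp_all
qed

lemma upper_zero: "m \<le> l \<Longrightarrow> N t \<xi> $ l $ m = 0"
  using upper unfolding strictly_upper_triangular_def by blast

text \<open>\<open>B v\<close> decays rapidly as soon as \<open>v\<close> grows polynomially, so
  this term moves to the right-hand side before anything is known about decay of \<open>v\<close>.
  What remains is triangular and yields to the scalar a priori estimate, row by row.\<close>

lemma nonresonant_imp_hypoelliptic:
  assumes nr: "\<And>k. nonresonant (t_mean (eig k))"
  shows "family_hypoelliptic c q"
  unfolding family_hypoelliptic_def
proof (intro allI impI)
  fix w :: "'m \<Rightarrow> int ^ 'n \<Rightarrow> real \<Rightarrow> complex" and k
  assume w: "\<forall>k. family poly_growth (w k)" and Lw: "\<forall>j. family rapid_decay (system_family c q w j)"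
  note R = growth_ideal_rapid and T = growth_ideal_poly
  define v where "v = unchange w"
  have wv: "w = change v" by (simp add: v_def change_unchange)
  have v: "family poly_growth (v l)" for l unfolding v_def by (intro family_unchange T spec[OF w])
  have vs: "torus_smooth (v l \<xi>)" for l \<xi> by (rule family_smooth[OF v])
  have "family rapid_decay (unchange (system_family c q w) l)" for l
    by (intro family_unchange R spec[OF Lw])
  then have g: "family rapid_decay (\<lambda>\<xi> t. tri v l \<xi> t + (\<Sum>m\<in>UNIV. B t \<xi> $ l $ m * v m \<xi> t))" for l
    unfolding wv system_family_change[OF vs] unchange_change .
  have tri: "family rapid_decay (tri v l)" for l
    using family_diff[OF R g[of l] family_B[of v l, OF v]] by simp
  have rv: "family rapid_decay (v l)" for l
  proof (rule ccontr)
    assume "\<not> family rapid_decay (v l)"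
    define A where "A = {l. \<not> family rapid_decay (v l)}"
    have "finite A" "A \<noteq> {}" using \<open>\<not> family rapid_decay (v l)\<close> by (auto simp: A_def)
    \<comment> \<open>Back substitution, phrased as a contradiction at the last component that fails
      to decay: apart from \<open>v j\<close>, row \<open>j\<close> involves only later
      components.\<close>
    define j where "j = Max A"
    have j: "j \<in> A" unfolding j_def by (rule Max_in) fact+
    have above: "family rapid_decay (v m)" if "j < m" for m
    proof (rule ccontr)
      assume "\<not> family rapid_decay (v m)"
      then have "m \<in> A" by (simp add: A_def)
      from Max_ge[OF \<open>finite A\<close> this] that show False by (simp add: j_def)
    qed
    obtain \<theta> where \<theta>: "0 \<le> \<theta>" "\<And>t \<xi>. Im (eig j t \<xi>) \<ge> - \<theta>" by (rule below_bound[of j]) blast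
    have "family rapid_decay (\<lambda>\<xi> t. N t \<xi> $ j $ m * v m \<xi> t)" for m
    proof (cases "m \<le> j")
      case True
      then show ?thesis by (simp add: upper_zero family_zero R)
    next
      case False
      then show ?thesis by (intro family_mult' R fam_N above) simp
    qed
    then have sum: "family rapid_decay (\<lambda>\<xi> t. \<Sum>m\<in>UNIV. N t \<xi> $ j $ m * v m \<xi> t)" by (intro family_sum R)
    have "family rapid_decay (v j)"
      by (rule family_circle_ode_apriori[OF R fam_eig nr \<theta> vs family_diff[OF R tri[of j] sum]])
        (simp add: tri_def)
    with j show False by (simp add: A_def)
  qed
  show "family rapid_decay (w k)" unfolding wv by (intro family_change R rv)
qed

text \<open>The induction inserts an index \<open>b\<close> below all those treated so far, so the
  rows are solved upwards, starting nearest to \<open>k\<close>. Each new component is driven by the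
  later ones, and by strict upper triangularity it does not enter the rows already solved.\<close>

lemma triangular_solve:
  fixes k :: 'm
  assumes v0: "family poly_growth v0" "\<And>\<xi>. \<xi> \<notin> X \<Longrightarrow> v0 \<xi> = (\<lambda>t. 0)"
    and h: "\<And>j. j < k \<Longrightarrow> h j \<in> poly_growth" "\<And>j \<xi>. j < k \<Longrightarrow> 0 \<le> h j \<xi>"
      "\<And>j \<xi>. j < k \<Longrightarrow> \<xi> \<in> X \<Longrightarrow> 1 \<le> h j \<xi> * cmod (gap (t_mean (eig j) \<xi>))"
    and "finite A" "A \<subseteq> {..<k}"
  shows "\<exists>v. (\<forall>l. family poly_growth (v l)) \<and> (\<forall>l. l \<notin> insert k A \<longrightarrow> v l = (\<lambda>\<xi> t. 0)) \<and> v k = v0 \<and>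
    (\<forall>l \<xi>. \<xi> \<notin> X \<longrightarrow> v l \<xi> = (\<lambda>t. 0)) \<and> (\<forall>j\<in>A. tri v j = (\<lambda>\<xi> t. 0))"
  using assms(6,7)
proof (induction A rule: finite_linorder_min_induct)
  case empty
  show ?case
    using v0 by (intro exI[of _ "\<lambda>l. if l = k then v0 else (\<lambda>\<xi> t. 0)"]) (simp add: family_zero growth_ideal_poly)
next
  case (insert b A)
  note T = growth_ideal_poly
  have "A \<subseteq> {..<k}" using insert.prems by auto
  from insert.IH[OF this] obtain v where v: "\<And>l. family poly_growth (v l)" "\<And>l. l \<notin> insert k A \<Longrightarrow> v l = (\<lambda>\<xi> t. 0)" "v k = v0"
    "\<And>l \<xi>. \<xi> \<notin> X \<Longrightarrow> v l \<xi> = (\<lambda>t. 0)" "\<And>j. j \<in> A \<Longrightarrow> tri v j = (\<lambda>\<xi> t. 0)"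
    by blast
  have bk: "b < k" using insert.prems by simp
  have bA: "b \<notin> A" using insert.hyps by auto
  have vb: "v b = (\<lambda>\<xi> t. 0)" using bk bA by (intro v(2)) auto
  obtain \<theta> where \<theta>: "0 \<le> \<theta>" "\<And>t \<xi>. Im (eig b t \<xi>) \<ge> - \<theta>" by (rule below_bound[of b]) blast
  define f where "f \<xi> t = - (\<Sum>m\<in>UNIV. N t \<xi> $ b $ m * v m \<xi> t)" for \<xi> t
  have f: "family poly_growth f"
    unfolding f_def[abs_def] by (intro family_minus family_matrix_vector T fam_N v(1))
  have fX: "f \<xi> = (\<lambda>t. 0)" if "\<xi> \<notin> X" for \<xi> by (simp add: f_def[abs_def] v(4)[OF that])
  obtain vb' where vb': "family poly_growth vb'" "\<And>\<xi> t. D_t (vb' \<xi>) t + eig b t \<xi> * vb' \<xi> t = f \<xi> t"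
    "\<And>\<xi>. \<xi> \<notin> X \<Longrightarrow> vb' \<xi> = (\<lambda>t. 0)"
    by (rule family_circle_ode_solve[OF fam_eig \<theta> f fX h[OF bk]]) blast+
  define v' where "v' = v(b := vb')"
  \<comment> \<open>The entry of \<open>N\<close> in row \<open>l\<close> and column
    \<open>b\<close> is 0 for \<open>b \<le> l\<close>, so replacing component \<open>b\<close> does
    not change these sums.\<close>
  have same: "(\<Sum>m\<in>UNIV. N t \<xi> $ l $ m * v' m \<xi> t) = (\<Sum>m\<in>UNIV. N t \<xi> $ l $ m * v m \<xi> t)" if "b \<le> l" for l t \<xi>
    by (intro sum.cong refl) (use that in \<open>auto simp: v'_def upper_zero\<close>)
  show ?case
  proof (intro exI[of _ v'] conjI allI impI ballI)
    show "family poly_growth (v' l)" for l by (simp add: v'_def v(1) vb'(1))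
    show "v' l = (\<lambda>\<xi> t. 0)" if "l \<notin> insert k (insert b A)" for l using that by (simp add: v'_def v(2))
    show "v' k = v0" using bk v(3) by (auto simp: v'_def)
    show "v' l \<xi> = (\<lambda>t. 0)" if "\<xi> \<notin> X" for l \<xi> using that by (simp add: v'_def v(4) vb'(3))
    fix j assume j: "j \<in> insert b A"
    show "tri v' j = (\<lambda>\<xi> t. 0)"
    proof (cases "j = b")
      case True
      show ?thesis
        unfolding True by (intro ext) (simp add: tri_def same, simp add: v'_def vb'(2), simp add: f_def)
    next
      case False
      then have jA: "j \<in> A" and bj: "b < j" using j insert.hyps by auto
      have "tri v' j = tri v j"
        unfolding tri_def[abs_def] using same[OF less_imp_le[OF bj]] False by (simp add: v'_def)
      then show ?thesis using v(5)[OF jA] by simp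
    qed
  qed
qed

text \<open>The counterexample has a component \<open>k\<close> of maximum 1 at the frequencies in
  \<open>X\<close>, zeros after it, and solved components before it. Its image is the change of
  basis applied to \<open>\<mu> v0\<close> in row \<open>k\<close> plus \<open>B v\<close>, both
  rapidly decaying, although component \<open>k\<close> itself does not decay.\<close>

lemma hypoelliptic_imp_nonresonant:
  assumes FH: "family_hypoelliptic c q"
  shows "nonresonant (t_mean (eig k))"
proof (rule ccontr)
  note R = growth_ideal_rapid and T = growth_ideal_poly
  assume "\<not> nonresonant (t_mean (eig k))"
  define A where "A = {k. \<not> nonresonant (t_mean (eig k))}"
  have "finite A" "A \<noteq> {}" using \<open>\<not> nonresonant (t_mean (eig k))\<close> by (auto simp: A_def)
  \<comment> \<open>The least resonant index: the rows before it, which component \<open>k\<close>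
    enters through \<open>N\<close>, can then be solved with polynomial loss.\<close>
  define k where "k = Min A"
  have "k \<in> A" unfolding k_def by (rule Min_in) fact+
  then have res: "\<not> nonresonant (t_mean (eig k))" by (simp add: A_def)
  have nr: "nonresonant (t_mean (eig j))" if "j < k" for j
  proof (rule ccontr)
    assume "\<not> nonresonant (t_mean (eig j))"
    then have "j \<in> A" by (simp add: A_def)
    from Min_le[OF \<open>finite A\<close> this] that show False by (simp add: k_def)
  qed
  have "\<forall>j. \<exists>hR. j < k \<longrightarrow> fst hR \<in> poly_growth \<and> (\<forall>\<xi>. 0 \<le> fst hR \<xi>) \<and>
      (\<forall>\<xi>. norm (zvec \<xi>) \<ge> snd hR \<longrightarrow> 1 \<le> fst hR \<xi> * cmod (gap (t_mean (eig j) \<xi>)))"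
  proof
    fix j
    show "\<exists>hR. j < k \<longrightarrow> fst hR \<in> poly_growth \<and> (\<forall>\<xi>. 0 \<le> fst hR \<xi>) \<and>
      (\<forall>\<xi>. norm (zvec \<xi>) \<ge> snd hR \<longrightarrow> 1 \<le> fst hR \<xi> * cmod (gap (t_mean (eig j) \<xi>)))"
    proof (cases "j < k")
      case True
      obtain h r where "h \<in> poly_growth" "\<And>\<xi>. 0 \<le> h \<xi>"
        "\<And>\<xi>. norm (zvec \<xi>) \<ge> r \<Longrightarrow> 1 \<le> h \<xi> * cmod (gap (t_mean (eig j) \<xi>))" by (rule nonresonantE[OF nr[OF True]]) blast
      then show ?thesis by (intro exI[of _ "(h, r)"]) simp
    qed simp
  qed
  from choice[OF this] obtain hR where hR: "\<And>j. j < k \<Longrightarrow> fst (hR j) \<in> poly_growth"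
    "\<And>j \<xi>. j < k \<Longrightarrow> 0 \<le> fst (hR j) \<xi>"
    "\<And>j \<xi>. j < k \<Longrightarrow> norm (zvec \<xi>) \<ge> snd (hR j) \<Longrightarrow> 1 \<le> fst (hR j) \<xi> * cmod (gap (t_mean (eig j) \<xi>))" by blast
  \<comment> \<open>A single radius beyond which every earlier row has its gap under
    control.\<close>
  define r where "r = (\<Sum>j\<in>UNIV. \<bar>snd (hR j)\<bar>)"
  have r: "snd (hR j) \<le> r" for j
    using member_le_sum[of j UNIV "\<lambda>j. \<bar>snd (hR j)\<bar>"] unfolding r_def by simp
  obtain X where X: "\<And>R'. \<exists>\<xi>\<in>X. norm (zvec \<xi>) \<ge> R'" "\<And>\<xi>. \<xi> \<in> X \<Longrightarrow> norm (zvec \<xi>) \<ge> r"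
    "\<And>\<xi>. \<xi> \<in> X \<Longrightarrow> cmod (gap (t_mean (eig k) \<xi>)) < 1 / 2"
    "(\<lambda>\<xi>. if \<xi> \<in> X then cmod (gap (t_mean (eig k) \<xi>)) else 0) \<in> rapid_decay"
    by (rule resonant_sequence[OF res, of r]) blast
  \<comment> \<open>Chosen so that \<open>\<mu> \<xi>\<close> and the mean of the eigenvalue differ
    by an integer for \<open>\<xi> \<in> X\<close>; the principal logarithm makes it as small as the
    gap, since the gap is below 1/2 there.\<close>
  define \<mu> where "\<mu> \<xi> = (if \<xi> \<in> X then Ln (1 + gap (t_mean (eig k) \<xi>)) / (2 * of_real pi * \<i>) else 0)" for \<xi>
  have \<mu>_le: "cmod (\<mu> \<xi>) \<le> (if \<xi> \<in> X then cmod (gap (t_mean (eig k) \<xi>)) else 0)" for \<xi>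
  proof (cases "\<xi> \<in> X")
    case True
    have "cmod (Ln (1 + gap (t_mean (eig k) \<xi>))) \<le> 2 * cmod (gap (t_mean (eig k) \<xi>))"
      by (rule norm_Ln_le[OF X(3)[OF True]])
    also have "\<dots> \<le> (2 * pi) * cmod (gap (t_mean (eig k) \<xi>))" using pi_gt3 by (intro mult_right_mono) simp_all
    finally have "cmod (Ln (1 + gap (t_mean (eig k) \<xi>))) / (2 * pi) \<le> cmod (gap (t_mean (eig k) \<xi>))"
      using pi_gt_zero by (simp add: pos_divide_le_eq mult.commute)
    then show ?thesis using True by (simp add: \<mu>_def norm_divide norm_mult)
  qed (simp add: \<mu>_def)
  have \<mu>_rapid: "(\<lambda>\<xi>. cmod (\<mu> \<xi>)) \<in> rapid_decay"
    by (rule growth_ideal_cofinite[OF R X(4)]) (use \<mu>_le in \<open>simp_all add: not_less[symmetric]\<close>)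
  have "\<forall>\<xi>. \<exists>v. torus_smooth v \<and> (\<forall>t. D_t v t + eig k t \<xi> * v t = \<mu> \<xi> * v t) \<and> (\<forall>t. cmod (v t) \<le> 1) \<and>
      (if \<xi> \<in> X then \<exists>t. cmod (v t) = 1 else v = (\<lambda>t. 0))"
  proof
    fix \<xi>
    show "\<exists>v. torus_smooth v \<and> (\<forall>t. D_t v t + eig k t \<xi> * v t = \<mu> \<xi> * v t) \<and> (\<forall>t. cmod (v t) \<le> 1) \<and>
      (if \<xi> \<in> X then \<exists>t. cmod (v t) = 1 else v = (\<lambda>t. 0))"
    proof (cases "\<xi> \<in> X")
      case True
      have "1 + gap (t_mean (eig k) \<xi>) = exp (2 * of_real pi * \<i> * t_mean (eig k) \<xi>)" by (simp add: gap_def)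
      moreover have "2 * of_real pi * \<i> * \<mu> \<xi> = Ln (1 + gap (t_mean (eig k) \<xi>))" using True by (simp add: \<mu>_def)
      ultimately have "exp (2 * of_real pi * \<i> * \<mu> \<xi>) = exp (2 * of_real pi * \<i> * t_mean (eig k) \<xi>)"
        by (simp only: exp_Ln exp_not_eq_zero not_False_eq_True)
      then obtain v where "torus_smooth v" "\<And>t. D_t v t + eig k t \<xi> * v t = \<mu> \<xi> * v t"
        "\<And>t. cmod (v t) \<le> 1" "\<exists>t. cmod (v t) = 1"
        unfolding t_mean_def by (rule circle_approximate_kernel[OF family_smooth[OF fam_eig]]) blast
      then show ?thesis using True by (intro exI[of _ v]) simp
    next
      case False
      then show ?thesis by (intro exI[of _ "\<lambda>t. 0"]) (simp add: torus_smooth_const D_t_zero)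
    qed
  qed
  from choice[OF this] obtain v0 where v0: "\<And>\<xi>. torus_smooth (v0 \<xi>)"
    "\<And>\<xi> t. D_t (v0 \<xi>) t + eig k t \<xi> * v0 \<xi> t = \<mu> \<xi> * v0 \<xi> t" "\<And>\<xi> t. cmod (v0 \<xi> t) \<le> 1"
    "\<And>\<xi>. if \<xi> \<in> X then \<exists>t. cmod (v0 \<xi> t) = 1 else v0 \<xi> = (\<lambda>t. 0)" by blast
  have v0X: "v0 \<xi> = (\<lambda>t. 0)" if "\<xi> \<notin> X" for \<xi> using v0(4)[of \<xi>] that by simp
  have f\<mu>: "family rapid_decay (\<lambda>\<xi> t. \<mu> \<xi>)" by (rule family_const[OF R \<mu>_rapid])
  \<comment> \<open>Read as a homogeneous equation with eigenvalue shifted by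
    \<open>\<mu> \<xi>\<close>, the equation lifts the bound 1 on \<open>v0\<close> to polynomial
    bounds on all its derivatives.\<close>
  have fv0: "family poly_growth v0"
  proof (rule family_circle_ode[OF T _ v0(1) _ family_zero[OF T]])
    show "family poly_growth (\<lambda>\<xi> t. eig k t \<xi> - \<mu> \<xi>)"
      by (intro family_diff T fam_eig family_rapid_poly f\<mu>)
    show "dominated poly_growth v0" by (rule dominatedI[OF poly_growth_const v0(3)])
    show "D_t (v0 \<xi>) t + (eig k t \<xi> - \<mu> \<xi>) * v0 \<xi> t = 0" for \<xi> t
      using v0(2)[of \<xi> t] by (simp add: algebra_simps)
  qed
  have "\<exists>v. (\<forall>l. family poly_growth (v l)) \<and> (\<forall>l. l \<notin> insert k {..<k} \<longrightarrow> v l = (\<lambda>\<xi> t. 0)) \<and> v k = v0 \<and>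
    (\<forall>l \<xi>. \<xi> \<notin> X \<longrightarrow> v l \<xi> = (\<lambda>t. 0)) \<and> (\<forall>j\<in>{..<k}. tri v j = (\<lambda>\<xi> t. 0))"
  proof (rule triangular_solve[where h = "\<lambda>j. fst (hR j)", OF fv0 v0X hR(1,2)])
    show "1 \<le> fst (hR j) \<xi> * cmod (gap (t_mean (eig j) \<xi>))" if "j < k" "\<xi> \<in> X" for j \<xi>
      by (rule hR(3)[OF that(1) order_trans[OF r X(2)[OF that(2)]]])
  qed simp_all
  then obtain v where v: "\<And>l. family poly_growth (v l)" "\<And>l. l \<notin> insert k {..<k} \<Longrightarrow> v l = (\<lambda>\<xi> t. 0)" "v k = v0"
    "\<And>j. j \<in> {..<k} \<Longrightarrow> tri v j = (\<lambda>\<xi> t. 0)" by blast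
  have v_above: "v l = (\<lambda>\<xi> t. 0)" if "k < l" for l using that by (intro v(2)) auto
  have N0: "(\<Sum>m\<in>UNIV. N t \<xi> $ j $ m * v m \<xi> t) = 0" if "k \<le> j" for j t \<xi>
  proof (intro sum.neutral ballI)
    fix m :: 'm
    show "N t \<xi> $ j $ m * v m \<xi> t = 0"
      by (cases "m \<le> j") (use that v_above[of m] in \<open>auto simp: upper_zero\<close>)
  qed
  have tri: "family rapid_decay (tri v j)" for j
  proof (cases "j < k")
    case True
    then show ?thesis by (simp add: v(4) family_zero R)
  next
    case False
    show ?thesis
    proof (cases "j = k")
      case True
      have "tri v j = (\<lambda>\<xi> t. \<mu> \<xi> * v0 \<xi> t)"
        unfolding tri_def[abs_def] True by (simp add: N0 v(3) v0(2))
      then show ?thesis using family_mult[OF R f\<mu> fv0] by simp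
    next
      case F: False
      have "tri v j = (\<lambda>\<xi> t. 0)"
        unfolding tri_def[abs_def] using False F by (simp add: N0 v_above D_t_zero)
      then show ?thesis by (simp add: family_zero R)
    qed
  qed
  have vs: "torus_smooth (v l \<xi>)" for l \<xi> by (rule family_smooth[OF v(1)])
  have "family rapid_decay (system_family c q (change v) j)" for j
    unfolding system_family_change[OF vs] by (intro family_change R family_add tri family_B v(1))
  with family_change[OF T v(1)] have "family rapid_decay (change v j)" for j
    using FH[unfolded family_hypoelliptic_def, THEN spec, of "change v"] by simp
  then have "family rapid_decay (unchange (change v) k)" by (intro family_unchange R)
  then have "family rapid_decay v0" by (simp only: unchange_change v(3))
  \<comment> \<open>The first power of the weight suffices: at a frequency in \<open>X\<close> of
    norm at least \<open>C\<close>, where \<open>v0\<close> attains modulus 1, the weight exceeds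
    \<open>C\<close>.\<close>
  then obtain C where C: "\<And>\<xi> t. cmod (v0 \<xi> t) * wt \<xi> ^ 1 \<le> C"
    by (rule dominated_rapidE[OF family_dominated]) blast
  obtain \<xi> where \<xi>: "\<xi> \<in> X" "norm (zvec \<xi>) \<ge> C" using X(1) by blast
  then obtain t where "cmod (v0 \<xi> t) = 1" using v0(4)[of \<xi>] by auto
  then show False using C[of \<xi> t] \<xi>(2) by (simp add: wt_def)
qed

lemma hypoelliptic_iff_nonresonant:
  "family_hypoelliptic c q \<longleftrightarrow> (\<forall>k. nonresonant (t_mean (eig k)))"
  using nonresonant_imp_hypoelliptic hypoelliptic_imp_nonresonant by blast

end

subsection \<open>Triangularizable symbols\<close>

lemma axis_bounded_linear: "bounded_linear (axis i :: 'a::euclidean_space \<Rightarrow> 'a ^ 'm::finite)"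
proof -
  have "linear (axis i :: 'a \<Rightarrow> 'a ^ 'm)"
    by (rule linearI) (simp_all add: vec_eq_iff axis_def)
  then show ?thesis by (simp add: linear_conv_bounded_linear)
qed

lemma has_vector_derivative_vec:
  fixes f :: "'m::finite \<Rightarrow> real \<Rightarrow> 'a::euclidean_space"
  assumes "\<And>i. (f i has_vector_derivative f' i) (at t)"
  shows "((\<lambda>t. \<chi> i. f i t) has_vector_derivative (\<chi> i. f' i)) (at t)"
proof -
  have sum: "(\<Sum>i\<in>UNIV. axis i (x i)) = (\<chi> i. x i)" for x :: "'m \<Rightarrow> 'a"
    by (simp add: vec_eq_iff axis_def)
  have "((\<lambda>t. \<Sum>i\<in>UNIV. axis i (f i t)) has_vector_derivative (\<Sum>i\<in>UNIV. axis i (f' i))) (at t)"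
    by (intro has_vector_derivative_sum bounded_linear.has_vector_derivative[OF axis_bounded_linear] assms)
  then show ?thesis unfolding sum .
qed

text \<open>The hypotheses bound the norm of matrix-valued derivatives while families are formed
  from entries; this passes from one to the other.\<close>

lemma t_deriv_matrix:
  fixes M :: "real \<Rightarrow> complex ^ 'm::finite ^ 'm"
  assumes "\<And>j k. torus_smooth (\<lambda>s. M s $ j $ k)"
  shows "t_deriv \<alpha> M = (\<lambda>t. \<chi> j k. t_deriv \<alpha> (\<lambda>s. M s $ j $ k) t)"
proof (induction \<alpha>)
  case 0
  show ?case by (simp add: t_deriv_0 vec_eq_iff)
next
  case (Suc \<alpha>)
  show ?case
    unfolding t_deriv_Suc' Suc.IH
    by (intro ext vector_derivative_at has_vector_derivative_vec torus_smooth_has_vector_derivative torus_smooth_t_deriv assms)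
qed

lemma t_deriv_entry_le:
  fixes M :: "real \<Rightarrow> complex ^ 'm::finite ^ 'm"
  assumes "\<And>j k. torus_smooth (\<lambda>s. M s $ j $ k)"
  shows "cmod (t_deriv \<alpha> (\<lambda>s. M s $ j $ k) t) \<le> norm (t_deriv \<alpha> M t)"
proof -
  have "cmod (t_deriv \<alpha> M t $ j $ k) \<le> norm (t_deriv \<alpha> M t)"
    by (rule order_trans[OF Finite_Cartesian_Product.norm_nth_le Finite_Cartesian_Product.norm_nth_le])
  then show ?thesis by (simp add: t_deriv_matrix[OF assms])
qed

text \<open>Bounds by real powers of \<open>norm (zvec \<xi>)\<close> for large \<open>\<xi>\<close>
  become bounds by natural powers of \<open>wt\<close>. Raising the radius to at least 1 ensures
  that rounding the exponent up only weakens the bound.\<close>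

lemma family_polyI:
  fixes w :: "int ^ 'n::finite \<Rightarrow> real \<Rightarrow> complex"
  assumes w: "\<And>\<xi>. torus_smooth (w \<xi>)"
    and bd: "\<And>\<alpha>. \<exists>C \<mu> R. \<forall>\<xi>. norm (zvec \<xi>) \<ge> R \<longrightarrow> (\<forall>t. cmod (t_deriv \<alpha> (w \<xi>) t) \<le> C * norm (zvec \<xi>) powr \<mu>)"
  shows "family poly_growth w"
  unfolding family_def
proof (intro conjI allI w)
  fix \<alpha>
  obtain C \<mu> R where C: "\<And>\<xi> t. norm (zvec \<xi>) \<ge> R \<Longrightarrow> cmod (t_deriv \<alpha> (w \<xi>) t) \<le> C * norm (zvec \<xi>) powr \<mu>"
    using bd[of \<alpha>] by blast
  show "dominated poly_growth (\<lambda>\<xi>. t_deriv \<alpha> (w \<xi>))"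
  proof (rule dominated_cofinite[OF growth_ideal_poly])
    show "(\<lambda>\<xi>. \<bar>C\<bar> * wt \<xi> ^ nat \<lceil>\<mu>\<rceil>) \<in> poly_growth" by (rule poly_growthI) (rule order_refl)
    show "cmod (t_deriv \<alpha> (w \<xi>) t) \<le> \<bar>C\<bar> * wt \<xi> ^ nat \<lceil>\<mu>\<rceil>" if R: "norm (zvec \<xi>) \<ge> max R 1" for \<xi> t
    proof -
      have "cmod (t_deriv \<alpha> (w \<xi>) t) \<le> C * norm (zvec \<xi>) powr \<mu>" using C R by simp
      also have "\<dots> \<le> \<bar>C\<bar> * norm (zvec \<xi>) powr \<mu>" by (intro mult_right_mono) simp_all
      also have "\<dots> \<le> \<bar>C\<bar> * wt \<xi> ^ nat \<lceil>\<mu>\<rceil>" using R by (intro mult_left_mono powr_norm_zvec_le) simp_all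
      finally show ?thesis .
    qed
  qed (simp_all add: torus_smooth_t_deriv w)
qed

lemma family_rapidI:
  fixes w :: "int ^ 'n::finite \<Rightarrow> real \<Rightarrow> complex"
  assumes w: "\<And>\<xi>. torus_smooth (w \<xi>)"
    and bd: "\<And>\<alpha> N. 0 < N \<Longrightarrow> \<exists>C R. \<forall>\<xi>. norm (zvec \<xi>) \<ge> R \<longrightarrow> (\<forall>t. cmod (t_deriv \<alpha> (w \<xi>) t) \<le> C * norm (zvec \<xi>) powr (- N))"
  shows "family rapid_decay w"
  unfolding family_def
proof (intro conjI allI w dominated_rapidI)
  fix \<alpha> N
  \<comment> \<open>\<open>Suc N\<close> keeps the exponent positive also for \<open>N = 0\<close>;
    the surplus power is discarded, since the norm is at least 1 in the case where the bound is
    applied.\<close>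
  obtain C R where C: "\<And>\<xi> t. norm (zvec \<xi>) \<ge> R \<Longrightarrow> cmod (t_deriv \<alpha> (w \<xi>) t) \<le> C * norm (zvec \<xi>) powr (- real (Suc N))"
    using bd[of "real (Suc N)" \<alpha>] by auto
  let ?R = "max R 1"
  let ?s = "\<lambda>\<xi>. (SUP t. cmod (t_deriv \<alpha> (w \<xi>) t)) * wt \<xi> ^ N"
  obtain K where K: "0 \<le> K" "\<And>\<xi>. \<xi> \<in> {\<xi>. norm (zvec \<xi>) < ?R} \<Longrightarrow> ?s \<xi> \<le> K"
    by (rule finite_max_bound[OF finite_small_zvec[of ?R], of ?s]) blast
  have "cmod (t_deriv \<alpha> (w \<xi>) t) * wt \<xi> ^ N \<le> \<bar>C\<bar> * 2 ^ N + K" for \<xi> t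
  proof (cases "norm (zvec \<xi>) < ?R")
    case True
    have "cmod (t_deriv \<alpha> (w \<xi>) t) \<le> (SUP t. cmod (t_deriv \<alpha> (w \<xi>) t))"
      by (rule cSUP_upper[OF UNIV_I torus_smooth_bdd_above[OF torus_smooth_t_deriv[OF w]]])
    then have "cmod (t_deriv \<alpha> (w \<xi>) t) * wt \<xi> ^ N \<le> ?s \<xi>" by (rule mult_right_mono) simp
    also have "\<dots> \<le> K" using K(2) True by simp
    finally show ?thesis by (simp add: add_increasing)
  next
    case False
    then have r: "1 \<le> norm (zvec \<xi>)" "R \<le> norm (zvec \<xi>)" by simp_all
    let ?r = "norm (zvec \<xi>)"
    have "cmod (t_deriv \<alpha> (w \<xi>) t) \<le> \<bar>C\<bar> * ?r powr (- real (Suc N))"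
      by (rule order_trans[OF C[OF r(2)] mult_right_mono]) simp_all
    also have "?r powr (- real (Suc N)) \<le> ?r powr (- real N)" using r(1) by (intro powr_mono) simp_all
    also have "?r powr (- real N) = inverse (?r ^ N)" 
      by (simp add: powr_minus powr_realpow[OF less_le_trans[OF zero_less_one r(1)]])
    finally have 1: "cmod (t_deriv \<alpha> (w \<xi>) t) \<le> \<bar>C\<bar> * inverse (?r ^ N)" by (simp add: mult_left_mono)
    have "wt \<xi> ^ N \<le> (2 * ?r) ^ N" using r(1) by (intro power_mono) (simp_all add: wt_def)
    with 1 have "cmod (t_deriv \<alpha> (w \<xi>) t) * wt \<xi> ^ N \<le> (\<bar>C\<bar> * inverse (?r ^ N)) * (2 * ?r) ^ N"
      by (intro mult_mono) simp_all
    also have "\<dots> = \<bar>C\<bar> * 2 ^ N"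
    proof -
      have "?r ^ N \<noteq> 0" using r(1) by auto
      then show ?thesis by (simp add: power_mult_distrib)
    qed
    finally show ?thesis using K(1) by simp
  qed
  then show "\<exists>C. \<forall>\<xi> t. cmod (t_deriv \<alpha> (w \<xi>) t) * wt \<xi> ^ N \<le> C" by blast
qed

lemma family_matrix_poly:
  fixes M :: "real \<Rightarrow> int ^ 'n::finite \<Rightarrow> complex ^ 'm::finite ^ 'm"
  assumes s: "smooth_matrix_symbol M" and b: "matrix_poly_bounded M"
  shows "family poly_growth (\<lambda>\<xi> t. M t \<xi> $ j $ k)"
proof (rule family_polyI)
  have sm: "torus_smooth (\<lambda>t. M t \<xi> $ j $ k)" for \<xi> j k
    using s unfolding smooth_matrix_symbol_def smooth_symbol_def by blast
  then show "torus_smooth (\<lambda>t. M t \<xi> $ j $ k)" for \<xi> .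
  fix \<alpha>
  obtain C R \<gamma> where C: "\<And>\<xi> t. norm (zvec \<xi>) \<ge> R \<Longrightarrow> norm (t_deriv \<alpha> (\<lambda>s. M s \<xi>) t) \<le> C * norm (zvec \<xi>) powr \<gamma>"
    using b unfolding matrix_poly_bounded_def by blast
  have "cmod (t_deriv \<alpha> (\<lambda>t. M t \<xi> $ j $ k) t) \<le> C * norm (zvec \<xi>) powr \<gamma>" if "norm (zvec \<xi>) \<ge> R" for \<xi> t
    by (rule order_trans[OF t_deriv_entry_le[OF sm] C[OF that]])
  then show "\<exists>C \<mu> R. \<forall>\<xi>. norm (zvec \<xi>) \<ge> R \<longrightarrow> (\<forall>t. cmod (t_deriv \<alpha> (\<lambda>t. M t \<xi> $ j $ k) t) \<le> C * norm (zvec \<xi>) powr \<mu>)"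
    by blast
qed

lemma family_matrix_rapid:
  fixes M :: "real \<Rightarrow> int ^ 'n::finite \<Rightarrow> complex ^ 'm::finite ^ 'm"
  assumes sm: "\<And>\<xi> j k. torus_smooth (\<lambda>t. M t \<xi> $ j $ k)" and b: "matrix_rapidly_decreasing M"
  shows "family rapid_decay (\<lambda>\<xi> t. M t \<xi> $ j $ k)"
proof (rule family_rapidI[OF sm])
  fix \<alpha> and N :: real assume "0 < N"
  then obtain C R where C: "\<And>\<xi> t. norm (zvec \<xi>) \<ge> R \<Longrightarrow> norm (t_deriv \<alpha> (\<lambda>s. M s \<xi>) t) \<le> C * norm (zvec \<xi>) powr (- N)"
    using b unfolding matrix_rapidly_decreasing_def by meson
  have "cmod (t_deriv \<alpha> (\<lambda>t. M t \<xi> $ j $ k) t) \<le> C * norm (zvec \<xi>) powr (- N)" if "norm (zvec \<xi>) \<ge> R" for \<xi> t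
    by (rule order_trans[OF t_deriv_entry_le[OF sm] C[OF that]])
  then show "\<exists>C R. \<forall>\<xi>. norm (zvec \<xi>) \<ge> R \<longrightarrow> (\<forall>t. cmod (t_deriv \<alpha> (\<lambda>t. M t \<xi> $ j $ k) t) \<le> C * norm (zvec \<xi>) powr (- N))"
    by blast
qed

lemma poly_growth_pdo:
  assumes "pdo_symbol a"
  shows "(\<lambda>\<xi>. cmod (a \<xi>)) \<in> poly_growth"
  by (rule pdo_symbol_wt[OF assms]) (rule poly_growthI)

lemma pdo_symbol_of_poly_growth:
  fixes a :: "int ^ 'n::finite \<Rightarrow> complex"
  assumes "g \<in> poly_growth" "\<And>\<xi>. cmod (a \<xi>) \<le> g \<xi>"
  shows "pdo_symbol a"
proof -
  obtain C N where C: "0 \<le> C" "\<And>\<xi>. g \<xi> \<le> C * wt \<xi> ^ N" by (rule poly_growthE[OF assms(1)]) blast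
  have "cmod (a \<xi>) \<le> (C * 2 ^ N + 1) * norm (zvec \<xi>) powr real N" if "\<xi> \<noteq> 0" for \<xi>
  proof -
    note r = norm_zvec_ge_1[OF that]
    have "cmod (a \<xi>) \<le> C * wt \<xi> ^ N" by (rule order_trans[OF assms(2) C(2)])
    also have "\<dots> \<le> C * (2 * norm (zvec \<xi>)) ^ N"
      using r by (intro mult_left_mono power_mono C) (simp_all add: wt_def)
    also have "\<dots> = C * 2 ^ N * norm (zvec \<xi>) ^ N" by (simp add: power_mult_distrib)
    also have "\<dots> \<le> (C * 2 ^ N + 1) * norm (zvec \<xi>) ^ N" by (intro mult_right_mono) simp_all
    also have "norm (zvec \<xi>) ^ N = norm (zvec \<xi>) powr real N"
      by (rule powr_realpow[symmetric]) (use r in linarith)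
    finally show ?thesis .
  qed
  moreover have "0 < C * 2 ^ N + 1" using C(1) by (simp add: add_nonneg_pos)
  ultimately show ?thesis unfolding pdo_symbol_def by blast
qed

text \<open>Polynomial growth of the nilpotent part is derived rather than assumed: it is the
  conjugate of the symbol by \<open>S\<close> minus the diagonal of eigenvalues, and all of these
  grow polynomially.\<close>

lemma strongly_triangularizable_system:
  fixes c :: "'m::{finite, linorder} \<Rightarrow> 'm \<Rightarrow> real \<Rightarrow> complex"
    and q :: "'m \<Rightarrow> 'm \<Rightarrow> int ^ 'n::finite \<Rightarrow> complex"
  assumes c: "\<And>j k. torus_smooth (c j k)" and q: "\<And>j k. pdo_symbol (q j k)"
    and st: "strongly_triangularizable (matrix_symbol c q) eig" and below: "diagonal_bounded_below eig"
  obtains S N where "triangular_system c q eig S N"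
proof -
  note T = growth_ideal_poly
  obtain S N where SN: "\<And>t \<xi>. invertible (S t \<xi>)"
    "\<And>t \<xi>. matrix_inv (S t \<xi>) ** matrix_symbol c q t \<xi> ** S t \<xi> = diag_mat (\<lambda>k. eig k t \<xi>) + N t \<xi>"
    "\<And>t \<xi>. strictly_upper_triangular (N t \<xi>)" "smooth_matrix_symbol S"
    "smooth_matrix_symbol (\<lambda>t \<xi>. matrix_inv (S t \<xi>))" "matrix_poly_bounded S"
    "matrix_poly_bounded (\<lambda>t \<xi>. matrix_inv (S t \<xi>))"
    "matrix_rapidly_decreasing (\<lambda>t \<xi>. matrix_inv (S t \<xi>) ** matrix_D_t (\<lambda>s. S s \<xi>) t)"
    using st unfolding strongly_triangularizable_def by blast
  have A: "condition_A (matrix_symbol c q) eig" using st unfolding strongly_triangularizable_def by blast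
  have S: "family poly_growth (\<lambda>\<xi> t. S t \<xi> $ j $ k)" for j k by (rule family_matrix_poly[OF SN(4,6)])
  have S': "family poly_growth (\<lambda>\<xi> t. matrix_inv (S t \<xi>) $ j $ k)" for j k by (rule family_matrix_poly[OF SN(5,7)])
  have eig: "family poly_growth (\<lambda>\<xi> t. eig k t \<xi>)" for k
  proof (rule family_polyI)
    show "torus_smooth (\<lambda>t. eig k t \<xi>)" for \<xi> using A unfolding condition_A_def smooth_symbol_def by blast
    show "\<exists>C \<mu> R. \<forall>\<xi>. norm (zvec \<xi>) \<ge> R \<longrightarrow> (\<forall>t. cmod (t_deriv \<alpha> (\<lambda>t. eig k t \<xi>) t) \<le> C * norm (zvec \<xi>) powr \<mu>)" for \<alpha>
      using A unfolding condition_A_def by blast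
  qed
  \<comment> \<open>Gives the smoothness of the entries of \<open>B\<close>, from which the decay
    hypothesis then makes a rapidly decaying family.\<close>
  have B: "family poly_growth (\<lambda>\<xi> t. (matrix_inv (S t \<xi>) ** matrix_D_t (\<lambda>s. S s \<xi>) t) $ j $ k)" for j k
    unfolding matrix_matrix_mult_def matrix_D_t_def vec_lambda_beta
    by (intro family_matrix_vector[where w = "\<lambda>i \<xi>. D_t (\<lambda>s. S s \<xi> $ i $ k)"] T S' family_D_t S)
  have Q: "family poly_growth (\<lambda>\<xi> t. matrix_symbol c q t \<xi> $ j $ k)" for j k
    unfolding matrix_symbol_def vec_lambda_beta
    by (rule family_mult[OF T family_independent[OF c] family_const[OF T poly_growth_pdo[OF q]]])
  have diag: "family poly_growth (\<lambda>\<xi> t. diag_mat (\<lambda>k. eig k t \<xi>) $ j $ k)" for j k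
    by (cases "j = k") (simp_all add: diag_mat_def eig family_zero T)
  have N: "family poly_growth (\<lambda>\<xi> t. N t \<xi> $ j $ k)" for j k
  proof -
    have "N t \<xi> $ j $ k = (matrix_inv (S t \<xi>) ** matrix_symbol c q t \<xi> ** S t \<xi>) $ j $ k - diag_mat (\<lambda>k. eig k t \<xi>) $ j $ k" for t \<xi>
      unfolding SN(2) by simp
    moreover have "family poly_growth (\<lambda>\<xi> t. (matrix_inv (S t \<xi>) ** matrix_symbol c q t \<xi> ** S t \<xi>) $ j $ k)"
      unfolding matrix_matrix_mult_def vec_lambda_beta
      by (intro family_sum family_mult T S S' Q)
    ultimately show ?thesis using family_diff[OF T _ diag] by simp
  qed
  have "triangular_system c q eig S N"
  proof
    show "family rapid_decay (\<lambda>\<xi> t. (matrix_inv (S t \<xi>) ** matrix_D_t (\<lambda>s. S s \<xi>) t) $ j $ k)" for j k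
      by (rule family_matrix_rapid[OF family_smooth[OF B] SN(8)])
  qed (fact SN eig N S S' below)+
  then show thesis by (rule that)
qed

section \<open>The diagonal system of means\<close>

lemma t_mean_const: "t_mean (\<lambda>t. a) = a"
  by (rule ext) (simp add: t_mean_def scaleR_conv_of_real)

text \<open>Averaging preserves the lower bound, so the diagonal system satisfies the hypotheses of
  the triangular theory as well.\<close>

lemma t_mean_bound_below:
  assumes eig: "\<And>\<xi>. torus_smooth (\<lambda>t. eig t \<xi>)" and \<theta>: "\<And>t. Im (eig t \<xi>) \<ge> - \<theta>"
  shows "Im (t_mean eig \<xi>) \<ge> - \<theta>"
proof -
  have int: "(\<lambda>t. eig t \<xi>) integrable_on {0..2 * pi}"
    by (intro integrable_continuous_real torus_smooth_continuous eig)
  have Im: "Im (integral {0..2 * pi} (\<lambda>t. eig t \<xi>)) = integral {0..2 * pi} (\<lambda>t. Im (eig t \<xi>))"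
    using integral_linear[OF int bounded_linear_Im] by (simp add: o_def)
  have "integral {0..2 * pi} (\<lambda>t. - \<theta>) \<le> integral {0..2 * pi} (\<lambda>t. Im (eig t \<xi>))"
    using integrable_linear[OF int bounded_linear_Im] \<theta>
    by (intro integral_le integrable_const_ivl) (simp_all add: o_def)
  then have "- \<theta> * (2 * pi) \<le> Im (integral {0..2 * pi} (\<lambda>t. eig t \<xi>))"
    unfolding Im by (simp add: mult.commute)
  then have "- \<theta> \<le> Im (integral {0..2 * pi} (\<lambda>t. eig t \<xi>)) / (2 * pi)"
    by (subst pos_le_divide_eq) simp_all
  also have "\<dots> = Im (t_mean eig \<xi>)"
    unfolding t_mean_def using Im_divide_of_real[of _ "2 * pi"] by simp
  finally show ?thesis .
qed

lemma cmod_t_mean_le: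
  assumes eig: "\<And>\<xi>. torus_smooth (\<lambda>t. eig t \<xi>)" and B: "\<And>t. cmod (eig t \<xi>) \<le> B"
  shows "cmod (t_mean eig \<xi>) \<le> B"
proof -
  have "cmod (integral torus_cell (\<lambda>t. eig t \<xi>)) \<le> B * (2 * pi) ^ DIM(real)"
    by (rule integral_torus_bound[OF torus_smooth_continuous[OF eig] B])
  then show ?thesis by (simp add: t_mean_def norm_divide norm_mult pos_divide_le_eq)
qed

lemma matrix_D_t_const: "matrix_D_t (\<lambda>s. A) t = 0"
  by (simp add: matrix_D_t_def D_t_def vec_eq_iff)

text \<open>For a constant \<open>S\<close> the matrix \<open>B\<close> vanishes, and the means
  inherit growth and lower bound from the eigenvalues.\<close>

lemma diagonal_system:
  fixes eig :: "'m::{finite, linorder} \<Rightarrow> real \<Rightarrow> int ^ 'n::finite \<Rightarrow> complex"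
  assumes eig: "\<And>k. family poly_growth (\<lambda>\<xi> t. eig k t \<xi>)" and below: "diagonal_bounded_below eig"
  shows "triangular_system (\<lambda>j k t. 1) (\<lambda>j k. if j = k then t_mean (eig k) else (\<lambda>\<xi>. 0))
    (\<lambda>k t. t_mean (eig k)) (\<lambda>t \<xi>. mat 1) (\<lambda>t \<xi>. 0)"
    and "pdo_symbol (t_mean (eig k))"
proof -
  note T = growth_ideal_poly
  have sm: "torus_smooth (\<lambda>t. eig k t \<xi>)" for k \<xi> by (rule family_smooth[OF eig])
  have mean: "\<exists>g\<in>poly_growth. \<forall>\<xi>. cmod (t_mean (eig k) \<xi>) \<le> g \<xi>" for k
  proof -
    obtain g where "g \<in> poly_growth" "\<And>\<xi> t. cmod (eig k t \<xi>) \<le> g \<xi>"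
      by (rule dominatedE[OF family_dominated[OF eig[of k]]]) blast
    then show ?thesis using cmod_t_mean_le[of "eig k", OF sm] by blast
  qed
  then show pdo: "pdo_symbol (t_mean (eig k))" for k using pdo_symbol_of_poly_growth by blast
  have inv1: "invertible (mat 1 :: complex ^ ('m::{finite, linorder}) ^ ('m::{finite, linorder}))"
    unfolding invertible_def by (intro exI[of _ "mat 1"]) simp
  have one: "matrix_inv (mat 1 :: complex ^ ('m::{finite, linorder}) ^ ('m::{finite, linorder})) = mat 1"
    using matrix_inv_cancel(1)[OF inv1] by simp
  have const: "family poly_growth (\<lambda>\<xi> t. (mat 1 :: complex ^ ('m::{finite, linorder}) ^ ('m::{finite, linorder})) $ j $ k)" for j k
    by (rule family_const[OF T poly_growth_const])
  show "triangular_system (\<lambda>j k t. 1) (\<lambda>j k. if j = k then t_mean (eig k) else (\<lambda>\<xi>. 0))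
    (\<lambda>k t. t_mean (eig k)) (\<lambda>t \<xi>. mat 1) (\<lambda>t \<xi>. 0)"
  proof
    show "diagonal_bounded_below (\<lambda>k t. t_mean (eig k))"
      unfolding diagonal_bounded_below_def
    proof
      fix k
      obtain \<theta> where "0 < \<theta>" "\<And>t \<xi>. Im (eig k t \<xi>) \<ge> - \<theta>"
        using below[unfolded diagonal_bounded_below_def, THEN spec, of k] by blast
      then show "\<exists>\<theta>>0. \<forall>t \<xi>. Im (t_mean (eig k) \<xi>) \<ge> - \<theta>"
        using t_mean_bound_below[of "eig k", OF sm] by blast
    qed
    show "family poly_growth (\<lambda>\<xi> t. t_mean (eig k) \<xi>)" for k
      by (rule family_const[OF T poly_growth_pdo[OF pdo]])
    show "matrix_inv (mat 1) ** matrix_symbol (\<lambda>j k t. 1) (\<lambda>j k. if j = k then t_mean (eig k) else (\<lambda>\<xi>. 0)) t \<xi> ** mat 1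
        = diag_mat (\<lambda>k. t_mean (eig k) \<xi>) + 0" for t \<xi>
      by (simp add: one matrix_symbol_def diag_mat_def vec_eq_iff)
    show "strictly_upper_triangular (0 :: complex ^ ('m::{finite, linorder}) ^ ('m::{finite, linorder}))"
      by (simp add: strictly_upper_triangular_def)
    show "family rapid_decay (\<lambda>\<xi> t. (matrix_inv (mat 1) ** matrix_D_t (\<lambda>s. mat 1 :: complex ^ ('m::{finite, linorder}) ^ ('m::{finite, linorder})) t) $ j $ k)" for j k
      by (simp add: matrix_D_t_const family_zero growth_ideal_rapid)
  qed (simp_all add: one inv1 const family_zero T)
qed

text \<open>The zero symbol annihilates every distribution, so the off-diagonal terms disappear and
  the diagonal system is an instance of the general one with all coefficients equal to 1.\<close>

lemma diag_system_eq_system_op: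
  fixes a :: "'m::finite \<Rightarrow> int ^ 'n::finite \<Rightarrow> complex"
  shows "diag_system (\<lambda>k. scalar_op (a k)) = system_op (\<lambda>j k t. 1) (\<lambda>j k. if j = k then a k else (\<lambda>\<xi>. 0))"
proof (intro ext)
  fix u :: "'m \<Rightarrow> 'n distr" and j \<phi>
  have "distr_mult (\<lambda>t. 1) (distr_pdo (if j = k then a k else (\<lambda>\<xi>. 0)) (u k)) \<phi> =
      (if k = j then distr_pdo (a j) (u j) \<phi> else 0)" for k
    by (auto simp: distr_mult_def distr_pdo_def)
  then show "diag_system (\<lambda>k. scalar_op (a k)) u j \<phi> =
      system_op (\<lambda>j k t. 1) (\<lambda>j k. if j = k then a k else (\<lambda>\<xi>. 0)) u j \<phi>"
    by (simp add: diag_system_def scalar_op_def system_op_def)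
qed

theorem theorem3p14:
  fixes c :: "'m::{finite, linorder} \<Rightarrow> 'm \<Rightarrow> real \<Rightarrow> complex"
    and q :: "'m \<Rightarrow> 'm \<Rightarrow> int ^ 'n \<Rightarrow> complex"
    and eig :: "'m \<Rightarrow> real \<Rightarrow> int ^ 'n \<Rightarrow> complex"
  assumes "\<And>j k. torus_smooth (c j k)"
    and "\<And>j k. pdo_symbol (q j k)"
    and "strongly_triangularizable (matrix_symbol c q) eig"
    and "diagonal_bounded_below eig"
  shows "globally_hypoelliptic (system_op c q) \<longleftrightarrow>
         globally_hypoelliptic (diag_system (\<lambda>k. scalar_op (t_mean (eig k))))"
proof -
  obtain S N where "triangular_system c q eig S N"
    by (rule strongly_triangularizable_system[OF assms])
  then interpret P: triangular_system c q eig S N .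
  let ?q = "\<lambda>j k. if j = k then t_mean (eig k) else (\<lambda>\<xi>. 0)"
  interpret L: triangular_system "\<lambda>j k t. 1" ?q "\<lambda>k t. t_mean (eig k)" "\<lambda>t \<xi>. mat 1" "\<lambda>t \<xi>. 0"
    by (rule diagonal_system(1)[OF P.fam_eig assms(4)])
  have q0: "pdo_symbol (?q j k)" for j k
  proof (cases "j = k")
    case True
    then show ?thesis using diagonal_system(2)[OF P.fam_eig assms(4)] by simp
  next
    case False
    then show ?thesis by (auto simp: pdo_symbol_def intro!: exI[of _ 1])
  qed
  have "globally_hypoelliptic (system_op c q) \<longleftrightarrow> (\<forall>k. nonresonant (t_mean (eig k)))"
    using globally_hypoelliptic_iff_family[of c q, OF assms(1,2)] P.hypoelliptic_iff_nonresonant by blast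
  \<comment> \<open>The diagonal system has the means as its eigenvalues and each is its own mean,
    so the same non-resonance conditions appear.\<close>
  moreover have "globally_hypoelliptic (system_op (\<lambda>j k t. 1) ?q) \<longleftrightarrow> (\<forall>k. nonresonant (t_mean (eig k)))"
    using globally_hypoelliptic_iff_family[of "\<lambda>j k t. 1" ?q, OF torus_smooth_const q0]
      L.hypoelliptic_iff_nonresonant by (simp add: t_mean_const)
  ultimately show ?thesis unfolding diag_system_eq_system_op by simp
qed

end
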